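(* For quantum sets $A$ and $B$, the category $\mathrm{QSet}(A,B)$ of quantum functions $A\to B$ and intertwiners is a semisimple dagger category.
   Context: All Hilbert spaces are finite-dimensional and complex; coherence isomorphisms of $\otimes$ are suppressed. A quantum set is a special symmetric dagger Frobenius algebra: a Hilbert space $A$ with linear maps $m_A:A\otimes A\to A$, $u_A:\mathbb{C}\to A$ forming an associative unital algebra such that, writing $\Delta_A=m_A^\dagger$, $\epsilon_A=u_A^\dagger$, one has $(m_A\otimes \mathrm{id})(\mathrm{id}\otimes\Delta_A)=\Delta_A m_A=(\mathrm{id}\otimes m_A)(\Delta_A\otimes\mathrm{id})$, $m_A\Delta_A=\mathrm{id}_A$, and $\epsilon_A m_A\sigma=\epsilon_A m_A$ with $\sigma$ the swap map. A quantum function $(H,P):A\to B$ is a Hilbert space $H$ and a linear map $P:H\otimes A\to B\otimes H$ such that (i) $(\Delta_B\otimes\mathrm{id}_H)P=(\mathrm{id}_B\otimes P)(P\otimes \mathrm{id}_A)(\mathrm{id}_H\otimes\Delta_A)$; (ii) $(\epsilon_B\otimes\mathrm{id}_H)P=\mathrm{id}_H\otimes\epsilon_A$; (iii) $P^\dagger=(\epsilon_Bm_B\otimes\mathrm{id}_H\otimes\mathrm{id}_A)(\mathrm{id}_B\otimes P\otimes\mathrm{id}_A)(\mathrm{id}_B\otimes\mathrm{id}_H\otimes\Delta_Au_A)$. $\mathrm{QSet}(A,B)$ has these as objects; a morphism (intertwiner) $(H,P)\to(H',P')$ is a linear map $f:H\to H'$ with $(\mathrm{id}_B\otimes f)P=P'(f\otimes\mathrm{id}_A)$.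 The dagger of an intertwiner is its Hilbert space adjoint. A linear dagger category is a dagger category enriched in finite-dimensional complex vector spaces such that $\dagger:\mathrm{Hom}(X,Y)\to\mathrm{Hom}(Y,X)$ is antilinear. A semisimple dagger category is a linear dagger category such that: 1. it is positive: $r^\dagger r=0$ implies $r=0$ for every morphism $r$; 2. it has a zero object (every object has a unique morphism into and out of it); 3. it has binary direct sums: for objects $X_1,X_2$ there are an object $X_1\oplus X_2$ and morphisms $s_i:X_i\to X_1\oplus X_2$ with $s_i^\dagger s_i=\mathrm{id}_{X_i}$ ($i=1,2$) and $s_1s_1^\dagger+s_2s_2^\dagger=\mathrm{id}_{X_1\oplus X_2}$; 4. all dagger idempotents split: for every $p\in\mathrm{End}(X)$ with $p^2=p=p^\dagger$ there is $i:A\to X$ with $i^\dagger i=\mathrm{id}_A$ and $ii^\dagger=p$. *)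

theory Defs
  imports Complex_Main "Jordan_Normal_Form.VS_Connect"
begin

section \<open>Finite-dimensional Hilbert spaces and linear maps\<close>

text \<open>
  Spaces are carrier-based, extending the HOL-Algebra record of modules, so that Hilbert spaces
  of different dimensions can live in one type. As usual for modules in HOL-Algebra, the record
  fields \<open>mult\<close> and \<open>one\<close> play no role. The inner product is antilinear in its first argument.
\<close>

record 'a hilb = "(complex, 'a) module" +
  inner :: "'a \<Rightarrow> 'a \<Rightarrow> complex"

locale fd_hilbert_space = vectorspace "class_ring :: complex ring" H
  for H :: "'a hilb" (structure) +
  assumes finite_dimensional: "fin_dim"
    and inner_add_right: "\<lbrakk>x \<in> carrier H; y \<in> carrier H; z \<in> carrier H\<rbrakk>
      \<Longrightarrow> inner H x (y \<oplus> z) = inner H x y + inner H x z"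
    and inner_smult_right: "\<lbrakk>x \<in> carrier H; y \<in> carrier H\<rbrakk>
      \<Longrightarrow> inner H x (c \<odot> y) = c * inner H x y"
    and inner_commute: "\<lbrakk>x \<in> carrier H; y \<in> carrier H\<rbrakk>
      \<Longrightarrow> inner H y x = cnj (inner H x y)"
    and inner_pos: "\<lbrakk>x \<in> carrier H; x \<noteq> \<zero>\<rbrakk> \<Longrightarrow> Re (inner H x x) > 0"

definition complex_hilb :: "complex hilb" where
  "complex_hilb = \<lparr>carrier = UNIV, mult = (*), one = 1, zero = 0, add = (+), smult = (*),
     inner = (\<lambda>x y. cnj x * y)\<rparr>"

text \<open>
  A linear map carries its domain and codomain. Its underlying function is extensional
  (\<open>undefined\<close> outside the domain), so that equality of linear maps is equality of records.
\<close>

record ('a, 'b) linmap =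
  dom :: "'a hilb"
  cod :: "'b hilb"
  fn :: "'a \<Rightarrow> 'b"

definition Lin :: "'a hilb \<Rightarrow> 'b hilb \<Rightarrow> ('a, 'b) linmap set" where
  "Lin H K = {f. dom f = H \<and> cod f = K \<and>
     fn f \<in> LinearCombinations.module_hom class_ring H K \<inter> extensional (carrier H)}"

definition lid :: "'a hilb \<Rightarrow> ('a, 'a) linmap" where
  "lid H = \<lparr>dom = H, cod = H, fn = restrict (\<lambda>x. x) (carrier H)\<rparr>"

definition lcomp :: "('b, 'c) linmap \<Rightarrow> ('a, 'b) linmap \<Rightarrow> ('a, 'c) linmap"
    (infixl "\<circ>\<^sub>l" 60) where
  "g \<circ>\<^sub>l f = \<lparr>dom = dom f, cod = cod g, fn = compose (carrier (dom f)) (fn g) (fn f)\<rparr>"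

definition adj :: "('a, 'b) linmap \<Rightarrow> ('b, 'a) linmap" ("_\<^sup>\<dagger>" [1000] 999) where
  "f\<^sup>\<dagger> = (THE g. g \<in> Lin (cod f) (dom f) \<and>
     (\<forall>x \<in> carrier (dom f). \<forall>y \<in> carrier (cod f).
        inner (dom f) (fn g y) x = inner (cod f) y (fn f x)))"


section \<open>Tensor products\<close>

text \<open>
  \<open>x \<otimes> y\<close> is realised as the form \<open>(a, b) \<mapsto> \<langle>a, x\<rangle> \<langle>b, y\<rangle>\<close> on \<open>H \<times> K\<close>, antilinear in both
  arguments and extended by \<open>0\<close> outside the carriers; \<open>H \<otimes> K\<close> is the linear span of these forms.
  Nondegeneracy of the inner products makes this a model of the algebraic tensor product.
\<close>

definition etensor :: "'a hilb \<Rightarrow> 'b hilb \<Rightarrow> 'a \<Rightarrow> 'b \<Rightarrow> ('a \<times> 'b \<Rightarrow> complex)" where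
  "etensor H K x y = (\<lambda>(a, b). if a \<in> carrier H \<and> b \<in> carrier K
     then inner H a x * inner K b y else 0)"

definition tensor_rep :: "'a hilb \<Rightarrow> 'b hilb \<Rightarrow> nat \<Rightarrow> (nat \<Rightarrow> 'a) \<Rightarrow> (nat \<Rightarrow> 'b)
    \<Rightarrow> ('a \<times> 'b \<Rightarrow> complex) \<Rightarrow> bool" where
  "tensor_rep H K n x y \<phi> \<longleftrightarrow> (\<forall>i<n. x i \<in> carrier H \<and> y i \<in> carrier K) \<and>
     \<phi> = (\<lambda>p. \<Sum>i<n. etensor H K (x i) (y i) p)"

text \<open>
  The inner product is determined by \<open>\<langle>x \<otimes> y, x' \<otimes> y'\<rangle> = \<langle>x, x'\<rangle> \<langle>y, y'\<rangle>\<close>; the number below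
  does not depend on the chosen representations as sums of elementary tensors.
\<close>

definition tensor_inner :: "'a hilb \<Rightarrow> 'b hilb
    \<Rightarrow> ('a \<times> 'b \<Rightarrow> complex) \<Rightarrow> ('a \<times> 'b \<Rightarrow> complex) \<Rightarrow> complex" where
  "tensor_inner H K \<phi> \<psi> = (THE c. \<exists>n x y n' x' y'.
     tensor_rep H K n x y \<phi> \<and> tensor_rep H K n' x' y' \<psi> \<and>
     c = (\<Sum>i<n. \<Sum>j<n'. inner H (x i) (x' j) * inner K (y i) (y' j)))"

definition tensor :: "'a hilb \<Rightarrow> 'b hilb \<Rightarrow> ('a \<times> 'b \<Rightarrow> complex) hilb" (infixr "\<otimes>\<^sub>h" 70) where
  "H \<otimes>\<^sub>h K = \<lparr>carrier = {\<phi>. \<exists>n x y. tensor_rep H K n x y \<phi>},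
     mult = undefined, one = undefined,
     zero = (\<lambda>p. 0), add = (\<lambda>\<phi> \<psi> p. \<phi> p + \<psi> p), smult = (\<lambda>c \<phi> p. c * \<phi> p),
     inner = tensor_inner H K\<rparr>"

definition ltensor :: "('a, 'c) linmap \<Rightarrow> ('b, 'd) linmap
    \<Rightarrow> ('a \<times> 'b \<Rightarrow> complex, 'c \<times> 'd \<Rightarrow> complex) linmap" (infixr "\<otimes>\<^sub>l" 70) where
  "f \<otimes>\<^sub>l g = (THE F. F \<in> Lin (dom f \<otimes>\<^sub>h dom g) (cod f \<otimes>\<^sub>h cod g) \<and>
     (\<forall>x \<in> carrier (dom f). \<forall>y \<in> carrier (dom g).
        fn F (etensor (dom f) (dom g) x y) = etensor (cod f) (cod g) (fn f x) (fn g y)))"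

text \<open>
  The coherence isomorphisms \<open>(H \<otimes> K) \<otimes> L \<cong> H \<otimes> (K \<otimes> L)\<close>, \<open>\<complex> \<otimes> H \<cong> H\<close>, \<open>H \<otimes> \<complex> \<cong> H\<close> and the
  swap \<open>H \<otimes> K \<cong> K \<otimes> H\<close>.
\<close>

definition assoc :: "'a hilb \<Rightarrow> 'b hilb \<Rightarrow> 'c hilb
    \<Rightarrow> (('a \<times> 'b \<Rightarrow> complex) \<times> 'c \<Rightarrow> complex, 'a \<times> ('b \<times> 'c \<Rightarrow> complex) \<Rightarrow> complex) linmap" where
  "assoc H K L = (THE F. F \<in> Lin ((H \<otimes>\<^sub>h K) \<otimes>\<^sub>h L) (H \<otimes>\<^sub>h (K \<otimes>\<^sub>h L)) \<and>
     (\<forall>x \<in> carrier H. \<forall>y \<in> carrier K. \<forall>z \<in> carrier L.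
        fn F (etensor (H \<otimes>\<^sub>h K) L (etensor H K x y) z) =
        etensor H (K \<otimes>\<^sub>h L) x (etensor K L y z)))"

definition assoc_inv :: "'a hilb \<Rightarrow> 'b hilb \<Rightarrow> 'c hilb
    \<Rightarrow> ('a \<times> ('b \<times> 'c \<Rightarrow> complex) \<Rightarrow> complex, ('a \<times> 'b \<Rightarrow> complex) \<times> 'c \<Rightarrow> complex) linmap" where
  "assoc_inv H K L = (THE F. F \<in> Lin (H \<otimes>\<^sub>h (K \<otimes>\<^sub>h L)) ((H \<otimes>\<^sub>h K) \<otimes>\<^sub>h L) \<and>
     (\<forall>x \<in> carrier H. \<forall>y \<in> carrier K. \<forall>z \<in> carrier L.
        fn F (etensor H (K \<otimes>\<^sub>h L) x (etensor K L y z)) =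
        etensor (H \<otimes>\<^sub>h K) L (etensor H K x y) z))"

definition lunit :: "'a hilb \<Rightarrow> (complex \<times> 'a \<Rightarrow> complex, 'a) linmap" where
  "lunit H = (THE F. F \<in> Lin (complex_hilb \<otimes>\<^sub>h H) H \<and>
     (\<forall>c. \<forall>x \<in> carrier H. fn F (etensor complex_hilb H c x) = c \<odot>\<^bsub>H\<^esub> x))"

definition runit :: "'a hilb \<Rightarrow> ('a \<times> complex \<Rightarrow> complex, 'a) linmap" where
  "runit H = (THE F. F \<in> Lin (H \<otimes>\<^sub>h complex_hilb) H \<and>
     (\<forall>x \<in> carrier H. \<forall>c. fn F (etensor H complex_hilb x c) = c \<odot>\<^bsub>H\<^esub> x))"

definition runit_inv :: "'a hilb \<Rightarrow> ('a, 'a \<times> complex \<Rightarrow> complex) linmap" where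
  "runit_inv H = \<lparr>dom = H, cod = H \<otimes>\<^sub>h complex_hilb,
     fn = restrict (\<lambda>x. etensor H complex_hilb x 1) (carrier H)\<rparr>"

definition swap :: "'a hilb \<Rightarrow> 'b hilb
    \<Rightarrow> ('a \<times> 'b \<Rightarrow> complex, 'b \<times> 'a \<Rightarrow> complex) linmap" where
  "swap H K = (THE F. F \<in> Lin (H \<otimes>\<^sub>h K) (K \<otimes>\<^sub>h H) \<and>
     (\<forall>x \<in> carrier H. \<forall>y \<in> carrier K. fn F (etensor H K x y) = etensor K H y x))"


section \<open>Quantum sets and quantum functions\<close>

record 'a frob =
  sp :: "'a hilb"
  mul :: "('a \<times> 'a \<Rightarrow> complex, 'a) linmap"
  unt :: "(complex, 'a) linmap"

definition comul :: "'a frob \<Rightarrow> ('a, 'a \<times> 'a \<Rightarrow> complex) linmap" where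
  "comul A = (mul A)\<^sup>\<dagger>"

definition counit :: "'a frob \<Rightarrow> ('a, complex) linmap" where
  "counit A = (unt A)\<^sup>\<dagger>"

definition quantum_set :: "'a frob \<Rightarrow> bool" where
  "quantum_set A \<longleftrightarrow> (let S = sp A; m = mul A; u = unt A; \<Delta> = comul A; \<epsilon> = counit A in
     fd_hilbert_space S \<and> m \<in> Lin (S \<otimes>\<^sub>h S) S \<and> u \<in> Lin complex_hilb S \<and>
     \<comment> \<open>associative unital algebra\<close>
     m \<circ>\<^sub>l (m \<otimes>\<^sub>l lid S) = m \<circ>\<^sub>l (lid S \<otimes>\<^sub>l m) \<circ>\<^sub>l assoc S S S \<and>
     m \<circ>\<^sub>l (u \<otimes>\<^sub>l lid S) = lunit S \<and>
     m \<circ>\<^sub>l (lid S \<otimes>\<^sub>l u) = runit S \<and>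
     \<comment> \<open>Frobenius\<close>
     (m \<otimes>\<^sub>l lid S) \<circ>\<^sub>l assoc_inv S S S \<circ>\<^sub>l (lid S \<otimes>\<^sub>l \<Delta>) = \<Delta> \<circ>\<^sub>l m \<and>
     \<Delta> \<circ>\<^sub>l m = (lid S \<otimes>\<^sub>l m) \<circ>\<^sub>l assoc S S S \<circ>\<^sub>l (\<Delta> \<otimes>\<^sub>l lid S) \<and>
     \<comment> \<open>special\<close>
     m \<circ>\<^sub>l \<Delta> = lid S \<and>
     \<comment> \<open>symmetric\<close>
     \<epsilon> \<circ>\<^sub>l m \<circ>\<^sub>l swap S S = \<epsilon> \<circ>\<^sub>l m)"

text \<open>
  In the third condition, read the right-hand side from the bottom up:
  \<open>B H \<rightarrow> (B H) \<complex> \<rightarrow> (B H)(A A) \<rightarrow> ((B H) A) A \<rightarrow> (B (H A)) A \<rightarrow> (B (B H)) A \<rightarrow> ((B B) H) A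
   \<rightarrow> (B B)(H A) \<rightarrow> \<complex> (H A) \<rightarrow> H A\<close>.
\<close>

definition quantum_function :: "'a frob \<Rightarrow> 'b frob \<Rightarrow> 'h hilb
    \<Rightarrow> ('h \<times> 'a \<Rightarrow> complex, 'b \<times> 'h \<Rightarrow> complex) linmap \<Rightarrow> bool" where
  "quantum_function A B H P \<longleftrightarrow> (let S = sp A; T = sp B in
     fd_hilbert_space H \<and> P \<in> Lin (H \<otimes>\<^sub>h S) (T \<otimes>\<^sub>h H) \<and>
     (comul B \<otimes>\<^sub>l lid H) \<circ>\<^sub>l P =
       assoc_inv T T H \<circ>\<^sub>l (lid T \<otimes>\<^sub>l P) \<circ>\<^sub>l assoc T H S \<circ>\<^sub>l (P \<otimes>\<^sub>l lid S) \<circ>\<^sub>l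
       assoc_inv H S S \<circ>\<^sub>l (lid H \<otimes>\<^sub>l comul A) \<and>
     lunit H \<circ>\<^sub>l (counit B \<otimes>\<^sub>l lid H) \<circ>\<^sub>l P = runit H \<circ>\<^sub>l (lid H \<otimes>\<^sub>l counit A) \<and>
     P\<^sup>\<dagger> =
       lunit (H \<otimes>\<^sub>h S) \<circ>\<^sub>l
       ((counit B \<circ>\<^sub>l mul B) \<otimes>\<^sub>l lid (H \<otimes>\<^sub>h S)) \<circ>\<^sub>l
       assoc (T \<otimes>\<^sub>h T) H S \<circ>\<^sub>l
       (assoc_inv T T H \<otimes>\<^sub>l lid S) \<circ>\<^sub>l
       ((lid T \<otimes>\<^sub>l P) \<otimes>\<^sub>l lid S) \<circ>\<^sub>l
       (assoc T H S \<otimes>\<^sub>l lid S) \<circ>\<^sub>l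
       assoc_inv (T \<otimes>\<^sub>h H) S S \<circ>\<^sub>l
       (lid (T \<otimes>\<^sub>h H) \<otimes>\<^sub>l (comul A \<circ>\<^sub>l unt A)) \<circ>\<^sub>l
       runit_inv (T \<otimes>\<^sub>h H))"

definition intertwiners :: "'a frob \<Rightarrow> 'b frob
    \<Rightarrow> 'h hilb \<times> ('h \<times> 'a \<Rightarrow> complex, 'b \<times> 'h \<Rightarrow> complex) linmap
    \<Rightarrow> 'h hilb \<times> ('h \<times> 'a \<Rightarrow> complex, 'b \<times> 'h \<Rightarrow> complex) linmap \<Rightarrow> ('h, 'h) linmap set" where
  "intertwiners A B = (\<lambda>(H, P) (H', P').
     {f \<in> Lin H H'. (lid (sp B) \<otimes>\<^sub>l f) \<circ>\<^sub>l P = P' \<circ>\<^sub>l (f \<otimes>\<^sub>l lid (sp A))})"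


section \<open>Semisimple dagger categories\<close>

text \<open>
  Hom-sets come as vector spaces (the \<open>carrier\<close> of \<open>Hom C X Y\<close> is the set of morphisms from \<open>X\<close>
  to \<open>Y\<close>).
\<close>

record ('o, 'm) dcat =
  Obj :: "'o set"
  Hom :: "'o \<Rightarrow> 'o \<Rightarrow> (complex, 'm) module"
  Ident :: "'o \<Rightarrow> 'm"
  Comp :: "'m \<Rightarrow> 'm \<Rightarrow> 'm" (infixl "\<star>\<index>" 70)
  Dag :: "'m \<Rightarrow> 'm"

locale dagger_category =
  fixes C :: "('o, 'm) dcat" (structure)
  assumes ident_in: "X \<in> Obj C \<Longrightarrow> Ident C X \<in> carrier (Hom C X X)"
    and comp_in: "\<lbrakk>X \<in> Obj C; Y \<in> Obj C; Z \<in> Obj C; f \<in> carrier (Hom C X Y);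
      g \<in> carrier (Hom C Y Z)\<rbrakk> \<Longrightarrow> g \<star> f \<in> carrier (Hom C X Z)"
    and comp_ident: "\<lbrakk>X \<in> Obj C; Y \<in> Obj C; f \<in> carrier (Hom C X Y)\<rbrakk> \<Longrightarrow> f \<star> Ident C X = f"
    and ident_comp: "\<lbrakk>X \<in> Obj C; Y \<in> Obj C; f \<in> carrier (Hom C X Y)\<rbrakk> \<Longrightarrow> Ident C Y \<star> f = f"
    and comp_assoc: "\<lbrakk>W \<in> Obj C; X \<in> Obj C; Y \<in> Obj C; Z \<in> Obj C; f \<in> carrier (Hom C W X);
      g \<in> carrier (Hom C X Y); h \<in> carrier (Hom C Y Z)\<rbrakk> \<Longrightarrow> (h \<star> g) \<star> f = h \<star> (g \<star> f)"
    and dag_in: "\<lbrakk>X \<in> Obj C; Y \<in> Obj C; f \<in> carrier (Hom C X Y)\<rbrakk>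
      \<Longrightarrow> Dag C f \<in> carrier (Hom C Y X)"
    and dag_ident: "X \<in> Obj C \<Longrightarrow> Dag C (Ident C X) = Ident C X"
    and dag_comp: "\<lbrakk>X \<in> Obj C; Y \<in> Obj C; Z \<in> Obj C; f \<in> carrier (Hom C X Y);
      g \<in> carrier (Hom C Y Z)\<rbrakk> \<Longrightarrow> Dag C (g \<star> f) = Dag C f \<star> Dag C g"
    and dag_dag: "\<lbrakk>X \<in> Obj C; Y \<in> Obj C; f \<in> carrier (Hom C X Y)\<rbrakk> \<Longrightarrow> Dag C (Dag C f) = f"

locale linear_dagger_category = dagger_category +
  assumes hom_vectorspace: "\<lbrakk>X \<in> Obj C; Y \<in> Obj C\<rbrakk> \<Longrightarrow> vectorspace class_ring (Hom C X Y)"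
    and hom_fin_dim: "\<lbrakk>X \<in> Obj C; Y \<in> Obj C\<rbrakk> \<Longrightarrow> vectorspace.fin_dim class_ring (Hom C X Y)"
    and comp_add_left: "\<lbrakk>X \<in> Obj C; Y \<in> Obj C; Z \<in> Obj C; f \<in> carrier (Hom C X Y);
      g \<in> carrier (Hom C Y Z); g' \<in> carrier (Hom C Y Z)\<rbrakk>
      \<Longrightarrow> (g \<oplus>\<^bsub>Hom C Y Z\<^esub> g') \<star> f = g \<star> f \<oplus>\<^bsub>Hom C X Z\<^esub> g' \<star> f"
    and comp_add_right: "\<lbrakk>X \<in> Obj C; Y \<in> Obj C; Z \<in> Obj C; f \<in> carrier (Hom C X Y);
      f' \<in> carrier (Hom C X Y); g \<in> carrier (Hom C Y Z)\<rbrakk>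
      \<Longrightarrow> g \<star> (f \<oplus>\<^bsub>Hom C X Y\<^esub> f') = g \<star> f \<oplus>\<^bsub>Hom C X Z\<^esub> g \<star> f'"
    and comp_smult_left: "\<lbrakk>X \<in> Obj C; Y \<in> Obj C; Z \<in> Obj C; f \<in> carrier (Hom C X Y);
      g \<in> carrier (Hom C Y Z)\<rbrakk> \<Longrightarrow> (c \<odot>\<^bsub>Hom C Y Z\<^esub> g) \<star> f = c \<odot>\<^bsub>Hom C X Z\<^esub> (g \<star> f)"
    and comp_smult_right: "\<lbrakk>X \<in> Obj C; Y \<in> Obj C; Z \<in> Obj C; f \<in> carrier (Hom C X Y);
      g \<in> carrier (Hom C Y Z)\<rbrakk> \<Longrightarrow> g \<star> (c \<odot>\<^bsub>Hom C X Y\<^esub> f) = c \<odot>\<^bsub>Hom C X Z\<^esub> (g \<star> f)"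
    and dag_add: "\<lbrakk>X \<in> Obj C; Y \<in> Obj C; f \<in> carrier (Hom C X Y); g \<in> carrier (Hom C X Y)\<rbrakk>
      \<Longrightarrow> Dag C (f \<oplus>\<^bsub>Hom C X Y\<^esub> g) = Dag C f \<oplus>\<^bsub>Hom C Y X\<^esub> Dag C g"
    and dag_smult: "\<lbrakk>X \<in> Obj C; Y \<in> Obj C; f \<in> carrier (Hom C X Y)\<rbrakk>
      \<Longrightarrow> Dag C (c \<odot>\<^bsub>Hom C X Y\<^esub> f) = cnj c \<odot>\<^bsub>Hom C Y X\<^esub> Dag C f"

locale semisimple_dagger_category = linear_dagger_category +
  assumes positive: "\<lbrakk>X \<in> Obj C; Y \<in> Obj C; r \<in> carrier (Hom C X Y);
      Dag C r \<star> r = \<zero>\<^bsub>Hom C X X\<^esub>\<rbrakk> \<Longrightarrow> r = \<zero>\<^bsub>Hom C X Y\<^esub>"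
    and zero_object: "\<exists>Z \<in> Obj C. \<forall>X \<in> Obj C.
      (\<exists>!f. f \<in> carrier (Hom C X Z)) \<and> (\<exists>!f. f \<in> carrier (Hom C Z X))"
    and direct_sum: "\<lbrakk>X\<^sub>1 \<in> Obj C; X\<^sub>2 \<in> Obj C\<rbrakk> \<Longrightarrow> \<exists>Y \<in> Obj C.
      \<exists>s\<^sub>1 \<in> carrier (Hom C X\<^sub>1 Y). \<exists>s\<^sub>2 \<in> carrier (Hom C X\<^sub>2 Y).
        Dag C s\<^sub>1 \<star> s\<^sub>1 = Ident C X\<^sub>1 \<and> Dag C s\<^sub>2 \<star> s\<^sub>2 = Ident C X\<^sub>2 \<and>
        s\<^sub>1 \<star> Dag C s\<^sub>1 \<oplus>\<^bsub>Hom C Y Y\<^esub> s\<^sub>2 \<star> Dag C s\<^sub>2 = Ident C Y"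
    and idempotents_split: "\<lbrakk>X \<in> Obj C; p \<in> carrier (Hom C X X); p \<star> p = p; Dag C p = p\<rbrakk>
      \<Longrightarrow> \<exists>Y \<in> Obj C. \<exists>i \<in> carrier (Hom C Y X). Dag C i \<star> i = Ident C Y \<and> i \<star> Dag C i = p"


section \<open>The category of quantum functions\<close>

text \<open>
  The type \<open>'h\<close> is the universe from which the Hilbert spaces \<open>H\<close> of quantum functions \<open>(H, P)\<close>
  are taken: every Hilbert space whose carrier is a subset of \<open>'h\<close> is allowed. If \<open>'h\<close> has at
  least the cardinality of the continuum, these include Hilbert spaces of every finite dimension.
\<close>

definition QSet :: "'a frob \<Rightarrow> 'b frob
    \<Rightarrow> ('h hilb \<times> ('h \<times> 'a \<Rightarrow> complex, 'b \<times> 'h \<Rightarrow> complex) linmap, ('h, 'h) linmap) dcat" where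
  "QSet A B = \<lparr>
     Obj = {(H, P). quantum_function A B H P},
     Hom = (\<lambda>X Y. \<lparr>carrier = intertwiners A B X Y, mult = undefined, one = undefined,
       zero = \<lparr>dom = fst X, cod = fst Y, fn = restrict (\<lambda>x. \<zero>\<^bsub>fst Y\<^esub>) (carrier (fst X))\<rparr>,
       add = (\<lambda>f g. \<lparr>dom = fst X, cod = fst Y,
         fn = restrict (\<lambda>x. fn f x \<oplus>\<^bsub>fst Y\<^esub> fn g x) (carrier (fst X))\<rparr>),
       smult = (\<lambda>c f. \<lparr>dom = fst X, cod = fst Y,
         fn = restrict (\<lambda>x. c \<odot>\<^bsub>fst Y\<^esub> fn f x) (carrier (fst X))\<rparr>)\<rparr>),
     Ident = (\<lambda>X. lid (fst X)),
     Comp = (\<circ>\<^sub>l),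
     Dag = adj\<rparr>"

end

theory Submission
  imports Defs
begin

text \<open>
  Condition (iii) says that \<open>P\<^sup>\<dagger>\<close> is \<open>P\<close> with its \<open>A\<close>- and \<open>B\<close>-legs bent around by the pairing \<open>\<epsilon> m\<close>
  and the copairing \<open>\<Delta> u\<close>. The snake identity makes bending injective, so that the adjoint of the
  intertwiner equation can be unbent into the intertwiner equation for the adjoint; hence the
  category inherits its dagger, and with it positivity, from Hilbert spaces. For the remaining
  axioms the point is that (i)--(iii) may be tested on a jointly surjective family of maps
  \<open>s\<close> from quantum functions such that \<open>s\<close> and \<open>s\<^sup>\<dagger>\<close> both satisfy the intertwiner equation.
\<close>

section \<open>Finite-dimensional Hilbert spaces\<close>

text \<open>Unbending is never constructed: injectivity of \<open>bend\<close> suffices, and it is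
  read off from a closed formula for \<open>bend\<close> on elementary tensors in which all
  coherence maps have been evaluated. In gluing, (i) and (ii) do not mention
  \<open>P\<^sup>\<dagger>\<close> and pass along any \<open>s\<close> satisfying the intertwiner
  equation; (iii) does mention it, and what is needed there is the adjoint of the equation for
  \<open>s\<^sup>\<dagger>\<close>. As long as P is not known to satisfy (iii), that equation cannot
  be derived from the one for \<open>s\<close>, which is why both are assumed.

  Adjoints, tensors of maps and the coherence maps are definite descriptions, usable only after
  existence and uniqueness. Existence comes from one source: a Parseval frame in each space, which
  gives Riesz representation and, by prescribing a map through frame coefficients, the universal
  property of the tensor product. Uniqueness is nondegeneracy of inner products or agreement on
  elementary tensors. Since all objects of the category live in one universe \<open>'h\<close>, the
  underlying spaces of direct sums have to be encoded inside \<open>'h\<close>.\<close>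

definition linear_functional :: "'a hilb \<Rightarrow> ('a \<Rightarrow> complex) \<Rightarrow> bool" where
  "linear_functional H g \<longleftrightarrow>
     (\<forall>x \<in> carrier H. \<forall>y \<in> carrier H. g (x \<oplus>\<^bsub>H\<^esub> y) = g x + g y) \<and>
     (\<forall>c. \<forall>x \<in> carrier H. g (c \<odot>\<^bsub>H\<^esub> x) = c * g x)"

lemma linear_functionalI:
  assumes "\<And>x y. x \<in> carrier H \<Longrightarrow> y \<in> carrier H \<Longrightarrow> g (x \<oplus>\<^bsub>H\<^esub> y) = g x + g y"
    and "\<And>c x. x \<in> carrier H \<Longrightarrow> g (c \<odot>\<^bsub>H\<^esub> x) = c * g x"
  shows "linear_functional H g"
  using assms by (simp add: linear_functional_def)

text \<open>Generation is phrased without linear combinations, so that it is directly an induction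
  principle.\<close>

definition generates :: "(complex, 'a, 'm) module_scheme \<Rightarrow> 'a set \<Rightarrow> bool" where
  "generates V E \<longleftrightarrow> E \<subseteq> carrier V \<and>
     (\<forall>U. E \<subseteq> U \<longrightarrow> \<zero>\<^bsub>V\<^esub> \<in> U \<longrightarrow>
        (\<forall>x \<in> carrier V. \<forall>y \<in> carrier V. x \<in> U \<longrightarrow> y \<in> U \<longrightarrow> x \<oplus>\<^bsub>V\<^esub> y \<in> U) \<longrightarrow>
        (\<forall>c. \<forall>x \<in> carrier V. x \<in> U \<longrightarrow> c \<odot>\<^bsub>V\<^esub> x \<in> U) \<longrightarrow> carrier V \<subseteq> U)"

lemma generates_induct [consumes 2, case_names gen zero add smult]:
  assumes "generates V E" and "x \<in> carrier V"
    and "\<And>x. x \<in> E \<Longrightarrow> P x" and "P \<zero>\<^bsub>V\<^esub>"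
    and "\<And>x y. x \<in> carrier V \<Longrightarrow> y \<in> carrier V \<Longrightarrow> P x \<Longrightarrow> P y \<Longrightarrow> P (x \<oplus>\<^bsub>V\<^esub> y)"
    and "\<And>c x. x \<in> carrier V \<Longrightarrow> P x \<Longrightarrow> P (c \<odot>\<^bsub>V\<^esub> x)"
  shows "P x"
proof -
  have "carrier V \<subseteq> Collect P"
  proof (rule assms(1)[unfolded generates_def, THEN conjunct2, THEN spec, THEN mp, THEN mp, THEN mp, THEN mp])
    show "E \<subseteq> Collect P" using assms(3) by (intro subsetI CollectI)
    show "\<zero>\<^bsub>V\<^esub> \<in> Collect P" using assms(4) by (rule CollectI)
    show "\<forall>x \<in> carrier V. \<forall>y \<in> carrier V. x \<in> Collect P \<longrightarrow> y \<in> Collect P \<longrightarrow>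
        x \<oplus>\<^bsub>V\<^esub> y \<in> Collect P"
      by (intro ballI impI CollectI assms(5)) (simp_all only: mem_Collect_eq)
    show "\<forall>c. \<forall>x \<in> carrier V. x \<in> Collect P \<longrightarrow> c \<odot>\<^bsub>V\<^esub> x \<in> Collect P"
      by (intro allI ballI impI CollectI assms(6)) (simp_all only: mem_Collect_eq)
  qed
  then show ?thesis using assms(2) by (rule subsetD[THEN CollectD])
qed

lemma generatesI:
  assumes "E \<subseteq> carrier V"
    and "\<And>U x. \<lbrakk>E \<subseteq> U; \<zero>\<^bsub>V\<^esub> \<in> U;
      \<And>x y. \<lbrakk>x \<in> carrier V; y \<in> carrier V; x \<in> U; y \<in> U\<rbrakk> \<Longrightarrow> x \<oplus>\<^bsub>V\<^esub> y \<in> U;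
      \<And>c x. \<lbrakk>x \<in> carrier V; x \<in> U\<rbrakk> \<Longrightarrow> c \<odot>\<^bsub>V\<^esub> x \<in> U; x \<in> carrier V\<rbrakk> \<Longrightarrow> x \<in> U"
  shows "generates V E"
  unfolding generates_def
proof (intro conjI allI impI subsetI)
  show "x \<in> carrier V" if "x \<in> E" for x
    using assms(1) that by (rule subsetD)
next
  fix U x
  assume E: "E \<subseteq> U" and z: "\<zero>\<^bsub>V\<^esub> \<in> U"
    and a: "\<forall>x \<in> carrier V. \<forall>y \<in> carrier V. x \<in> U \<longrightarrow> y \<in> U \<longrightarrow> x \<oplus>\<^bsub>V\<^esub> y \<in> U"
    and m: "\<forall>c. \<forall>x \<in> carrier V. x \<in> U \<longrightarrow> c \<odot>\<^bsub>V\<^esub> x \<in> U" and x: "x \<in> carrier V"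
  show "x \<in> U"
    by (rule assms(2)[OF E z a[rule_format] m[rule_format] x])
qed

section \<open>Criteria for finite dimension: generating sets and separating functionals\<close>

lemma fin_dimI:
  fixes V :: "(complex, 'a, 'm) module_scheme"
  assumes V: "vectorspace class_ring V" and E: "generates V E" and fin: "finite E"
  shows "vectorspace.fin_dim class_ring V"
proof -
  interpret V: vectorspace class_ring V by (rule V)
  have EV: "E \<subseteq> carrier V" using E by (simp add: generates_def)
  interpret S: submodule class_ring "V.span E" V by (rule V.span_is_submodule[OF EV])
  have "x \<in> V.span E" if "x \<in> carrier V" for x
    using E that by (rule generates_induct) (use V.in_own_span[OF EV] in auto)
  then have "V.span E = carrier V" using S.subset by auto
  then show ?thesis unfolding V.fin_dim_def using fin EV by blast
qed

lemma fin_dimE: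
  fixes V :: "(complex, 'a, 'm) module_scheme"
  assumes V: "vectorspace class_ring V" and "vectorspace.fin_dim class_ring V"
  obtains E where "finite E" and "generates V E"
proof -
  interpret V: vectorspace class_ring V by (rule V)
  obtain E where E: "finite E" "E \<subseteq> carrier V" "V.span E = carrier V"
    using assms(2) unfolding V.fin_dim_def by auto
  have "generates V E"
  proof (rule generatesI[OF E(2)])
    fix U x
    assume U: "E \<subseteq> U" "\<zero>\<^bsub>V\<^esub> \<in> U"
      "\<And>x y. \<lbrakk>x \<in> carrier V; y \<in> carrier V; x \<in> U; y \<in> U\<rbrakk> \<Longrightarrow> x \<oplus>\<^bsub>V\<^esub> y \<in> U"
      "\<And>c x. \<lbrakk>x \<in> carrier V; x \<in> U\<rbrakk> \<Longrightarrow> c \<odot>\<^bsub>V\<^esub> x \<in> U" and x: "x \<in> carrier V"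
    \<comment> \<open>\<open>U\<close> may contain elements outside the carrier, hence the
      intersection.\<close>
    have "submodule class_ring (U \<inter> carrier V) V"
      using U by unfold_locales auto
    then have "V.span E \<subseteq> U \<inter> carrier V"
      using U(1) E(2) by (intro V.span_is_subset) auto
    then show "x \<in> U" using x E(3) by auto
  qed
  with E(1) show ?thesis by (rule that)
qed

lemma vectorspaceI:
  fixes V :: "(complex, 'a, 'm) module_scheme"
  assumes "\<zero>\<^bsub>V\<^esub> \<in> carrier V"
    and "\<And>x y. x \<in> carrier V \<Longrightarrow> y \<in> carrier V \<Longrightarrow> x \<oplus>\<^bsub>V\<^esub> y \<in> carrier V"
    and "\<And>c x. x \<in> carrier V \<Longrightarrow> c \<odot>\<^bsub>V\<^esub> x \<in> carrier V"
    and "\<And>x y. x \<in> carrier V \<Longrightarrow> y \<in> carrier V \<Longrightarrow> x \<oplus>\<^bsub>V\<^esub> y = y \<oplus>\<^bsub>V\<^esub> x"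
    and "\<And>x y z. x \<in> carrier V \<Longrightarrow> y \<in> carrier V \<Longrightarrow> z \<in> carrier V \<Longrightarrow>
      (x \<oplus>\<^bsub>V\<^esub> y) \<oplus>\<^bsub>V\<^esub> z = x \<oplus>\<^bsub>V\<^esub> (y \<oplus>\<^bsub>V\<^esub> z)"
    and "\<And>x. x \<in> carrier V \<Longrightarrow> x \<oplus>\<^bsub>V\<^esub> \<zero>\<^bsub>V\<^esub> = x"
    and "\<And>x. x \<in> carrier V \<Longrightarrow> x \<oplus>\<^bsub>V\<^esub> ((-1) \<odot>\<^bsub>V\<^esub> x) = \<zero>\<^bsub>V\<^esub>"
    and "\<And>x. x \<in> carrier V \<Longrightarrow> 1 \<odot>\<^bsub>V\<^esub> x = x"
    and "\<And>a b x. x \<in> carrier V \<Longrightarrow> (a * b) \<odot>\<^bsub>V\<^esub> x = a \<odot>\<^bsub>V\<^esub> (b \<odot>\<^bsub>V\<^esub> x)"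
    and "\<And>a b x. x \<in> carrier V \<Longrightarrow> (a + b) \<odot>\<^bsub>V\<^esub> x = a \<odot>\<^bsub>V\<^esub> x \<oplus>\<^bsub>V\<^esub> b \<odot>\<^bsub>V\<^esub> x"
    and "\<And>a x y. x \<in> carrier V \<Longrightarrow> y \<in> carrier V \<Longrightarrow>
      a \<odot>\<^bsub>V\<^esub> (x \<oplus>\<^bsub>V\<^esub> y) = a \<odot>\<^bsub>V\<^esub> x \<oplus>\<^bsub>V\<^esub> a \<odot>\<^bsub>V\<^esub> y"
  shows "vectorspace class_ring V"
proof -
  have neg: "\<forall>v\<in>carrier V. \<exists>w\<in>carrier V. v \<oplus>\<^bsub>V\<^esub> w = \<zero>\<^bsub>V\<^esub>"
    using assms(3,7) by blast
  show ?thesis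
    by (rule vs_criteria, rule class_field) (use assms neg in simp_all)
qed

text \<open>A finite separating family of functionals embeds the space into a power of the complex
  numbers. This form suits Hom spaces, which are cut out by equations and come with no visible
  generators.\<close>

lemma fin_dim_if_separated:
  fixes V :: "(complex, 'a, 'm) module_scheme"
  assumes V: "vectorspace class_ring V" and fin: "finite I"
    and add: "\<And>i x y. \<lbrakk>i \<in> I; x \<in> carrier V; y \<in> carrier V\<rbrakk> \<Longrightarrow> l i (x \<oplus>\<^bsub>V\<^esub> y) = l i x + l i y"
    and smult: "\<And>i c x. \<lbrakk>i \<in> I; x \<in> carrier V\<rbrakk> \<Longrightarrow> l i (c \<odot>\<^bsub>V\<^esub> x) = c * (l i x :: complex)"
    and sep: "\<And>x. \<lbrakk>x \<in> carrier V; \<And>i. i \<in> I \<Longrightarrow> l i x = 0\<rbrakk> \<Longrightarrow> x = \<zero>\<^bsub>V\<^esub>"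
  shows "vectorspace.fin_dim class_ring V"
proof -
  interpret V: vectorspace class_ring V by (rule V)
  have sm: "c \<odot>\<^bsub>V\<^esub> x \<in> carrier V" if "x \<in> carrier V" for c x using that by simp
  \<comment> \<open>\<open>J\<close> collects the functionals no longer required to vanish: the span
    of \<open>E\<close> contains the common kernel of those in \<open>I - J\<close>. That kernel is
    zero for empty \<open>J\<close> and the whole space for \<open>J = I\<close>.\<close>
  have "\<exists>E. finite E \<and> E \<subseteq> carrier V \<and>
      (\<forall>x \<in> carrier V. (\<forall>i \<in> I - J. l i x = 0) \<longrightarrow> x \<in> V.span E)" if "finite J" "J \<subseteq> I" for J
    using that
  proof (induction J rule: finite_induct)
    case empty
    have "x \<in> V.span {}" if "x \<in> carrier V" "\<forall>i \<in> I - {}. l i x = 0" for x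
      using sep[of x] that by (simp add: V.span_zero)
    then show ?case by (intro exI[of _ "{}"]) auto
  next
    case (insert j J)
    then obtain E where E: "finite E" "E \<subseteq> carrier V"
      "\<And>x. x \<in> carrier V \<Longrightarrow> (\<forall>i \<in> I - J. l i x = 0) \<Longrightarrow> x \<in> V.span E" by auto
    have j: "j \<in> I" using insert by auto
    \<comment> \<open>Releasing \<open>l j\<close> enlarges the kernel by at most one dimension; any
      \<open>w\<close> in it with \<open>l j w\<close> nonzero supplies the missing
      direction.\<close>
    show ?case
    proof (cases "\<exists>w \<in> carrier V. (\<forall>i \<in> I - insert j J. l i w = 0) \<and> l j w \<noteq> 0")
      case False
      have "x \<in> V.span E" if "x \<in> carrier V" "\<forall>i \<in> I - insert j J. l i x = 0" for x
        using False that by (intro E(3)) auto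
      then show ?thesis using E by auto
    next
      case True
      then obtain w where w: "w \<in> carrier V" "\<forall>i \<in> I - insert j J. l i w = 0" "l j w \<noteq> 0"
        by auto
      let ?E = "insert w E"
      have EV: "?E \<subseteq> carrier V" using E w by auto
      interpret S: submodule class_ring "V.span ?E" V by (rule V.span_is_submodule[OF EV])
      have "x \<in> V.span ?E" if x: "x \<in> carrier V" "\<forall>i \<in> I - insert j J. l i x = 0" for x
      proof -
        \<comment> \<open>Chosen so that \<open>l j\<close> vanishes on \<open>?y\<close>; the
          functionals still in force already vanish on \<open>x\<close> and on
          \<open>w\<close>.\<close>
        let ?c = "l j x / l j w"
        let ?y = "x \<oplus>\<^bsub>V\<^esub> (- ?c) \<odot>\<^bsub>V\<^esub> w"
        have y: "?y \<in> carrier V" using x w by simp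
        have "l i ?y = 0" if "i \<in> I - J" for i
          using that x w j by (cases "i = j") (auto simp: add smult sm)
        then have "?y \<in> V.span E" using E(3)[OF y] by blast
        then have 1: "?y \<in> V.span ?E" using V.span_is_monotone[of E ?E] by auto
        have w': "w \<in> V.span ?E" using V.in_own_span[OF EV] by auto
        have "?y \<oplus>\<^bsub>V\<^esub> ?c \<odot>\<^bsub>V\<^esub> w = x \<oplus>\<^bsub>V\<^esub> ((- ?c) \<odot>\<^bsub>V\<^esub> w \<oplus>\<^bsub>V\<^esub> ?c \<odot>\<^bsub>V\<^esub> w)"
          using x(1) w(1) by (simp add: V.a_assoc)
        also have "(- ?c) \<odot>\<^bsub>V\<^esub> w \<oplus>\<^bsub>V\<^esub> ?c \<odot>\<^bsub>V\<^esub> w = (- ?c + ?c) \<odot>\<^bsub>V\<^esub> w"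
          using V.smult_l_distr[of "- ?c" ?c w] w(1) by simp
        also have "\<dots> = \<zero>\<^bsub>V\<^esub>" using V.lmult_0[OF w(1)] by simp
        finally have "x = ?y \<oplus>\<^bsub>V\<^esub> ?c \<odot>\<^bsub>V\<^esub> w" using x by simp
        then show ?thesis using S.m_closed[OF 1 S.smult_closed[OF _ w', of ?c]] by simp
      qed
      then show ?thesis using E EV by (intro exI[of _ ?E]) auto
    qed
  qed
  from this[of I] obtain E where E: "finite E" "E \<subseteq> carrier V"
    "carrier V \<subseteq> V.span E" using fin by auto
  then have "V.span E = carrier V" using V.span_is_subset2[of E] by auto
  with E show ?thesis unfolding V.fin_dim_def by blast
qed

section \<open>Inner product arithmetic, frames and Riesz representation\<close>

context fd_hilbert_space
begin

lemma smult_in [simp, intro]: "x \<in> carrier H \<Longrightarrow> c \<odot> x \<in> carrier H"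
  by simp

lemma smult_add_left: "x \<in> carrier H \<Longrightarrow> (a + b) \<odot> x = a \<odot> x \<oplus> b \<odot> x"
  using smult_l_distr[of a b x] by simp

lemma smult_add_right: "x \<in> carrier H \<Longrightarrow> y \<in> carrier H \<Longrightarrow> c \<odot> (x \<oplus> y) = c \<odot> x \<oplus> c \<odot> y"
  using smult_r_distr[of c x y] by simp

lemma smult_smult: "x \<in> carrier H \<Longrightarrow> (a * b) \<odot> x = a \<odot> (b \<odot> x)"
  using smult_assoc1[of a b x] by simp

lemma one_smult [simp]: "x \<in> carrier H \<Longrightarrow> 1 \<odot> x = x"
  using smult_one[of x] by simp

lemma zero_smult [simp]: "x \<in> carrier H \<Longrightarrow> 0 \<odot> x = \<zero>"
  using lmult_0[of x] by simp

lemma add_neg_smult [simp]: "x \<in> carrier H \<Longrightarrow> x \<oplus> (-1) \<odot> x = \<zero>"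
  using smult_add_left[of x 1 "-1"] by simp

lemma inner_zero_right [simp]: "x \<in> carrier H \<Longrightarrow> inner H x \<zero> = 0"
  using inner_smult_right[of x \<zero> 0] by simp

lemma inner_add_left: "\<lbrakk>x \<in> carrier H; y \<in> carrier H; z \<in> carrier H\<rbrakk>
    \<Longrightarrow> inner H (x \<oplus> y) z = inner H x z + inner H y z"
  using inner_commute[of z "x \<oplus> y"] inner_commute[of z x] inner_commute[of z y]
    inner_add_right[of z x y] by simp

lemma inner_smult_left: "\<lbrakk>x \<in> carrier H; y \<in> carrier H\<rbrakk>
    \<Longrightarrow> inner H (c \<odot> x) y = cnj c * inner H x y"
  using inner_commute[of y "c \<odot> x"] inner_commute[of y x] inner_smult_right[of y x c] by simp

lemma eq_if_diff_zero:
  assumes "x \<in> carrier H" "y \<in> carrier H" "x \<oplus> (-1) \<odot> y = \<zero>"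
  shows "x = y"
proof -
  have "x = x \<oplus> (y \<oplus> (-1) \<odot> y)" using assms by simp
  also have "\<dots> = (x \<oplus> (-1) \<odot> y) \<oplus> y" using assms(1,2) by (simp add: a_ac del: add_neg_smult)
  finally show ?thesis using assms by simp
qed

lemma inner_self_eq_0:
  assumes "x \<in> carrier H" "inner H x x = 0"
  shows "x = \<zero>"
  using inner_pos[of x] assms by auto

text \<open>Nondegeneracy, by testing against the difference of \<open>x\<close> and
  \<open>y\<close> itself. The linearity of maps built from Riesz vectors reduces to it.\<close>

lemma inner_ext:
  assumes "x \<in> carrier H" "y \<in> carrier H"
    and "\<And>z. z \<in> carrier H \<Longrightarrow> inner H z x = inner H z y"
  shows "x = y"
proof (rule eq_if_diff_zero[OF assms(1,2)], rule inner_self_eq_0)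
  let ?w = "x \<oplus> (-1) \<odot> y"
  show w: "?w \<in> carrier H" using assms by simp
  show "inner H ?w ?w = 0"
    using inner_add_right[OF w assms(1), of "(-1) \<odot> y"] assms(2) w assms(3)[OF w]
    by (simp add: inner_smult_right)
qed

lemma inner_ext_left:
  assumes "x \<in> carrier H" "y \<in> carrier H"
    and "\<And>z. z \<in> carrier H \<Longrightarrow> inner H x z = inner H y z"
  shows "x = y"
  using assms by (intro inner_ext) (auto simp: inner_commute[of x] inner_commute[of y])

lemma linear_functional_inner: "x \<in> carrier H \<Longrightarrow> linear_functional H (inner H x)"
  by (rule linear_functionalI) (simp_all add: inner_add_right inner_smult_right)

lemma linear_functional_zero: "linear_functional H g \<Longrightarrow> g \<zero> = 0"
  unfolding linear_functional_def by (metis mult_zero_left zero_closed zero_smult)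

lemma linear_functional_finsum:
  assumes g: "linear_functional H g" and "finite E" "f \<in> E \<rightarrow> carrier H"
  shows "g (finsum H f E) = (\<Sum>e\<in>E. g (f e))"
  using assms(2,3)
proof (induction E rule: finite_induct)
  case empty
  then show ?case using g by (simp add: linear_functional_zero)
next
  case (insert e E)
  then have "g (f e \<oplus> finsum H f E) = g (f e) + g (finsum H f E)"
    using g unfolding linear_functional_def by (simp add: finsum_closed Pi_iff)
  then show ?case using insert by (simp add: Pi_iff)
qed

lemma ex_generates: "\<exists>E. finite E \<and> generates H E"
  using fin_dimE[OF vectorspace_axioms finite_dimensional] by metis

text \<open>By Gram--Schmidt; orthonormality is not recorded because only the expansion is needed.\<close>

lemma ex_frame: "\<exists>E. finite E \<and> E \<subseteq> carrier H \<and>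
    (\<forall>x \<in> carrier H. x = finsum H (\<lambda>e. inner H e x \<odot> e) E)"
proof -
  define proj where "proj E x = finsum H (\<lambda>e. inner H e x \<odot> e) E" for E x
  define orth where "orth E \<longleftrightarrow> finite E \<and> E \<subseteq> carrier H \<and>
    (\<forall>e \<in> E. \<forall>f \<in> E. inner H e f = (if e = f then 1 else 0))" for E
  have proj_in: "proj E x \<in> carrier H" if "E \<subseteq> carrier H" for E x
    unfolding proj_def using that by (intro finsum_closed) auto
  have inner_proj: "inner H z (proj E x) = (\<Sum>e\<in>E. inner H e x * inner H z e)"
    if "E \<subseteq> carrier H" "finite E" "z \<in> carrier H" for E x z
  proof -
    have "(\<lambda>e. inner H e x \<odot> e) \<in> E \<rightarrow> carrier H" using that by auto
    then have "inner H z (proj E x) = (\<Sum>e\<in>E. inner H z (inner H e x \<odot> e))"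
      unfolding proj_def
      using linear_functional_finsum[OF linear_functional_inner[OF that(3)] that(2)] by blast
    also have "\<dots> = (\<Sum>e\<in>E. inner H e x * inner H z e)"
      using that by (intro sum.cong) (auto simp: inner_smult_right subset_iff)
    finally show ?thesis .
  qed
  \<comment> \<open>An orthonormal \<open>E\<close> whose projection fixes every element of a finite
    set \<open>S\<close>. Applied to a generating set this gives the expansion everywhere, since the
    projection is linear.\<close>
  have step: "\<exists>E. orth E \<and> (\<forall>x \<in> S. x = proj E x)"
    if "finite S" "S \<subseteq> carrier H" for S
    using that
  proof (induction S rule: finite_induct)
    case empty
    then show ?case by (intro exI[of _ "{}"]) (auto simp: orth_def)
  next
    case (insert s S)
    then obtain E where E: "orth E" "\<And>x. x \<in> S \<Longrightarrow> x = proj E x" by auto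
    have Ec: "E \<subseteq> carrier H" "finite E" using E by (auto simp: orth_def)
    have s: "s \<in> carrier H" using insert by auto
    \<comment> \<open>The component of \<open>s\<close> orthogonal to \<open>E\<close>. If it
      vanishes, \<open>E\<close> already serves; otherwise its normalisation is the new
      vector.\<close>
    let ?r = "s \<oplus> (-1) \<odot> proj E s"
    have r: "?r \<in> carrier H" using s proj_in[OF Ec(1)] by simp
    have er: "inner H e ?r = 0" if "e \<in> E" for e
    proof -
      have e: "e \<in> carrier H" using that Ec by auto
      have "inner H e (proj E s) = (\<Sum>f\<in>E. inner H f s * (if e = f then 1 else 0))"
        unfolding inner_proj[OF Ec e] using E(1) that by (intro sum.cong) (auto simp: orth_def)
      also have "\<dots> = (\<Sum>f\<in>E. if f = e then inner H f s else 0)"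
        by (intro sum.cong) auto
      also have "\<dots> = inner H e s" using that Ec by simp
      finally show ?thesis
        using e s proj_in[OF Ec(1)] by (simp add: inner_add_right inner_smult_right)
    qed
    show ?case
    proof (cases "?r = \<zero>")
      case True
      then have "s = proj E s" using eq_if_diff_zero s proj_in[OF Ec(1)] by blast
      then show ?thesis using E by auto
    next
      case False
      define n where "n = Re (inner H ?r ?r)"
      have n: "n > 0" unfolding n_def using inner_pos[OF r False] .
      have "Im (inner H ?r ?r) = 0" using inner_commute[OF r r] by (simp add: complex_eq_iff)
      then have rr: "inner H ?r ?r = of_real n" by (simp add: n_def complex_eq_iff)
      define u where "u = complex_of_real (1 / sqrt n) \<odot> ?r"
      have u: "u \<in> carrier H" using r by (simp add: u_def)
      have sq: "complex_of_real (sqrt n) * complex_of_real (sqrt n) = complex_of_real n"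
        using n by (metis abs_of_pos of_real_mult real_sqrt_mult_self)
      have uu: "inner H u u = 1"
        using n r sq unfolding u_def
        by (simp add: inner_smult_left inner_smult_right rr field_simps del: of_real_divide)
           (simp add: field_simps)
      have eu: "inner H e u = 0" if "e \<in> E" for e
        using er[OF that] that Ec r unfolding u_def by (simp add: inner_smult_right subset_iff)
      have ue: "inner H u e = 0" if "e \<in> E" for e
        using eu[OF that] that Ec u inner_commute[of e u] by auto
      have uE: "u \<notin> E" using eu uu by fastforce
      let ?E = "insert u E"
      have orth: "orth ?E"
        using E(1) u uu eu ue uE unfolding orth_def by auto
      have pr: "proj ?E x = inner H u x \<odot> u \<oplus> proj E x" if "x \<in> carrier H" for x
        unfolding proj_def using Ec uE u by (subst finsum_insert) (auto simp: subset_iff)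
      have uproj: "inner H u (proj E x) = 0" for x
        unfolding inner_proj[OF Ec u] by (intro sum.neutral) (simp add: ue)
      \<comment> \<open>For the old elements the new term vanishes, because \<open>u\<close> is
        orthogonal to \<open>E\<close> and \<open>x\<close> is expanded in \<open>E\<close>.\<close>
      have "x = proj ?E x" if "x \<in> S" for x
      proof -
        have x: "x \<in> carrier H" using that insert by auto
        have "inner H u x = 0" using uproj[of x] E(2)[OF that] by simp
        then show ?thesis using pr[OF x] E(2)[OF that] u x by simp
      qed
      \<comment> \<open>The new term is exactly the residue \<open>?r\<close>: pairing
        \<open>u\<close> with \<open>s\<close> gives the norm of \<open>?r\<close>, the square root
        of \<open>n\<close>.\<close>
      moreover have "s = proj ?E s"
      proof -
        have "inner H u s = inner H u ?r"
          using uproj[of s] u s proj_in[OF Ec(1)]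
          by (simp add: inner_add_right inner_smult_right)
        also have "\<dots> = of_real (sqrt n)"
          unfolding u_def using r n sq
          by (simp add: inner_smult_left rr field_simps)
        finally have "inner H u s \<odot> u = (of_real (sqrt n) * complex_of_real (1 / sqrt n)) \<odot> ?r"
          unfolding u_def using r by (subst smult_smult) auto
        also have "of_real (sqrt n) * complex_of_real (1 / sqrt n) = 1" using n by simp
        finally have "inner H u s \<odot> u = ?r" using r by simp
        then have "proj ?E s = s \<oplus> ((-1) \<odot> proj E s \<oplus> proj E s)"
          using pr[OF s] s proj_in[OF Ec(1)] by (simp add: a_assoc)
        also have "(-1) \<odot> proj E s \<oplus> proj E s = \<zero>"
          using proj_in[OF Ec(1)] by (subst a_comm) auto
        finally show ?thesis using s by simp
      qed
      ultimately show ?thesis using orth by (intro exI[of _ ?E]) auto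
    qed
  qed
  obtain S where S: "finite S" "generates H S" using ex_generates by auto
  then obtain E where E: "orth E" "\<And>x. x \<in> S \<Longrightarrow> x = proj E x"
    using step[of S] by (auto simp: generates_def)
  have Ec: "E \<subseteq> carrier H" "finite E" using E by (auto simp: orth_def)
  \<comment> \<open>Linearity of \<open>proj E\<close>, checked by pairing with an arbitrary
    \<open>z\<close>, carries the expansion from \<open>S\<close> to everything it
    generates.\<close>
  have "x = proj E x" if "x \<in> carrier H" for x
    using S(2) that
  proof (induction rule: generates_induct)
    case (gen x)
    then show ?case by (rule E(2))
  next
    case zero
    show ?case
      by (rule inner_ext)
        (use Ec proj_in in \<open>auto simp: inner_proj subset_iff intro!: sum.neutral[symmetric]\<close>)
  next
    case (add x y)
    have "inner H z (proj E (x \<oplus> y)) = inner H z (proj E x \<oplus> proj E y)" if "z \<in> carrier H" for z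
    proof -
      have "inner H z (proj E (x \<oplus> y)) =
          (\<Sum>e\<in>E. inner H e x * inner H z e + inner H e y * inner H z e)"
        unfolding inner_proj[OF Ec that] using add.hyps add.IH Ec
        by (intro sum.cong) (auto simp: inner_add_right subset_iff algebra_simps)
      then show ?thesis
        using that proj_in[OF Ec(1)] by (simp add: inner_add_right inner_proj[OF Ec] sum.distrib)
    qed
    then have "proj E (x \<oplus> y) = proj E x \<oplus> proj E y"
      using proj_in[OF Ec(1)] by (intro inner_ext) auto
    then show ?case using add.hyps add.IH by simp
  next
    case (smult c x)
    have "inner H z (proj E (c \<odot> x)) = inner H z (c \<odot> proj E x)" if "z \<in> carrier H" for z
    proof -
      have "inner H z (proj E (c \<odot> x)) = (\<Sum>e\<in>E. c * (inner H e x * inner H z e))"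
        unfolding inner_proj[OF Ec that] using smult.hyps smult.IH Ec
        by (intro sum.cong) (auto simp: inner_smult_right subset_iff)
      then show ?thesis
        using that proj_in[OF Ec(1)]
        by (simp add: inner_smult_right inner_proj[OF Ec] sum_distrib_left)
    qed
    then have "proj E (c \<odot> x) = c \<odot> proj E x"
      using proj_in[OF Ec(1)] by (intro inner_ext) auto
    then show ?case using smult.hyps smult.IH by simp
  qed
  with Ec show ?thesis unfolding proj_def by blast
qed

text \<open>The expansion property is that of a Parseval frame. Fixing one per space lets
  functionals, tensors and their inner products be evaluated by finite sums.\<close>

definition frame :: "'a set" where
  "frame = (SOME E. finite E \<and> E \<subseteq> carrier H \<and>
     (\<forall>x \<in> carrier H. x = finsum H (\<lambda>e. inner H e x \<odot> e) E))"

lemma finite_frame [simp]: "finite frame"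
  and frame_subset: "frame \<subseteq> carrier H"
  and frame_expand: "x \<in> carrier H \<Longrightarrow> x = finsum H (\<lambda>e. inner H e x \<odot> e) frame"
  using someI_ex[OF ex_frame] unfolding frame_def by blast+

lemma frame_in [simp, intro]: "e \<in> frame \<Longrightarrow> e \<in> carrier H"
  using frame_subset by auto

lemma linear_functional_frame:
  assumes g: "linear_functional H g" and x: "x \<in> carrier H"
  shows "g x = (\<Sum>e\<in>frame. inner H e x * g e)"
proof -
  have "g x = g (finsum H (\<lambda>e. inner H e x \<odot> e) frame)" using frame_expand[OF x] by simp
  also have "\<dots> = (\<Sum>e\<in>frame. g (inner H e x \<odot> e))"
    by (rule linear_functional_finsum[OF g]) auto
  also have "\<dots> = (\<Sum>e\<in>frame. inner H e x * g e)"
    using g by (intro sum.cong) (auto simp: linear_functional_def)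
  finally show ?thesis .
qed

lemma riesz:
  assumes g: "linear_functional H g"
  shows "\<exists>v \<in> carrier H. \<forall>x \<in> carrier H. inner H v x = g x"
proof (intro bexI ballI)
  \<comment> \<open>The coefficients are conjugated because the inner product is antilinear in the
    argument where \<open>?v\<close> is finally placed.\<close>
  let ?v = "finsum H (\<lambda>e. cnj (g e) \<odot> e) frame"
  show v: "?v \<in> carrier H" by (intro finsum_closed) auto
  fix x assume x: "x \<in> carrier H"
  have "inner H x ?v = (\<Sum>e\<in>frame. inner H x (cnj (g e) \<odot> e))"
    by (rule linear_functional_finsum[OF linear_functional_inner[OF x]]) auto
  also have "\<dots> = (\<Sum>e\<in>frame. cnj (g e) * inner H x e)"
    using x by (intro sum.cong) (auto simp: inner_smult_right)
  also have "\<dots> = (\<Sum>e\<in>frame. cnj (inner H e x * g e))"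
    using x by (intro sum.cong) (auto simp: inner_commute[of _ x])
  also have "\<dots> = cnj (g x)" using linear_functional_frame[OF g x] by simp
  finally show "inner H ?v x = g x" using inner_commute[OF x v] by simp
qed

lemma riesz_right:
  assumes "linear_functional H (\<lambda>x. cnj (g x))"
  shows "\<exists>v \<in> carrier H. \<forall>x \<in> carrier H. inner H x v = g x"
  using riesz[OF assms] inner_commute by (metis complex_cnj_cnj)

end

lemma fd_hilbert_spaceI:
  fixes H :: "'a hilb"
  assumes "vectorspace class_ring H" and "finite E" and "generates H E"
    and "\<And>x y z. \<lbrakk>x \<in> carrier H; y \<in> carrier H; z \<in> carrier H\<rbrakk>
      \<Longrightarrow> inner H x (y \<oplus>\<^bsub>H\<^esub> z) = inner H x y + inner H x z"
    and "\<And>c x y. \<lbrakk>x \<in> carrier H; y \<in> carrier H\<rbrakk> \<Longrightarrow> inner H x (c \<odot>\<^bsub>H\<^esub> y) = c * inner H x y"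
    and "\<And>x y. \<lbrakk>x \<in> carrier H; y \<in> carrier H\<rbrakk> \<Longrightarrow> inner H y x = cnj (inner H x y)"
    and "\<And>x. \<lbrakk>x \<in> carrier H; x \<noteq> \<zero>\<^bsub>H\<^esub>\<rbrakk> \<Longrightarrow> Re (inner H x x) > 0"
  shows "fd_hilbert_space H"
  by (intro fd_hilbert_space.intro fd_hilbert_space_axioms.intro assms fin_dimI[OF assms(1,3,2)])

lemma complex_hilb_simps [simp]:
  "carrier complex_hilb = UNIV" "zero complex_hilb = 0" "add complex_hilb = (+)"
  "smult complex_hilb = (*)" "inner complex_hilb x y = cnj x * y"
  by (simp_all add: complex_hilb_def)

lemma fd_complex_hilb [simp]: "fd_hilbert_space complex_hilb"
proof (rule fd_hilbert_spaceI[where E = "{1}"])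
  show "vectorspace class_ring complex_hilb"
    by (rule vectorspaceI) (simp_all add: algebra_simps)
  show "generates complex_hilb {1}"
  proof (rule generatesI)
    fix U :: "complex set" and x :: complex
    assume *: "{1} \<subseteq> U" "\<And>c x. \<lbrakk>x \<in> carrier complex_hilb; x \<in> U\<rbrakk>
      \<Longrightarrow> c \<odot>\<^bsub>complex_hilb\<^esub> x \<in> U"
    show "x \<in> U" using *(2)[of 1 x] *(1) by simp
  qed simp
  show "0 < Re (inner complex_hilb x x)" if "x \<noteq> \<zero>\<^bsub>complex_hilb\<^esub>" for x
    using that sum_power2_gt_zero_iff[of "Re x" "Im x"]
    by (auto simp: complex_eq_iff power2_eq_square)
qed (simp_all add: algebra_simps)

section \<open>Linear maps and adjoints\<close>

lemma LinI:
  assumes "dom f = H" "cod f = K" "fn f \<in> extensional (carrier H)"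
    and "\<And>x. x \<in> carrier H \<Longrightarrow> fn f x \<in> carrier K"
    and "\<And>x y. \<lbrakk>x \<in> carrier H; y \<in> carrier H\<rbrakk> \<Longrightarrow> fn f (x \<oplus>\<^bsub>H\<^esub> y) = fn f x \<oplus>\<^bsub>K\<^esub> fn f y"
    and "\<And>c x. x \<in> carrier H \<Longrightarrow> fn f (c \<odot>\<^bsub>H\<^esub> x) = c \<odot>\<^bsub>K\<^esub> fn f x"
  shows "f \<in> Lin H K"
  using assms by (auto simp: Lin_def LinearCombinations.module_hom_def)

lemma Lin_dom: "f \<in> Lin H K \<Longrightarrow> dom f = H"
  and Lin_cod: "f \<in> Lin H K \<Longrightarrow> cod f = K"
  and Lin_extensional: "f \<in> Lin H K \<Longrightarrow> fn f \<in> extensional (carrier H)"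
  and Lin_in: "f \<in> Lin H K \<Longrightarrow> x \<in> carrier H \<Longrightarrow> fn f x \<in> carrier K"
  and Lin_add: "f \<in> Lin H K \<Longrightarrow> x \<in> carrier H \<Longrightarrow> y \<in> carrier H
    \<Longrightarrow> fn f (x \<oplus>\<^bsub>H\<^esub> y) = fn f x \<oplus>\<^bsub>K\<^esub> fn f y"
  and Lin_smult: "f \<in> Lin H K \<Longrightarrow> x \<in> carrier H \<Longrightarrow> fn f (c \<odot>\<^bsub>H\<^esub> x) = c \<odot>\<^bsub>K\<^esub> fn f x"
  by (auto simp: Lin_def LinearCombinations.module_hom_def)

lemma Lin_zero:
  assumes "fd_hilbert_space H" "fd_hilbert_space K" "f \<in> Lin H K"
  shows "fn f \<zero>\<^bsub>H\<^esub> = \<zero>\<^bsub>K\<^esub>"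
proof -
  interpret H: fd_hilbert_space H by fact
  interpret K: fd_hilbert_space K by fact
  have "fn f (0 \<odot>\<^bsub>H\<^esub> \<zero>\<^bsub>H\<^esub>) = 0 \<odot>\<^bsub>K\<^esub> fn f \<zero>\<^bsub>H\<^esub>"
    using assms(3) by (intro Lin_smult) auto
  then show ?thesis using Lin_in[OF assms(3), of "\<zero>\<^bsub>H\<^esub>"] by simp
qed

lemma Lin_eqI:
  assumes "f \<in> Lin H K" "g \<in> Lin H K" "\<And>x. x \<in> carrier H \<Longrightarrow> fn f x = fn g x"
  shows "f = g"
proof -
  have "fn f = fn g"
    using Lin_extensional[OF assms(1)] Lin_extensional[OF assms(2)] assms(3)
    by (rule extensionalityI)
  then show ?thesis using assms(1,2) by (auto intro!: linmap.equality simp: Lin_dom Lin_cod)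
qed

definition mk_lin :: "'a hilb \<Rightarrow> 'b hilb \<Rightarrow> ('a \<Rightarrow> 'b) \<Rightarrow> ('a, 'b) linmap" where
  "mk_lin H K g = \<lparr>dom = H, cod = K, fn = restrict g (carrier H)\<rparr>"

lemma mk_lin_fn [simp]: "x \<in> carrier H \<Longrightarrow> fn (mk_lin H K g) x = g x"
  by (simp add: mk_lin_def)

lemma mk_lin_in:
  assumes "fd_hilbert_space H"
    and "\<And>x. x \<in> carrier H \<Longrightarrow> g x \<in> carrier K"
    and "\<And>x y. \<lbrakk>x \<in> carrier H; y \<in> carrier H\<rbrakk> \<Longrightarrow> g (x \<oplus>\<^bsub>H\<^esub> y) = g x \<oplus>\<^bsub>K\<^esub> g y"
    and "\<And>c x. x \<in> carrier H \<Longrightarrow> g (c \<odot>\<^bsub>H\<^esub> x) = c \<odot>\<^bsub>K\<^esub> g x"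
  shows "mk_lin H K g \<in> Lin H K"
proof -
  interpret H: fd_hilbert_space H by fact
  show ?thesis by (rule LinI) (simp_all add: mk_lin_def assms)
qed

lemma dom_lcomp [simp]: "dom (g \<circ>\<^sub>l f) = dom f"
  and cod_lcomp [simp]: "cod (g \<circ>\<^sub>l f) = cod g"
  by (simp_all add: lcomp_def)

lemma lcomp_fn [simp]: "x \<in> carrier (dom f) \<Longrightarrow> fn (g \<circ>\<^sub>l f) x = fn g (fn f x)"
  by (simp add: lcomp_def compose_def)

lemma lcomp_in [intro]:
  assumes "fd_hilbert_space H" "f \<in> Lin H K" "g \<in> Lin K L" shows "g \<circ>\<^sub>l f \<in> Lin H L"
proof -
  interpret H: fd_hilbert_space H by fact
  show ?thesis
    using assms(2,3)
    by (auto simp: Lin_def lcomp_def LinearCombinations.module_hom_def compose_def Pi_iff)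
qed

lemma lcomp_assoc:
  assumes "fd_hilbert_space H" "fd_hilbert_space K"
    and "f \<in> Lin H K" "g \<in> Lin K L" "h \<in> Lin L M"
  shows "(h \<circ>\<^sub>l g) \<circ>\<^sub>l f = h \<circ>\<^sub>l (g \<circ>\<^sub>l f)"
  using assms by (intro Lin_eqI[of _ H M]) (auto simp: Lin_in Lin_dom)

lemma lid_fn [simp]: "x \<in> carrier H \<Longrightarrow> fn (lid H) x = x"
  and lid_dom [simp]: "dom (lid H) = H" and lid_cod [simp]: "cod (lid H) = H"
  by (simp_all add: lid_def)

lemma lid_in [simp, intro]: "fd_hilbert_space H \<Longrightarrow> lid H \<in> Lin H H"
proof -
  assume "fd_hilbert_space H"
  then interpret H: fd_hilbert_space H .
  show ?thesis by (rule LinI) (auto simp: lid_def)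
qed

lemma lcomp_lid_right:
  assumes "fd_hilbert_space H" "f \<in> Lin H K" shows "f \<circ>\<^sub>l lid H = f"
  using assms by (intro Lin_eqI[of _ H K]) (auto simp: Lin_dom)

lemma lcomp_lid_left:
  assumes "fd_hilbert_space H" "fd_hilbert_space K" "f \<in> Lin H K" shows "lid K \<circ>\<^sub>l f = f"
  using assms by (intro Lin_eqI[of _ H K]) (auto simp: Lin_in Lin_dom)

text \<open>Riesz representation yields each value of the map separately, and nondegeneracy makes
  the values depend linearly on the argument. Prescribing matrix coefficients in this way produces
  both adjoints and linear maps out of tensor products.\<close>

lemma ex_lin_of_coefficients:
  assumes H: "fd_hilbert_space H" and K: "fd_hilbert_space K"
    and lin: "\<And>x. x \<in> carrier H \<Longrightarrow> linear_functional K (\<lambda>z. cnj (b z x))"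
    and lin': "\<And>z. z \<in> carrier K \<Longrightarrow> linear_functional H (b z)"
  shows "\<exists>f \<in> Lin H K. \<forall>x \<in> carrier H. \<forall>z \<in> carrier K. inner K z (fn f x) = b z x"
proof -
  interpret H: fd_hilbert_space H by fact
  interpret K: fd_hilbert_space K by fact
  define g where "g x = (SOME v. v \<in> carrier K \<and> (\<forall>z \<in> carrier K. inner K z v = b z x))" for x
  have g: "g x \<in> carrier K" "\<And>z. z \<in> carrier K \<Longrightarrow> inner K z (g x) = b z x"
    if "x \<in> carrier H" for x
    using someI_ex[OF K.riesz_right[OF lin[OF that], unfolded Bex_def]]
    unfolding g_def by blast+
  have "mk_lin H K g \<in> Lin H K"
  proof (rule mk_lin_in[OF H])
    show "g x \<in> carrier K" if "x \<in> carrier H" for x using g that by auto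
    show "g (x \<oplus>\<^bsub>H\<^esub> y) = g x \<oplus>\<^bsub>K\<^esub> g y" if "x \<in> carrier H" "y \<in> carrier H" for x y
      using that lin'
      by (intro K.inner_ext) (auto simp: g K.inner_add_right linear_functional_def)
    show "g (c \<odot>\<^bsub>H\<^esub> x) = c \<odot>\<^bsub>K\<^esub> g x" if "x \<in> carrier H" for c x
      using that lin'
      by (intro K.inner_ext) (auto simp: g K.inner_smult_right linear_functional_def)
  qed
  then show ?thesis using g by (intro bexI[of _ "mk_lin H K g"]) auto
qed

lemma ex_adj:
  assumes H: "fd_hilbert_space H" and K: "fd_hilbert_space K" and f: "f \<in> Lin H K"
  shows "\<exists>g \<in> Lin K H. \<forall>y \<in> carrier K. \<forall>x \<in> carrier H. inner H x (fn g y) = inner K (fn f x) y"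
proof (rule ex_lin_of_coefficients[OF K H])
  interpret H: fd_hilbert_space H by fact
  interpret K: fd_hilbert_space K by fact
  show "linear_functional H (\<lambda>z. cnj (inner K (fn f z) y))" if "y \<in> carrier K" for y
    by (rule linear_functionalI) (simp_all add: that Lin_add[OF f] Lin_smult[OF f] Lin_in[OF f]
      K.inner_add_left K.inner_smult_left)
  show "linear_functional K (inner K (fn f z))" if "z \<in> carrier H" for z
    using that by (intro K.linear_functional_inner Lin_in[OF f])
qed

text \<open>Nondegeneracy makes the description defining \<open>adj\<close> unique, so exhibiting
  one candidate computes the adjoint.\<close>

lemma adj_eqI:
  assumes H: "fd_hilbert_space H" and K: "fd_hilbert_space K" and f: "f \<in> Lin H K"
    and g: "g \<in> Lin K H"
    and eq: "\<And>x y. x \<in> carrier H \<Longrightarrow> y \<in> carrier K \<Longrightarrow> inner H (fn g y) x = inner K y (fn f x)"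
  shows "f\<^sup>\<dagger> = g"
  unfolding adj_def Lin_dom[OF f] Lin_cod[OF f]
proof (rule the_equality)
  show "g \<in> Lin K H \<and> (\<forall>x\<in>carrier H. \<forall>y\<in>carrier K. inner H (fn g y) x = inner K y (fn f x))"
    using g eq by auto
next
  interpret H: fd_hilbert_space H by fact
  fix g'
  assume g': "g' \<in> Lin K H \<and> (\<forall>x\<in>carrier H. \<forall>y\<in>carrier K. inner H (fn g' y) x = inner K y (fn f x))"
  show "g' = g"
    using g' g eq by (intro Lin_eqI[of _ K H] H.inner_ext_left) (auto simp: Lin_in)
qed

lemma adj_props:
  assumes H: "fd_hilbert_space H" and K: "fd_hilbert_space K" and f: "f \<in> Lin H K"
  shows adj_in: "f\<^sup>\<dagger> \<in> Lin K H"
    and adj_inner: "\<And>x y. x \<in> carrier H \<Longrightarrow> y \<in> carrier K \<Longrightarrow>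
      inner H (fn (f\<^sup>\<dagger>) y) x = inner K y (fn f x)"
    and adj_inner_right: "\<And>x y. x \<in> carrier H \<Longrightarrow> y \<in> carrier K \<Longrightarrow>
      inner H x (fn (f\<^sup>\<dagger>) y) = inner K (fn f x) y"
proof -
  interpret H: fd_hilbert_space H by fact
  interpret K: fd_hilbert_space K by fact
  obtain g where g: "g \<in> Lin K H"
    "\<And>x y. x \<in> carrier H \<Longrightarrow> y \<in> carrier K \<Longrightarrow> inner H x (fn g y) = inner K (fn f x) y"
    using ex_adj[OF assms] by blast
  have g': "inner H (fn g y) x = inner K y (fn f x)" if "x \<in> carrier H" "y \<in> carrier K" for x y
    using g(2)[OF that] H.inner_commute[of x "fn g y"] K.inner_commute[of "fn f x" y] that
      Lin_in[OF f that(1)] Lin_in[OF g(1) that(2)] by simp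
  have "f\<^sup>\<dagger> = g" by (rule adj_eqI[OF assms g(1) g'])
  then show "f\<^sup>\<dagger> \<in> Lin K H"
    and "\<And>x y. x \<in> carrier H \<Longrightarrow> y \<in> carrier K \<Longrightarrow> inner H (fn (f\<^sup>\<dagger>) y) x = inner K y (fn f x)"
    and "\<And>x y. x \<in> carrier H \<Longrightarrow> y \<in> carrier K \<Longrightarrow> inner H x (fn (f\<^sup>\<dagger>) y) = inner K (fn f x) y"
    using g g' by auto
qed

lemma adj_adj:
  assumes "fd_hilbert_space H" "fd_hilbert_space K" "f \<in> Lin H K"
  shows "(f\<^sup>\<dagger>)\<^sup>\<dagger> = f"
  using assms by (intro adj_eqI[of K H]) (auto simp: adj_in adj_inner_right)

lemma adj_lid: "fd_hilbert_space H \<Longrightarrow> (lid H)\<^sup>\<dagger> = lid H"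
  by (rule adj_eqI[of H H]) auto

lemma adj_lcomp:
  assumes H: "fd_hilbert_space H" and K: "fd_hilbert_space K" and L: "fd_hilbert_space L"
    and f: "f \<in> Lin H K" and g: "g \<in> Lin K L"
  shows "(g \<circ>\<^sub>l f)\<^sup>\<dagger> = f\<^sup>\<dagger> \<circ>\<^sub>l g\<^sup>\<dagger>"
proof (rule adj_eqI[OF H L])
  note af = adj_in[OF H K f] and ag = adj_in[OF K L g]
  show "g \<circ>\<^sub>l f \<in> Lin H L" "f\<^sup>\<dagger> \<circ>\<^sub>l g\<^sup>\<dagger> \<in> Lin L H" using f g af ag H L by auto
  show "inner H (fn (f\<^sup>\<dagger> \<circ>\<^sub>l g\<^sup>\<dagger>) y) x = inner L y (fn (g \<circ>\<^sub>l f) x)"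
    if "x \<in> carrier H" "y \<in> carrier L" for x y
    using that f g af ag
    by (simp add: adj_inner[OF H K f] adj_inner[OF K L g] Lin_in[of _ L K] Lin_in[of _ H K] Lin_dom[OF f] Lin_dom[OF ag])
qed

section \<open>Tensor products\<close>

lemma tensor_simps [simp]:
  "zero (H \<otimes>\<^sub>h K) = (\<lambda>p. 0)" "add (H \<otimes>\<^sub>h K) = (\<lambda>\<phi> \<psi> p. \<phi> p + \<psi> p)"
  "smult (H \<otimes>\<^sub>h K) = (\<lambda>c \<phi> p. c * \<phi> p)" "inner (H \<otimes>\<^sub>h K) = tensor_inner H K"
  by (simp_all add: tensor_def)

lemma carrier_tensor: "\<phi> \<in> carrier (H \<otimes>\<^sub>h K) \<longleftrightarrow> (\<exists>n x y. tensor_rep H K n x y \<phi>)"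
  by (simp add: tensor_def)

lemma etensor_apply [simp]:
  "a \<in> carrier H \<Longrightarrow> b \<in> carrier K \<Longrightarrow> etensor H K x y (a, b) = inner H a x * inner K b y"
  by (simp add: etensor_def)

lemma tensor_zero_in [simp]: "(\<lambda>p. 0) \<in> carrier (H \<otimes>\<^sub>h K)"
proof -
  have "tensor_rep H K 0 x y (\<lambda>p. 0)" for x y by (simp add: tensor_rep_def)
  then show ?thesis unfolding carrier_tensor by blast
qed

lemma tensor_add_etensor:
  assumes "\<phi> \<in> carrier (H \<otimes>\<^sub>h K)" "x \<in> carrier H" "y \<in> carrier K"
  shows "(\<lambda>p. \<phi> p + etensor H K x y p) \<in> carrier (H \<otimes>\<^sub>h K)"
proof -
  obtain n u v where "tensor_rep H K n u v \<phi>" using assms(1) by (auto simp: carrier_tensor)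
  then have "tensor_rep H K (Suc n) (u(n := x)) (v(n := y)) (\<lambda>p. \<phi> p + etensor H K x y p)"
    using assms by (simp add: tensor_rep_def less_Suc_eq)
  then show ?thesis unfolding carrier_tensor by blast
qed

lemma etensor_in [simp, intro]:
  "x \<in> carrier H \<Longrightarrow> y \<in> carrier K \<Longrightarrow> etensor H K x y \<in> carrier (H \<otimes>\<^sub>h K)"
  using tensor_add_etensor[OF tensor_zero_in, of x H y K] by simp

lemma tensor_induct_rep [consumes 1, case_names zero add]:
  assumes "\<phi> \<in> carrier (H \<otimes>\<^sub>h K)" and "P (\<lambda>p. 0)"
    and "\<And>\<psi> x y. \<lbrakk>\<psi> \<in> carrier (H \<otimes>\<^sub>h K); P \<psi>; x \<in> carrier H; y \<in> carrier K\<rbrakk>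
      \<Longrightarrow> P (\<lambda>p. \<psi> p + etensor H K x y p)"
  shows "P \<phi>"
proof -
  obtain n u v where *: "tensor_rep H K n u v \<phi>" using assms(1) by (auto simp: carrier_tensor)
  have "(\<lambda>p. \<Sum>i<m. etensor H K (u i) (v i) p) \<in> carrier (H \<otimes>\<^sub>h K) \<and>
      P (\<lambda>p. \<Sum>i<m. etensor H K (u i) (v i) p)" if "m \<le> n" for m
    using that
  proof (induction m)
    case 0
    then show ?case using assms(2) by simp
  next
    case (Suc m)
    then have "u m \<in> carrier H" "v m \<in> carrier K" using * by (auto simp: tensor_rep_def)
    then show ?case
      using Suc tensor_add_etensor[of "\<lambda>p. \<Sum>i<m. etensor H K (u i) (v i) p" H K "u m" "v m"]
        assms(3)[of "\<lambda>p. \<Sum>i<m. etensor H K (u i) (v i) p" "u m" "v m"]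
      by simp
  qed
  from this[of n] show ?thesis using * by (simp add: tensor_rep_def)
qed

lemma tensor_add_in:
  assumes "\<phi> \<in> carrier (H \<otimes>\<^sub>h K)" "\<psi> \<in> carrier (H \<otimes>\<^sub>h K)"
  shows "(\<lambda>p. \<phi> p + \<psi> p) \<in> carrier (H \<otimes>\<^sub>h K)"
  using assms(2)
proof (induction rule: tensor_induct_rep)
  case zero
  then show ?case using assms(1) by simp
next
  case (add \<psi> x y)
  then show ?case using tensor_add_etensor[OF add(4) add(2,3)] by (simp add: add.assoc)
qed

lemma tensor_outside:
  assumes "\<phi> \<in> carrier (H \<otimes>\<^sub>h K)" "\<not> (a \<in> carrier H \<and> b \<in> carrier K)"
  shows "\<phi> (a, b) = 0"
  using assms(1) by (induction rule: tensor_induct_rep) (use assms(2) in \<open>auto simp: etensor_def\<close>)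

text \<open>Representations are plain sums of elementary tensors, so no case for scalars
  arises.\<close>

lemma tensor_induct [consumes 1, case_names zero add etensor]:
  assumes "\<phi> \<in> carrier (H \<otimes>\<^sub>h K)" and "P (\<lambda>p. 0)"
    and "\<And>\<phi> \<psi>. \<lbrakk>\<phi> \<in> carrier (H \<otimes>\<^sub>h K); \<psi> \<in> carrier (H \<otimes>\<^sub>h K); P \<phi>; P \<psi>\<rbrakk>
      \<Longrightarrow> P (\<lambda>p. \<phi> p + \<psi> p)"
    and "\<And>x y. \<lbrakk>x \<in> carrier H; y \<in> carrier K\<rbrakk> \<Longrightarrow> P (etensor H K x y)"
  shows "P \<phi>"
  using assms(1)
proof (induction rule: tensor_induct_rep)
  case (add \<psi> x y)
  then show ?case using assms(3)[of \<psi> "etensor H K x y"] assms(4) by simp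
qed (rule assms(2))

section \<open>Inner product and universal property of the binary tensor product\<close>

definition bilinear_on :: "'a hilb \<Rightarrow> 'b hilb \<Rightarrow> 'c hilb \<Rightarrow> ('a \<Rightarrow> 'b \<Rightarrow> 'c) \<Rightarrow> bool" where
  "bilinear_on H K V \<beta> \<longleftrightarrow>
     (\<forall>x \<in> carrier H. \<forall>y \<in> carrier K. \<beta> x y \<in> carrier V \<and>
       (\<forall>x' \<in> carrier H. \<beta> (x \<oplus>\<^bsub>H\<^esub> x') y = \<beta> x y \<oplus>\<^bsub>V\<^esub> \<beta> x' y) \<and>
       (\<forall>y' \<in> carrier K. \<beta> x (y \<oplus>\<^bsub>K\<^esub> y') = \<beta> x y \<oplus>\<^bsub>V\<^esub> \<beta> x y') \<and>
       (\<forall>c. \<beta> (c \<odot>\<^bsub>H\<^esub> x) y = c \<odot>\<^bsub>V\<^esub> \<beta> x y \<and> \<beta> x (c \<odot>\<^bsub>K\<^esub> y) = c \<odot>\<^bsub>V\<^esub> \<beta> x y))"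

lemma bilinear_onI:
  assumes "\<And>x y. \<lbrakk>x \<in> carrier H; y \<in> carrier K\<rbrakk> \<Longrightarrow> \<beta> x y \<in> carrier V"
    and "\<And>x x' y. \<lbrakk>x \<in> carrier H; x' \<in> carrier H; y \<in> carrier K\<rbrakk> \<Longrightarrow>
      \<beta> (x \<oplus>\<^bsub>H\<^esub> x') y = \<beta> x y \<oplus>\<^bsub>V\<^esub> \<beta> x' y"
    and "\<And>x y y'. \<lbrakk>x \<in> carrier H; y \<in> carrier K; y' \<in> carrier K\<rbrakk> \<Longrightarrow>
      \<beta> x (y \<oplus>\<^bsub>K\<^esub> y') = \<beta> x y \<oplus>\<^bsub>V\<^esub> \<beta> x y'"
    and "\<And>c x y. \<lbrakk>x \<in> carrier H; y \<in> carrier K\<rbrakk> \<Longrightarrow> \<beta> (c \<odot>\<^bsub>H\<^esub> x) y = c \<odot>\<^bsub>V\<^esub> \<beta> x y"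
    and "\<And>c x y. \<lbrakk>x \<in> carrier H; y \<in> carrier K\<rbrakk> \<Longrightarrow> \<beta> x (c \<odot>\<^bsub>K\<^esub> y) = c \<odot>\<^bsub>V\<^esub> \<beta> x y"
  shows "bilinear_on H K V \<beta>"
  using assms by (simp add: bilinear_on_def)

context
  fixes H :: "'a hilb" and K :: "'b hilb"
  assumes H: "fd_hilbert_space H" and K: "fd_hilbert_space K"
begin

interpretation H: fd_hilbert_space H by (rule H)
interpretation K: fd_hilbert_space K by (rule K)

lemma etensor_add_left: "\<lbrakk>x \<in> carrier H; x' \<in> carrier H; y \<in> carrier K\<rbrakk> \<Longrightarrow>
    etensor H K (x \<oplus>\<^bsub>H\<^esub> x') y = (\<lambda>p. etensor H K x y p + etensor H K x' y p)"
  by (rule ext) (auto simp: etensor_def H.inner_add_right algebra_simps)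

lemma etensor_add_right: "\<lbrakk>x \<in> carrier H; y \<in> carrier K; y' \<in> carrier K\<rbrakk> \<Longrightarrow>
    etensor H K x (y \<oplus>\<^bsub>K\<^esub> y') = (\<lambda>p. etensor H K x y p + etensor H K x y' p)"
  by (rule ext) (auto simp: etensor_def K.inner_add_right algebra_simps)

lemma etensor_smult_left: "\<lbrakk>x \<in> carrier H; y \<in> carrier K\<rbrakk> \<Longrightarrow>
    etensor H K (c \<odot>\<^bsub>H\<^esub> x) y = (\<lambda>p. c * etensor H K x y p)"
  by (rule ext) (auto simp: etensor_def H.inner_smult_right)

lemma etensor_smult_right: "\<lbrakk>x \<in> carrier H; y \<in> carrier K\<rbrakk> \<Longrightarrow>
    etensor H K x (c \<odot>\<^bsub>K\<^esub> y) = (\<lambda>p. c * etensor H K x y p)"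
  by (rule ext) (auto simp: etensor_def K.inner_smult_right)

lemma etensor_zero_left: "y \<in> carrier K \<Longrightarrow> etensor H K \<zero>\<^bsub>H\<^esub> y = (\<lambda>p. 0)"
  by (rule ext) (auto simp: etensor_def)

lemma etensor_zero_right: "x \<in> carrier H \<Longrightarrow> etensor H K x \<zero>\<^bsub>K\<^esub> = (\<lambda>p. 0)"
  by (rule ext) (auto simp: etensor_def)

lemma tensor_smult_in:
  assumes "\<phi> \<in> carrier (H \<otimes>\<^sub>h K)"
  shows "(\<lambda>p. c * \<phi> p) \<in> carrier (H \<otimes>\<^sub>h K)"
  using assms
proof (induction rule: tensor_induct)
  case (add \<phi> \<psi>)
  then show ?case using tensor_add_in[OF add(3,4)] by (simp add: algebra_simps)
next
  case (etensor x y)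
  then show ?case using etensor_smult_left[of x y c] etensor_in[of "c \<odot>\<^bsub>H\<^esub> x" H y K] by simp
qed simp

text \<open>Forms representing tensors are antilinear in each argument, so their conjugates are
  functionals to which frame expansion applies.\<close>

lemma linear_functional_tensor_left:
  assumes "\<phi> \<in> carrier (H \<otimes>\<^sub>h K)" "b \<in> carrier K"
  shows "linear_functional H (\<lambda>a. cnj (\<phi> (a, b)))"
  using assms(1)
proof (induction rule: tensor_induct)
  case (etensor x y)
  show ?case
    by (rule linear_functionalI)
      (simp_all add: etensor assms(2) H.inner_add_left H.inner_smult_left algebra_simps)
qed (auto simp: linear_functional_def algebra_simps)

lemma linear_functional_tensor_right:
  assumes "\<phi> \<in> carrier (H \<otimes>\<^sub>h K)" "a \<in> carrier H"
  shows "linear_functional K (\<lambda>b. cnj (\<phi> (a, b)))"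
  using assms(1)
proof (induction rule: tensor_induct)
  case (etensor x y)
  show ?case
    by (rule linear_functionalI)
      (simp_all add: etensor assms(2) K.inner_add_left K.inner_smult_left algebra_simps)
qed (auto simp: linear_functional_def algebra_simps)

text \<open>Frame expansion in each argument separately: a tensor is determined by the finite matrix
  of its values on frame vectors.\<close>

lemma tensor_frame:
  assumes \<phi>: "\<phi> \<in> carrier (H \<otimes>\<^sub>h K)" and a: "a \<in> carrier H" and b: "b \<in> carrier K"
  shows "\<phi> (a, b) = (\<Sum>e\<in>H.frame. \<Sum>f\<in>K.frame. inner H a e * inner K b f * \<phi> (e, f))"
proof -
  have "cnj (\<phi> (a, b)) = (\<Sum>e\<in>H.frame. inner H e a * cnj (\<phi> (e, b)))"
    by (rule H.linear_functional_frame[OF linear_functional_tensor_left[OF \<phi> b] a])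
  also have "\<dots> = (\<Sum>e\<in>H.frame. inner H e a * (\<Sum>f\<in>K.frame. inner K f b * cnj (\<phi> (e, f))))"
    using K.linear_functional_frame[OF linear_functional_tensor_right[OF \<phi>] b] by simp
  finally have "\<phi> (a, b) =
      cnj (\<Sum>e\<in>H.frame. inner H e a * (\<Sum>f\<in>K.frame. inner K f b * cnj (\<phi> (e, f))))"
    by (metis complex_cnj_cnj)
  also have "\<dots> = (\<Sum>e\<in>H.frame. \<Sum>f\<in>K.frame. inner H a e * inner K b f * \<phi> (e, f))"
    using a b by (simp add: sum_distrib_left mult.assoc H.inner_commute[of _ a]
      K.inner_commute[of _ b])
  finally show ?thesis .
qed

text \<open>The right-hand side mentions only the two forms, so the double sum is independent of the
  representations and the description in \<open>tensor_inner\<close> is well defined. The common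
  value is the Hilbert-Schmidt product of the two matrices of frame values.\<close>

lemma tensor_inner_rep:
  assumes "tensor_rep H K n x y \<phi>" "tensor_rep H K n' x' y' \<psi>"
  shows "(\<Sum>i<n. \<Sum>j<n'. inner H (x i) (x' j) * inner K (y i) (y' j)) =
    (\<Sum>e\<in>H.frame. \<Sum>f\<in>K.frame. cnj (\<phi> (e, f)) * \<psi> (e, f))"
proof -
  have x: "x i \<in> carrier H" "y i \<in> carrier K" if "i < n" for i
    using assms that by (auto simp: tensor_rep_def)
  have \<psi>: "\<psi> \<in> carrier (H \<otimes>\<^sub>h K)" using assms by (auto simp: carrier_tensor)
  \<comment> \<open>Summing over \<open>j\<close> first evaluates the form of the second tensor at
    \<open>(x i, y i)\<close>.\<close>
  have "(\<Sum>i<n. \<Sum>j<n'. inner H (x i) (x' j) * inner K (y i) (y' j)) = (\<Sum>i<n. \<psi> (x i, y i))"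
    using x assms(2) by (intro sum.cong) (auto simp: tensor_rep_def)
  also have "\<dots> = (\<Sum>i<n. \<Sum>e\<in>H.frame. \<Sum>f\<in>K.frame.
      inner H (x i) e * inner K (y i) f * \<psi> (e, f))"
    by (intro sum.cong refl tensor_frame[OF \<psi>] x) simp_all
  also have "\<dots> = (\<Sum>e\<in>H.frame. \<Sum>f\<in>K.frame. \<Sum>i<n.
      inner H (x i) e * inner K (y i) f * \<psi> (e, f))"
  proof -
    have "(\<Sum>i<n. \<Sum>e\<in>H.frame. \<Sum>f\<in>K.frame. inner H (x i) e * inner K (y i) f * \<psi> (e, f)) =
      (\<Sum>e\<in>H.frame. \<Sum>i<n. \<Sum>f\<in>K.frame. inner H (x i) e * inner K (y i) f * \<psi> (e, f))"
      by (rule sum.swap)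
    also have "\<dots> = (\<Sum>e\<in>H.frame. \<Sum>f\<in>K.frame. \<Sum>i<n.
        inner H (x i) e * inner K (y i) f * \<psi> (e, f))"
      by (rule sum.cong[OF refl], rule sum.swap)
    finally show ?thesis .
  qed
  also have "\<dots> = (\<Sum>e\<in>H.frame. \<Sum>f\<in>K.frame. cnj (\<phi> (e, f)) * \<psi> (e, f))"
  proof (intro sum.cong refl)
    fix e f assume ef: "e \<in> H.frame" "f \<in> K.frame"
    have "cnj (\<phi> (e, f)) = (\<Sum>i<n. cnj (inner H e (x i) * inner K f (y i)))"
      using assms(1) ef by (simp add: tensor_rep_def)
    also have "\<dots> = (\<Sum>i<n. inner H (x i) e * inner K (y i) f)"
      using x ef by (intro sum.cong) (auto simp: H.inner_commute[of e] K.inner_commute[of f])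
    finally show "(\<Sum>i<n. inner H (x i) e * inner K (y i) f * \<psi> (e, f)) = cnj (\<phi> (e, f)) * \<psi> (e, f)"
      by (simp add: sum_distrib_right)
  qed
  finally show ?thesis .
qed

lemma tensor_inner_frame:
  assumes "\<phi> \<in> carrier (H \<otimes>\<^sub>h K)" "\<psi> \<in> carrier (H \<otimes>\<^sub>h K)"
  shows "tensor_inner H K \<phi> \<psi> = (\<Sum>e\<in>H.frame. \<Sum>f\<in>K.frame. cnj (\<phi> (e, f)) * \<psi> (e, f))"
  unfolding tensor_inner_def
proof (rule the_equality)
  obtain n x y n' x' y' where reps: "tensor_rep H K n x y \<phi>" "tensor_rep H K n' x' y' \<psi>"
    using assms unfolding carrier_tensor by blast
  show "\<exists>n x y n' x' y'. tensor_rep H K n x y \<phi> \<and> tensor_rep H K n' x' y' \<psi> \<and>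
      (\<Sum>e\<in>H.frame. \<Sum>f\<in>K.frame. cnj (\<phi> (e, f)) * \<psi> (e, f)) =
      (\<Sum>i<n. \<Sum>j<n'. inner H (x i) (x' j) * inner K (y i) (y' j))"
    using tensor_inner_rep[OF reps, symmetric] reps
    by (intro exI conjI)
next
  fix c
  assume "\<exists>n x y n' x' y'. tensor_rep H K n x y \<phi> \<and> tensor_rep H K n' x' y' \<psi> \<and>
      c = (\<Sum>i<n. \<Sum>j<n'. inner H (x i) (x' j) * inner K (y i) (y' j))"
  then show "c = (\<Sum>e\<in>H.frame. \<Sum>f\<in>K.frame. cnj (\<phi> (e, f)) * \<psi> (e, f))"
    by (elim exE conjE) (simp only: tensor_inner_rep)
qed

text \<open>The reproducing property of this model. It turns values of a form into inner products,
  so that vectors of a tensor product produced by an adjoint can be compared pointwise.\<close>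

lemma inner_etensor_left:
  assumes \<phi>: "\<phi> \<in> carrier (H \<otimes>\<^sub>h K)" and a: "a \<in> carrier H" and b: "b \<in> carrier K"
  shows "tensor_inner H K (etensor H K a b) \<phi> = \<phi> (a, b)"
  unfolding tensor_inner_frame[OF etensor_in[OF a b] \<phi>] tensor_frame[OF assms]
  using a b by (intro sum.cong) (auto simp: H.inner_commute[of _ a] K.inner_commute[of _ b])

lemma vectorspace_tensor: "vectorspace class_ring (H \<otimes>\<^sub>h K)"
  by (rule vectorspaceI) (auto simp: tensor_add_in tensor_smult_in algebra_simps)

lemma generates_tensor:
  assumes EH: "generates H EH" and EK: "generates K EK"
  shows "generates (H \<otimes>\<^sub>h K) ((\<lambda>(x, y). etensor H K x y) ` (EH \<times> EK))"
proof (rule generatesI)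
  have sub: "EH \<subseteq> carrier H" "EK \<subseteq> carrier K" using EH EK by (auto simp: generates_def)
  then show "(\<lambda>(x, y). etensor H K x y) ` (EH \<times> EK) \<subseteq> carrier (H \<otimes>\<^sub>h K)" by auto
  fix U \<phi>
  assume E: "(\<lambda>(x, y). etensor H K x y) ` (EH \<times> EK) \<subseteq> U"
    and z: "\<zero>\<^bsub>H \<otimes>\<^sub>h K\<^esub> \<in> U"
    and a: "\<And>x y. \<lbrakk>x \<in> carrier (H \<otimes>\<^sub>h K); y \<in> carrier (H \<otimes>\<^sub>h K); x \<in> U; y \<in> U\<rbrakk>
      \<Longrightarrow> x \<oplus>\<^bsub>H \<otimes>\<^sub>h K\<^esub> y \<in> U"
    and m: "\<And>c x. \<lbrakk>x \<in> carrier (H \<otimes>\<^sub>h K); x \<in> U\<rbrakk> \<Longrightarrow> c \<odot>\<^bsub>H \<otimes>\<^sub>h K\<^esub> x \<in> U"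
    and \<phi>: "\<phi> \<in> carrier (H \<otimes>\<^sub>h K)"
  \<comment> \<open>One factor at a time: the right factor is freed while the left one is still a
    generator, then the left one.\<close>
  have 1: "etensor H K x y \<in> U" if "x \<in> EH" "y \<in> carrier K" for x y
    using EK that(2)
  proof (induction rule: generates_induct)
    case (gen y)
    then show ?case using E that(1) by auto
  next
    case zero
    then show ?case using z that sub by (auto simp: etensor_zero_right)
  next
    case (add y y')
    then show ?case
      using a[of "etensor H K x y" "etensor H K x y'"] that sub
      by (auto simp: etensor_add_right subset_iff)
  next
    case (smult c y)
    then show ?case
      using m[of "etensor H K x y" c] that sub
      by (auto simp: etensor_smult_right subset_iff)
  qed
  have 2: "etensor H K x y \<in> U" if "x \<in> carrier H" "y \<in> carrier K" for x y
    using EH that(1)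
  proof (induction rule: generates_induct)
    case (gen x)
    then show ?case using 1 that by auto
  next
    case zero
    then show ?case using z that by (auto simp: etensor_zero_left)
  next
    case (add x x')
    then show ?case
      using a[of "etensor H K x y" "etensor H K x' y"] that
      by (auto simp: etensor_add_left)
  next
    case (smult c x)
    then show ?case
      using m[of "etensor H K x y" c] that
      by (auto simp: etensor_smult_left)
  qed
  show "\<phi> \<in> U"
    using \<phi>
  proof (induction rule: tensor_induct)
    case zero
    then show ?case using z by simp
  next
    case (add \<phi> \<psi>)
    then show ?case using a by simp
  qed (rule 2)
qed

lemma fd_tensor: "fd_hilbert_space (H \<otimes>\<^sub>h K)"
proof -
  obtain EH EK where E: "finite EH" "finite EK" "generates H EH" "generates K EK"
    using H.ex_generates K.ex_generates by auto
  show ?thesis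
  proof (rule fd_hilbert_spaceI[OF vectorspace_tensor _ generates_tensor[OF E(3,4)]])
    show "finite ((\<lambda>(x, y). etensor H K x y) ` (EH \<times> EK))" using E by auto
    show "inner (H \<otimes>\<^sub>h K) x (y \<oplus>\<^bsub>H \<otimes>\<^sub>h K\<^esub> z) = inner (H \<otimes>\<^sub>h K) x y + inner (H \<otimes>\<^sub>h K) x z"
      if "x \<in> carrier (H \<otimes>\<^sub>h K)" "y \<in> carrier (H \<otimes>\<^sub>h K)" "z \<in> carrier (H \<otimes>\<^sub>h K)" for x y z
      using that by (simp add: tensor_inner_frame tensor_add_in algebra_simps sum.distrib)
    show "inner (H \<otimes>\<^sub>h K) x (c \<odot>\<^bsub>H \<otimes>\<^sub>h K\<^esub> y) = c * inner (H \<otimes>\<^sub>h K) x y"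
      if "x \<in> carrier (H \<otimes>\<^sub>h K)" "y \<in> carrier (H \<otimes>\<^sub>h K)" for c x y
      using that by (simp add: tensor_inner_frame tensor_smult_in sum_distrib_left algebra_simps)
    show "inner (H \<otimes>\<^sub>h K) y x = cnj (inner (H \<otimes>\<^sub>h K) x y)"
      if "x \<in> carrier (H \<otimes>\<^sub>h K)" "y \<in> carrier (H \<otimes>\<^sub>h K)" for x y
      using that by (simp add: tensor_inner_frame mult.commute)
    show "Re (inner (H \<otimes>\<^sub>h K) \<phi> \<phi>) > 0"
      if \<phi>: "\<phi> \<in> carrier (H \<otimes>\<^sub>h K)" "\<phi> \<noteq> \<zero>\<^bsub>H \<otimes>\<^sub>h K\<^esub>" for \<phi>
    proof -
      \<comment> \<open>The squared norm is the sum of the squared moduli of the frame values, hence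
        positive unless all of them vanish.\<close>
      have eq: "Re (inner (H \<otimes>\<^sub>h K) \<phi> \<phi>) = (\<Sum>p\<in>H.frame \<times> K.frame. (cmod (\<phi> p))\<^sup>2)"
      proof -
        have "Re (cnj z * z) = (cmod z)\<^sup>2" for z
          by (simp only: cmod_power2) (simp add: power2_eq_square)
        then show ?thesis
          using \<phi>(1) by (simp add: tensor_inner_frame sum.cartesian_product' del: times_complex.sel)
      qed
      \<comment> \<open>If all frame values vanish, the form is zero on the carriers by
        \<open>tensor_frame\<close> and off them by \<open>tensor_outside\<close>.\<close>
      have "\<exists>p \<in> H.frame \<times> K.frame. \<phi> p \<noteq> 0"
      proof (rule ccontr)
        assume neg: "\<not> ?thesis"
        have "\<phi> (a, b) = 0" for a b
        proof (cases "a \<in> carrier H \<and> b \<in> carrier K")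
          case True
          then show ?thesis using tensor_frame[OF \<phi>(1), of a b] neg by auto
        qed (rule tensor_outside[OF \<phi>(1)])
        then show False using \<phi>(2) by auto
      qed
      then obtain p where p: "p \<in> H.frame \<times> K.frame" "\<phi> p \<noteq> 0" by blast
      show ?thesis unfolding eq by (rule sum_pos2[of _ p]) (use p in auto)
    qed
  qed
qed

lemma tensor_ext:
  fixes V :: "'c hilb"
  assumes V: "fd_hilbert_space V"
    and FG: "F \<in> Lin (H \<otimes>\<^sub>h K) V" "G \<in> Lin (H \<otimes>\<^sub>h K) V"
    and eq: "\<And>x y. \<lbrakk>x \<in> carrier H; y \<in> carrier K\<rbrakk> \<Longrightarrow>
      fn F (etensor H K x y) = fn G (etensor H K x y)"
  shows "F = G"
proof (rule Lin_eqI[OF FG])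
  fix \<phi> assume "\<phi> \<in> carrier (H \<otimes>\<^sub>h K)"
  then show "fn F \<phi> = fn G \<phi>"
  proof (induction rule: tensor_induct)
    case zero
    then show ?case
      using Lin_zero[OF fd_tensor V FG(1)] Lin_zero[OF fd_tensor V FG(2)] by simp
  next
    case (add \<phi> \<psi>)
    then show ?case using Lin_add[OF FG(1)] Lin_add[OF FG(2)] by simp
  qed (rule eq)
qed

text \<open>Extending \<beta> along a representation by elementary tensors would require
  independence of the representation. Prescribing coefficients through the frame values of the form
  avoids this: linearity is then visible, and bilinearity of \<beta> enters only to compute the map
  on elementary tensors.\<close>

lemma tensor_lift:
  fixes V :: "'c hilb"
  assumes V: "fd_hilbert_space V" and \<beta>: "bilinear_on H K V \<beta>"
  shows "\<exists>!F. F \<in> Lin (H \<otimes>\<^sub>h K) V \<and>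
    (\<forall>x \<in> carrier H. \<forall>y \<in> carrier K. fn F (etensor H K x y) = \<beta> x y)"
proof -
  interpret V: fd_hilbert_space V by (rule V)
  have \<beta>_in: "\<beta> x y \<in> carrier V" if "x \<in> carrier H" "y \<in> carrier K" for x y
    using \<beta> that by (auto simp: bilinear_on_def)
  \<comment> \<open>The coefficient \<open>inner V z (fn F \<phi>)\<close> that results from
    expanding \<phi> over pairs of frame vectors.\<close>
  define b where "b z \<phi> = (\<Sum>e\<in>H.frame. \<Sum>f\<in>K.frame. \<phi> (e, f) * inner V z (\<beta> e f))" for z \<phi>
  have "\<exists>F \<in> Lin (H \<otimes>\<^sub>h K) V. \<forall>\<phi> \<in> carrier (H \<otimes>\<^sub>h K). \<forall>z \<in> carrier V. inner V z (fn F \<phi>) = b z \<phi>"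
  proof (rule ex_lin_of_coefficients[OF fd_tensor V])
    show "linear_functional V (\<lambda>z. cnj (b z \<phi>))" for \<phi>
      unfolding b_def
      by (rule linear_functionalI)
        (simp_all add: \<beta>_in V.inner_add_left V.inner_smult_left algebra_simps sum.distrib
          sum_distrib_left)
    show "linear_functional (H \<otimes>\<^sub>h K) (b z)" for z
      unfolding b_def
      by (rule linear_functionalI) (simp_all add: algebra_simps sum.distrib sum_distrib_left)
  qed
  then obtain F where F: "F \<in> Lin (H \<otimes>\<^sub>h K) V"
    "\<And>\<phi> z. \<phi> \<in> carrier (H \<otimes>\<^sub>h K) \<Longrightarrow> z \<in> carrier V \<Longrightarrow> inner V z (fn F \<phi>) = b z \<phi>"
    by blast
  have "fn F (etensor H K x y) = \<beta> x y" if x: "x \<in> carrier H" and y: "y \<in> carrier K" for x y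
  proof (rule V.inner_ext)
    fix z assume z: "z \<in> carrier V"
    have l1: "linear_functional H (\<lambda>x. inner V z (\<beta> x y))"
      using \<beta> y z by (intro linear_functionalI)
        (auto simp: bilinear_on_def V.inner_add_right V.inner_smult_right)
    have l2: "linear_functional K (\<lambda>y. inner V z (\<beta> x y))" if "x \<in> carrier H" for x
      using \<beta> that z by (intro linear_functionalI)
        (auto simp: bilinear_on_def V.inner_add_right V.inner_smult_right)
    have "inner V z (\<beta> x y) = (\<Sum>e\<in>H.frame. inner H e x * inner V z (\<beta> e y))"
      by (rule H.linear_functional_frame[OF l1 x])
    also have "\<dots> = (\<Sum>e\<in>H.frame. inner H e x * (\<Sum>f\<in>K.frame. inner K f y * inner V z (\<beta> e f)))"
      using K.linear_functional_frame[OF l2 y] by (intro sum.cong) auto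
    also have "\<dots> = b z (etensor H K x y)"
      unfolding b_def by (simp add: sum_distrib_left mult.assoc)
    finally show "inner V z (fn F (etensor H K x y)) = inner V z (\<beta> x y)"
      using F(2)[OF etensor_in[OF x y] z] by simp
  qed (use F(1) x y \<beta>_in in \<open>auto simp: Lin_in\<close>)
  note F' = this
  show ?thesis
  proof (intro ex1I[of _ F] conjI ballI F(1) F')
    fix G
    assume G: "G \<in> Lin (H \<otimes>\<^sub>h K) V \<and>
      (\<forall>x \<in> carrier H. \<forall>y \<in> carrier K. fn G (etensor H K x y) = \<beta> x y)"
    show "G = F" by (rule tensor_ext[OF V _ F(1)]) (simp_all add: G F')
  qed
qed

end

lemma bilinear_on_etensor:
  assumes "fd_hilbert_space H" "fd_hilbert_space K"
  shows "bilinear_on H K (H \<otimes>\<^sub>h K) (etensor H K)"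
  using assms
  by (intro bilinear_onI)
    (auto simp: etensor_add_left etensor_add_right etensor_smult_left etensor_smult_right)

lemma tensor_eqI:
  assumes "\<phi> \<in> carrier (H \<otimes>\<^sub>h K)" "\<psi> \<in> carrier (H \<otimes>\<^sub>h K)"
    and "\<And>a b. \<lbrakk>a \<in> carrier H; b \<in> carrier K\<rbrakk> \<Longrightarrow> \<phi> (a, b) = \<psi> (a, b)"
  shows "\<phi> = \<psi>"
proof (rule ext, safe)
  fix a b
  show "\<phi> (a, b) = \<psi> (a, b)"
    using assms(3) tensor_outside[OF assms(1)] tensor_outside[OF assms(2)] by metis
qed

lemma inner_tensor_etensor:
  assumes "fd_hilbert_space H" "fd_hilbert_space K"
    and "x \<in> carrier H" "y \<in> carrier K" "x' \<in> carrier H" "y' \<in> carrier K"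
  shows "inner (H \<otimes>\<^sub>h K) (etensor H K x y) (etensor H K x' y') = inner H x x' * inner K y y'"
  using assms by (simp add: inner_etensor_left)

lemma inner_etensor_tensor:
  assumes "fd_hilbert_space H" "fd_hilbert_space K"
    and "x \<in> carrier H" "y \<in> carrier K" "\<phi> \<in> carrier (H \<otimes>\<^sub>h K)"
  shows "inner (H \<otimes>\<^sub>h K) (etensor H K x y) \<phi> = \<phi> (x, y)"
  using assms by (simp add: inner_etensor_left)

section \<open>Threefold tensor products, handled by freezing one leg\<close>

definition insert_left :: "'a hilb \<Rightarrow> 'b hilb \<Rightarrow> 'a \<Rightarrow> ('b, 'a \<times> 'b \<Rightarrow> complex) linmap" where
  "insert_left H K x = mk_lin K (H \<otimes>\<^sub>h K) (etensor H K x)"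

definition insert_right :: "'a hilb \<Rightarrow> 'b hilb \<Rightarrow> 'b \<Rightarrow> ('a, 'a \<times> 'b \<Rightarrow> complex) linmap" where
  "insert_right H K y = mk_lin H (H \<otimes>\<^sub>h K) (\<lambda>x. etensor H K x y)"

lemma insert_left_fn [simp]: "y \<in> carrier K \<Longrightarrow> fn (insert_left H K x) y = etensor H K x y"
  and insert_left_dom [simp]: "dom (insert_left H K x) = K"
  and insert_right_fn [simp]: "x \<in> carrier H \<Longrightarrow> fn (insert_right H K y) x = etensor H K x y"
  and insert_right_dom [simp]: "dom (insert_right H K y) = H"
  by (simp_all add: insert_left_def insert_right_def) (simp_all add: mk_lin_def)

lemma insert_left_in:
  "\<lbrakk>x \<in> carrier H; fd_hilbert_space H; fd_hilbert_space K\<rbrakk>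
    \<Longrightarrow> insert_left H K x \<in> Lin K (H \<otimes>\<^sub>h K)"
  unfolding insert_left_def
  by (intro mk_lin_in) (auto simp: etensor_add_right etensor_smult_right)

lemma insert_right_in:
  "\<lbrakk>y \<in> carrier K; fd_hilbert_space H; fd_hilbert_space K\<rbrakk>
    \<Longrightarrow> insert_right H K y \<in> Lin H (H \<otimes>\<^sub>h K)"
  unfolding insert_right_def
  by (intro mk_lin_in) (auto simp: etensor_add_left etensor_smult_left)

text \<open>Composing with the insertion of a fixed \<open>z\<close> leaves maps on the binary
  product, where \<open>tensor_ext\<close> applies once more.\<close>

lemma tensor_ext3_left:
  assumes H: "fd_hilbert_space H" and K: "fd_hilbert_space K" and L: "fd_hilbert_space L"
    and V: "fd_hilbert_space V"
    and F: "F \<in> Lin ((H \<otimes>\<^sub>h K) \<otimes>\<^sub>h L) V" and G: "G \<in> Lin ((H \<otimes>\<^sub>h K) \<otimes>\<^sub>h L) V"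
    and eq: "\<And>x y z. \<lbrakk>x \<in> carrier H; y \<in> carrier K; z \<in> carrier L\<rbrakk> \<Longrightarrow>
      fn F (etensor (H \<otimes>\<^sub>h K) L (etensor H K x y) z) =
      fn G (etensor (H \<otimes>\<^sub>h K) L (etensor H K x y) z)"
  shows "F = G"
proof (rule tensor_ext[OF fd_tensor[OF H K] L V F G])
  fix \<phi> z assume \<phi>: "\<phi> \<in> carrier (H \<otimes>\<^sub>h K)" and z: "z \<in> carrier L"
  note i = insert_right_in[OF z fd_tensor[OF H K] L]
  have "F \<circ>\<^sub>l insert_right (H \<otimes>\<^sub>h K) L z = G \<circ>\<^sub>l insert_right (H \<otimes>\<^sub>h K) L z"
    by (rule tensor_ext[OF H K V lcomp_in[OF fd_tensor[OF H K] i F]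
      lcomp_in[OF fd_tensor[OF H K] i G]]) (simp add: eq z)
  then have "fn (F \<circ>\<^sub>l insert_right (H \<otimes>\<^sub>h K) L z) \<phi> = fn (G \<circ>\<^sub>l insert_right (H \<otimes>\<^sub>h K) L z) \<phi>"
    by simp
  then show "fn F (etensor (H \<otimes>\<^sub>h K) L \<phi> z) = fn G (etensor (H \<otimes>\<^sub>h K) L \<phi> z)"
    using \<phi> by simp
qed

lemma tensor_ext3_right:
  assumes H: "fd_hilbert_space H" and K: "fd_hilbert_space K" and L: "fd_hilbert_space L"
    and V: "fd_hilbert_space V"
    and F: "F \<in> Lin (H \<otimes>\<^sub>h (K \<otimes>\<^sub>h L)) V" and G: "G \<in> Lin (H \<otimes>\<^sub>h (K \<otimes>\<^sub>h L)) V"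
    and eq: "\<And>x y z. \<lbrakk>x \<in> carrier H; y \<in> carrier K; z \<in> carrier L\<rbrakk> \<Longrightarrow>
      fn F (etensor H (K \<otimes>\<^sub>h L) x (etensor K L y z)) =
      fn G (etensor H (K \<otimes>\<^sub>h L) x (etensor K L y z))"
  shows "F = G"
proof (rule tensor_ext[OF H fd_tensor[OF K L] V F G])
  fix x \<phi> assume x: "x \<in> carrier H" and \<phi>: "\<phi> \<in> carrier (K \<otimes>\<^sub>h L)"
  note i = insert_left_in[OF x H fd_tensor[OF K L]]
  have "F \<circ>\<^sub>l insert_left H (K \<otimes>\<^sub>h L) x = G \<circ>\<^sub>l insert_left H (K \<otimes>\<^sub>h L) x"
    by (rule tensor_ext[OF K L V lcomp_in[OF fd_tensor[OF K L] i F]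
      lcomp_in[OF fd_tensor[OF K L] i G]]) (simp add: eq x)
  then have "fn (F \<circ>\<^sub>l insert_left H (K \<otimes>\<^sub>h L) x) \<phi> = fn (G \<circ>\<^sub>l insert_left H (K \<otimes>\<^sub>h L) x) \<phi>"
    by simp
  then show "fn F (etensor H (K \<otimes>\<^sub>h L) x \<phi>) = fn G (etensor H (K \<otimes>\<^sub>h L) x \<phi>)"
    using \<phi> by simp
qed

text \<open>A map on a threefold product is built by lifting in two variables with the third as
  parameter. The lift must then be linear in the parameter at every tensor; this is known at
  elementary tensors, and both sides of the claim are additive in the tensor.\<close>

lemma bilinear_on_family:
  assumes H: "fd_hilbert_space H" and K: "fd_hilbert_space K" and L: "fd_hilbert_space L"
    and V: "fd_hilbert_space V"
    and A: "\<And>z. z \<in> carrier L \<Longrightarrow> A z \<in> Lin (H \<otimes>\<^sub>h K) V"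
    and \<tau>: "\<And>x y z. \<lbrakk>x \<in> carrier H; y \<in> carrier K; z \<in> carrier L\<rbrakk> \<Longrightarrow>
      fn (A z) (etensor H K x y) = \<tau> x y z"
    and add: "\<And>x y z z'. \<lbrakk>x \<in> carrier H; y \<in> carrier K; z \<in> carrier L; z' \<in> carrier L\<rbrakk> \<Longrightarrow>
      \<tau> x y (z \<oplus>\<^bsub>L\<^esub> z') = \<tau> x y z \<oplus>\<^bsub>V\<^esub> \<tau> x y z'"
    and smult: "\<And>c x y z. \<lbrakk>x \<in> carrier H; y \<in> carrier K; z \<in> carrier L\<rbrakk> \<Longrightarrow>
      \<tau> x y (c \<odot>\<^bsub>L\<^esub> z) = c \<odot>\<^bsub>V\<^esub> \<tau> x y z"
    and \<phi>: "\<phi> \<in> carrier (H \<otimes>\<^sub>h K)"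
  shows "z \<in> carrier L \<Longrightarrow> z' \<in> carrier L \<Longrightarrow> fn (A (z \<oplus>\<^bsub>L\<^esub> z')) \<phi> = fn (A z) \<phi> \<oplus>\<^bsub>V\<^esub> fn (A z') \<phi>"
    and "z \<in> carrier L \<Longrightarrow> fn (A (c \<odot>\<^bsub>L\<^esub> z)) \<phi> = c \<odot>\<^bsub>V\<^esub> fn (A z) \<phi>"
proof -
  interpret L: fd_hilbert_space L by (rule L)
  interpret V: fd_hilbert_space V by (rule V)
  note HK = fd_tensor[OF H K]
  have zero: "fn (A z) (\<lambda>p. 0) = \<zero>\<^bsub>V\<^esub>" if "z \<in> carrier L" for z
    using Lin_zero[OF HK V A[OF that]] by simp
  have plus: "fn (A z) (\<lambda>p. \<phi> p + \<psi> p) = fn (A z) \<phi> \<oplus>\<^bsub>V\<^esub> fn (A z) \<psi>"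
    if "z \<in> carrier L" "\<phi> \<in> carrier (H \<otimes>\<^sub>h K)" "\<psi> \<in> carrier (H \<otimes>\<^sub>h K)" for z \<phi> \<psi>
    using Lin_add[OF A[OF that(1)] that(2,3)] by simp
  have Ain: "fn (A z) \<phi> \<in> carrier V" if "z \<in> carrier L" "\<phi> \<in> carrier (H \<otimes>\<^sub>h K)" for z \<phi>
    by (rule Lin_in[OF A[OF that(1)] that(2)])
  show "fn (A (z \<oplus>\<^bsub>L\<^esub> z')) \<phi> = fn (A z) \<phi> \<oplus>\<^bsub>V\<^esub> fn (A z') \<phi>"
    if z: "z \<in> carrier L" "z' \<in> carrier L"
    using \<phi>
  proof (induction rule: tensor_induct)
    case (add \<phi> \<psi>)
    then show ?case using z by (simp add: plus Ain V.a_ac)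
  qed (use z in \<open>simp_all add: zero \<tau> assms(7)\<close>)
  show "fn (A (c \<odot>\<^bsub>L\<^esub> z)) \<phi> = c \<odot>\<^bsub>V\<^esub> fn (A z) \<phi>" if z: "z \<in> carrier L"
    using \<phi>
  proof (induction rule: tensor_induct)
    case (add \<phi> \<psi>)
    then show ?case using z by (simp add: plus Ain V.smult_add_right)
  qed (use z in \<open>simp_all add: zero \<tau> smult\<close>)
qed

lemma tensor_lift_fam:
  assumes H: "fd_hilbert_space H" and K: "fd_hilbert_space K" and V: "fd_hilbert_space V"
    and \<beta>: "\<And>z. z \<in> Z \<Longrightarrow> bilinear_on H K V (\<lambda>x y. \<tau> x y z)"
  shows "\<exists>A. \<forall>z \<in> Z. A z \<in> Lin (H \<otimes>\<^sub>h K) V \<and>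
    (\<forall>x \<in> carrier H. \<forall>y \<in> carrier K. fn (A z) (etensor H K x y) = \<tau> x y z)"
  using tensor_lift[OF H K V \<beta>] by (intro bchoice) blast

text \<open>Currying: for fixed \<open>z\<close> the binary universal property gives
  \<open>A z\<close>, and sending \<phi> and \<open>z\<close> to \<open>fn (A z) \<phi>\<close> is
  bilinear, so it lifts again.\<close>

lemma tensor_lift3_left:
  assumes H: "fd_hilbert_space H" and K: "fd_hilbert_space K" and L: "fd_hilbert_space L"
    and V: "fd_hilbert_space V"
    and \<beta>1: "\<And>z. z \<in> carrier L \<Longrightarrow> bilinear_on H K V (\<lambda>x y. \<tau> x y z)"
    and \<beta>2: "\<And>x. x \<in> carrier H \<Longrightarrow> bilinear_on K L V (\<tau> x)"
  shows "\<exists>!F. F \<in> Lin ((H \<otimes>\<^sub>h K) \<otimes>\<^sub>h L) V \<and>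
    (\<forall>x \<in> carrier H. \<forall>y \<in> carrier K. \<forall>z \<in> carrier L.
       fn F (etensor (H \<otimes>\<^sub>h K) L (etensor H K x y) z) = \<tau> x y z)"
proof (rule ex_ex1I)
  obtain A where A: "\<And>z. z \<in> carrier L \<Longrightarrow> A z \<in> Lin (H \<otimes>\<^sub>h K) V"
    "\<And>x y z. \<lbrakk>x \<in> carrier H; y \<in> carrier K; z \<in> carrier L\<rbrakk> \<Longrightarrow>
      fn (A z) (etensor H K x y) = \<tau> x y z"
    using tensor_lift_fam[OF H K V, of "carrier L" \<tau>] \<beta>1 by metis
  have "bilinear_on (H \<otimes>\<^sub>h K) L V (\<lambda>\<phi> z. fn (A z) \<phi>)"
    by (rule bilinear_onI)
      (use \<beta>2 in \<open>auto simp: Lin_in[OF A(1)] Lin_add[OF A(1), simplified]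
        Lin_smult[OF A(1), simplified] bilinear_on_def
        intro!: bilinear_on_family[OF H K L V A]\<close>)
  from tensor_lift[OF fd_tensor[OF H K] L V this]
  show "\<exists>F. F \<in> Lin ((H \<otimes>\<^sub>h K) \<otimes>\<^sub>h L) V \<and>
    (\<forall>x \<in> carrier H. \<forall>y \<in> carrier K. \<forall>z \<in> carrier L.
       fn F (etensor (H \<otimes>\<^sub>h K) L (etensor H K x y) z) = \<tau> x y z)"
    by (auto simp: A(2))
qed (auto intro: tensor_ext3_left[OF H K L V])

lemma tensor_lift3_right:
  assumes H: "fd_hilbert_space H" and K: "fd_hilbert_space K" and L: "fd_hilbert_space L"
    and V: "fd_hilbert_space V"
    and \<beta>1: "\<And>z. z \<in> carrier L \<Longrightarrow> bilinear_on H K V (\<lambda>x y. \<tau> x y z)"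
    and \<beta>2: "\<And>x. x \<in> carrier H \<Longrightarrow> bilinear_on K L V (\<tau> x)"
  shows "\<exists>!F. F \<in> Lin (H \<otimes>\<^sub>h (K \<otimes>\<^sub>h L)) V \<and>
    (\<forall>x \<in> carrier H. \<forall>y \<in> carrier K. \<forall>z \<in> carrier L.
       fn F (etensor H (K \<otimes>\<^sub>h L) x (etensor K L y z)) = \<tau> x y z)"
proof (rule ex_ex1I)
  obtain A where A: "\<And>x. x \<in> carrier H \<Longrightarrow> A x \<in> Lin (K \<otimes>\<^sub>h L) V"
    "\<And>y z x. \<lbrakk>y \<in> carrier K; z \<in> carrier L; x \<in> carrier H\<rbrakk> \<Longrightarrow>
      fn (A x) (etensor K L y z) = \<tau> x y z"
    using tensor_lift_fam[OF K L V, of "carrier H" "\<lambda>y z x. \<tau> x y z"] \<beta>2 by metis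
  have "bilinear_on H (K \<otimes>\<^sub>h L) V (\<lambda>x \<phi>. fn (A x) \<phi>)"
    by (rule bilinear_onI)
      (use \<beta>1 in \<open>auto simp: Lin_in[OF A(1)] Lin_add[OF A(1), simplified]
        Lin_smult[OF A(1), simplified] bilinear_on_def
        intro!: bilinear_on_family[OF K L H V A]\<close>)
  from tensor_lift[OF H fd_tensor[OF K L] V this]
  show "\<exists>F. F \<in> Lin (H \<otimes>\<^sub>h (K \<otimes>\<^sub>h L)) V \<and>
    (\<forall>x \<in> carrier H. \<forall>y \<in> carrier K. \<forall>z \<in> carrier L.
       fn F (etensor H (K \<otimes>\<^sub>h L) x (etensor K L y z)) = \<tau> x y z)"
    by (auto simp: A(2))
qed (auto intro: tensor_ext3_right[OF H K L V])

section \<open>Structure maps\<close>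

text \<open>The universal property discharges the definite description; from here on tensors of maps
  are used through these two facts only.\<close>

lemma ltensor_props:
  assumes f: "f \<in> Lin H H'" and g: "g \<in> Lin K K'"
    and H: "fd_hilbert_space H" and K: "fd_hilbert_space K"
    and H': "fd_hilbert_space H'" and K': "fd_hilbert_space K'"
  shows ltensor_in: "f \<otimes>\<^sub>l g \<in> Lin (H \<otimes>\<^sub>h K) (H' \<otimes>\<^sub>h K')"
    and ltensor_fn: "\<And>x y. \<lbrakk>x \<in> carrier H; y \<in> carrier K\<rbrakk> \<Longrightarrow>
      fn (f \<otimes>\<^sub>l g) (etensor H K x y) = etensor H' K' (fn f x) (fn g y)"
proof -
  have "bilinear_on H K (H' \<otimes>\<^sub>h K') (\<lambda>x y. etensor H' K' (fn f x) (fn g y))"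
    by (rule bilinear_onI)
      (auto simp: Lin_in[OF f] Lin_in[OF g] Lin_add[OF f] Lin_add[OF g] Lin_smult[OF f]
        Lin_smult[OF g] etensor_add_left[OF H' K'] etensor_add_right[OF H' K']
        etensor_smult_left[OF H' K'] etensor_smult_right[OF H' K'])
  from theI'[OF tensor_lift[OF H K fd_tensor[OF H' K'] this]]
  have *: "f \<otimes>\<^sub>l g \<in> Lin (H \<otimes>\<^sub>h K) (H' \<otimes>\<^sub>h K') \<and>
    (\<forall>x \<in> carrier H. \<forall>y \<in> carrier K.
       fn (f \<otimes>\<^sub>l g) (etensor H K x y) = etensor H' K' (fn f x) (fn g y))"
    unfolding ltensor_def Lin_dom[OF f] Lin_dom[OF g] Lin_cod[OF f] Lin_cod[OF g] .
  then show "f \<otimes>\<^sub>l g \<in> Lin (H \<otimes>\<^sub>h K) (H' \<otimes>\<^sub>h K')" by blast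
  show "fn (f \<otimes>\<^sub>l g) (etensor H K x y) = etensor H' K' (fn f x) (fn g y)"
    if "x \<in> carrier H" "y \<in> carrier K" for x y using * that by blast
qed

lemma assoc_props:
  assumes H: "fd_hilbert_space H" and K: "fd_hilbert_space K" and L: "fd_hilbert_space L"
  shows assoc_in: "assoc H K L \<in> Lin ((H \<otimes>\<^sub>h K) \<otimes>\<^sub>h L) (H \<otimes>\<^sub>h (K \<otimes>\<^sub>h L))"
    and assoc_fn: "\<And>x y z. \<lbrakk>x \<in> carrier H; y \<in> carrier K; z \<in> carrier L\<rbrakk> \<Longrightarrow>
      fn (assoc H K L) (etensor (H \<otimes>\<^sub>h K) L (etensor H K x y) z) =
      etensor H (K \<otimes>\<^sub>h L) x (etensor K L y z)"
proof -
  note KL = fd_tensor[OF K L]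
  have "\<exists>!F. F \<in> Lin ((H \<otimes>\<^sub>h K) \<otimes>\<^sub>h L) (H \<otimes>\<^sub>h (K \<otimes>\<^sub>h L)) \<and>
    (\<forall>x \<in> carrier H. \<forall>y \<in> carrier K. \<forall>z \<in> carrier L.
       fn F (etensor (H \<otimes>\<^sub>h K) L (etensor H K x y) z) =
       etensor H (K \<otimes>\<^sub>h L) x (etensor K L y z))"
    using bilinear_on_etensor[OF H KL] bilinear_on_etensor[OF K L]
    by (intro tensor_lift3_left[OF H K L fd_tensor[OF H KL]] bilinear_onI)
      (auto simp: bilinear_on_def)
  note * = theI'[OF this, folded assoc_def]
  then show "assoc H K L \<in> Lin ((H \<otimes>\<^sub>h K) \<otimes>\<^sub>h L) (H \<otimes>\<^sub>h (K \<otimes>\<^sub>h L))" by blast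
  show "fn (assoc H K L) (etensor (H \<otimes>\<^sub>h K) L (etensor H K x y) z) =
      etensor H (K \<otimes>\<^sub>h L) x (etensor K L y z)"
    if "x \<in> carrier H" "y \<in> carrier K" "z \<in> carrier L" for x y z using * that by blast
qed

lemma assoc_inv_props:
  assumes H: "fd_hilbert_space H" and K: "fd_hilbert_space K" and L: "fd_hilbert_space L"
  shows assoc_inv_in: "assoc_inv H K L \<in> Lin (H \<otimes>\<^sub>h (K \<otimes>\<^sub>h L)) ((H \<otimes>\<^sub>h K) \<otimes>\<^sub>h L)"
    and assoc_inv_fn: "\<And>x y z. \<lbrakk>x \<in> carrier H; y \<in> carrier K; z \<in> carrier L\<rbrakk> \<Longrightarrow>
      fn (assoc_inv H K L) (etensor H (K \<otimes>\<^sub>h L) x (etensor K L y z)) =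
      etensor (H \<otimes>\<^sub>h K) L (etensor H K x y) z"
proof -
  note HK = fd_tensor[OF H K]
  have "\<exists>!F. F \<in> Lin (H \<otimes>\<^sub>h (K \<otimes>\<^sub>h L)) ((H \<otimes>\<^sub>h K) \<otimes>\<^sub>h L) \<and>
    (\<forall>x \<in> carrier H. \<forall>y \<in> carrier K. \<forall>z \<in> carrier L.
       fn F (etensor H (K \<otimes>\<^sub>h L) x (etensor K L y z)) =
       etensor (H \<otimes>\<^sub>h K) L (etensor H K x y) z)"
    using bilinear_on_etensor[OF HK L] bilinear_on_etensor[OF H K]
    by (intro tensor_lift3_right[OF H K L fd_tensor[OF HK L]] bilinear_onI)
      (auto simp: bilinear_on_def)
  note * = theI'[OF this, folded assoc_inv_def]
  then show "assoc_inv H K L \<in> Lin (H \<otimes>\<^sub>h (K \<otimes>\<^sub>h L)) ((H \<otimes>\<^sub>h K) \<otimes>\<^sub>h L)" by blast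
  show "fn (assoc_inv H K L) (etensor H (K \<otimes>\<^sub>h L) x (etensor K L y z)) =
      etensor (H \<otimes>\<^sub>h K) L (etensor H K x y) z"
    if "x \<in> carrier H" "y \<in> carrier K" "z \<in> carrier L" for x y z using * that by blast
qed

lemma lunit_props:
  assumes H: "fd_hilbert_space H"
  shows lunit_in: "lunit H \<in> Lin (complex_hilb \<otimes>\<^sub>h H) H"
    and lunit_fn: "\<And>c x. x \<in> carrier H \<Longrightarrow> fn (lunit H) (etensor complex_hilb H c x) = c \<odot>\<^bsub>H\<^esub> x"
proof -
  interpret H: fd_hilbert_space H by (rule H)
  have "bilinear_on complex_hilb H H (\<lambda>c x. c \<odot>\<^bsub>H\<^esub> x)"
    by (rule bilinear_onI)
      (auto simp: H.smult_add_left H.smult_add_right H.smult_smult[symmetric] mult.commute)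
  from theI'[OF tensor_lift[OF fd_complex_hilb H H this]]
  have *: "lunit H \<in> Lin (complex_hilb \<otimes>\<^sub>h H) H \<and>
    (\<forall>c. \<forall>x \<in> carrier H. fn (lunit H) (etensor complex_hilb H c x) = c \<odot>\<^bsub>H\<^esub> x)"
    unfolding lunit_def by simp
  then show "lunit H \<in> Lin (complex_hilb \<otimes>\<^sub>h H) H" by blast
  show "fn (lunit H) (etensor complex_hilb H c x) = c \<odot>\<^bsub>H\<^esub> x"
    if "x \<in> carrier H" for c x using * that by blast
qed

lemma runit_props:
  assumes H: "fd_hilbert_space H"
  shows runit_in: "runit H \<in> Lin (H \<otimes>\<^sub>h complex_hilb) H"
    and runit_fn: "\<And>c x. x \<in> carrier H \<Longrightarrow> fn (runit H) (etensor H complex_hilb x c) = c \<odot>\<^bsub>H\<^esub> x"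
proof -
  interpret H: fd_hilbert_space H by (rule H)
  have "bilinear_on H complex_hilb H (\<lambda>x c. c \<odot>\<^bsub>H\<^esub> x)"
    by (rule bilinear_onI)
      (auto simp: H.smult_add_left H.smult_add_right H.smult_smult[symmetric] mult.commute)
  from theI'[OF tensor_lift[OF H fd_complex_hilb H this]]
  have *: "runit H \<in> Lin (H \<otimes>\<^sub>h complex_hilb) H \<and>
    (\<forall>x \<in> carrier H. \<forall>c. fn (runit H) (etensor H complex_hilb x c) = c \<odot>\<^bsub>H\<^esub> x)"
    unfolding runit_def by simp
  then show "runit H \<in> Lin (H \<otimes>\<^sub>h complex_hilb) H" by blast
  show "fn (runit H) (etensor H complex_hilb x c) = c \<odot>\<^bsub>H\<^esub> x"
    if "x \<in> carrier H" for c x using * that by blast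
qed

lemma runit_inv_fn [simp]: "x \<in> carrier H \<Longrightarrow> fn (runit_inv H) x = etensor H complex_hilb x 1"
  and runit_inv_dom [simp]: "dom (runit_inv H) = H"
  by (simp_all add: runit_inv_def)

lemma runit_inv_in: "fd_hilbert_space H \<Longrightarrow> runit_inv H \<in> Lin H (H \<otimes>\<^sub>h complex_hilb)"
  using insert_right_in[of 1 complex_hilb H]
  by (simp add: runit_inv_def insert_right_def mk_lin_def)

lemmas fd_intros = fd_tensor fd_complex_hilb

lemmas lin_intros = lcomp_in ltensor_in adj_in[rotated 2] lid_in assoc_in assoc_inv_in lunit_in runit_in
  runit_inv_in insert_left_in insert_right_in fd_intros

lemma ltensor_lcomp:
  assumes f: "f \<in> Lin H H'" and g: "g \<in> Lin K K'" and f': "f' \<in> Lin H' H''" and g': "g' \<in> Lin K' K''"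
    and fd: "fd_hilbert_space H" "fd_hilbert_space K" "fd_hilbert_space H'"
      "fd_hilbert_space K'" "fd_hilbert_space H''" "fd_hilbert_space K''"
  shows "(f' \<otimes>\<^sub>l g') \<circ>\<^sub>l (f \<otimes>\<^sub>l g) = (f' \<circ>\<^sub>l f) \<otimes>\<^sub>l (g' \<circ>\<^sub>l g)"
proof (rule tensor_ext[OF fd(1,2) fd_tensor[OF fd(5,6)]])
  note fg = ltensor_in[OF f g fd(1,2,3,4)]
  note ff = lcomp_in[OF fd(1) f f'] and gg = lcomp_in[OF fd(2) g g']
  show "(f' \<otimes>\<^sub>l g') \<circ>\<^sub>l (f \<otimes>\<^sub>l g) \<in> Lin (H \<otimes>\<^sub>h K) (H'' \<otimes>\<^sub>h K'')"
    "(f' \<circ>\<^sub>l f) \<otimes>\<^sub>l (g' \<circ>\<^sub>l g) \<in> Lin (H \<otimes>\<^sub>h K) (H'' \<otimes>\<^sub>h K'')"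
    by (rule lin_intros f g f' g' fd)+
  fix x y assume x: "x \<in> carrier H" and y: "y \<in> carrier K"
  show "fn ((f' \<otimes>\<^sub>l g') \<circ>\<^sub>l (f \<otimes>\<^sub>l g)) (etensor H K x y) =
      fn ((f' \<circ>\<^sub>l f) \<otimes>\<^sub>l (g' \<circ>\<^sub>l g)) (etensor H K x y)"
    using x y
    by (simp add: Lin_dom[OF fg] Lin_dom[OF f] Lin_dom[OF g] ltensor_fn[OF f g fd(1,2,3,4)]
      ltensor_fn[OF f' g' fd(3,4,5,6)] ltensor_fn[OF ff gg fd(1,2,5,6)] Lin_in[OF f] Lin_in[OF g])
qed

text \<open>On an elementary tensor both sides yield forms. The reproducing property turns their
  values into products of inner products, where the adjunction applies in each factor.\<close>

lemma ltensor_adj: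
  assumes f: "f \<in> Lin H H'" and g: "g \<in> Lin K K'"
    and H: "fd_hilbert_space H" and K: "fd_hilbert_space K"
    and H': "fd_hilbert_space H'" and K': "fd_hilbert_space K'"
  shows "(f \<otimes>\<^sub>l g)\<^sup>\<dagger> = f\<^sup>\<dagger> \<otimes>\<^sub>l g\<^sup>\<dagger>"
proof (rule tensor_ext[OF H' K' fd_tensor[OF H K]])
  note HK = fd_tensor[OF H K] and HK' = fd_tensor[OF H' K']
  note fg = ltensor_in[OF assms] and af = adj_in[OF H H' f] and ag = adj_in[OF K K' g]
  note afg = adj_in[OF HK HK' fg] and fag = ltensor_in[OF af ag H' K' H K]
  show "(f \<otimes>\<^sub>l g)\<^sup>\<dagger> \<in> Lin (H' \<otimes>\<^sub>h K') (H \<otimes>\<^sub>h K)" "f\<^sup>\<dagger> \<otimes>\<^sub>l g\<^sup>\<dagger> \<in> Lin (H' \<otimes>\<^sub>h K') (H \<otimes>\<^sub>h K)"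
    by (rule afg fag)+
  fix x y assume x: "x \<in> carrier H'" and y: "y \<in> carrier K'"
  show "fn ((f \<otimes>\<^sub>l g)\<^sup>\<dagger>) (etensor H' K' x y) = fn (f\<^sup>\<dagger> \<otimes>\<^sub>l g\<^sup>\<dagger>) (etensor H' K' x y)"
  proof (rule tensor_eqI)
    show "fn ((f \<otimes>\<^sub>l g)\<^sup>\<dagger>) (etensor H' K' x y) \<in> carrier (H \<otimes>\<^sub>h K)"
      "fn (f\<^sup>\<dagger> \<otimes>\<^sub>l g\<^sup>\<dagger>) (etensor H' K' x y) \<in> carrier (H \<otimes>\<^sub>h K)"
      using x y by (intro Lin_in[OF afg] Lin_in[OF fag] etensor_in; simp)+
    fix a b assume a: "a \<in> carrier H" and b: "b \<in> carrier K"
    have "fn ((f \<otimes>\<^sub>l g)\<^sup>\<dagger>) (etensor H' K' x y) (a, b) =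
        inner (H \<otimes>\<^sub>h K) (etensor H K a b) (fn ((f \<otimes>\<^sub>l g)\<^sup>\<dagger>) (etensor H' K' x y))"
      using a b x y by (intro inner_etensor_tensor[symmetric] Lin_in[OF afg] H K) auto
    also have "\<dots> = inner H' (fn f a) x * inner K' (fn g b) y"
      using a b x y
      by (simp only: adj_inner_right[OF HK HK' fg] etensor_in ltensor_fn[OF assms]
        inner_tensor_etensor[OF H' K'] Lin_in[OF f] Lin_in[OF g])
    also have "\<dots> = fn (f\<^sup>\<dagger> \<otimes>\<^sub>l g\<^sup>\<dagger>) (etensor H' K' x y) (a, b)"
      using a b x y
      by (simp add: ltensor_fn[OF af ag H' K' H K] Lin_in[OF af] Lin_in[OF ag]
        adj_inner_right[OF H H' f] adj_inner_right[OF K K' g])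
    finally show "fn ((f \<otimes>\<^sub>l g)\<^sup>\<dagger>) (etensor H' K' x y) (a, b) =
      fn (f\<^sup>\<dagger> \<otimes>\<^sub>l g\<^sup>\<dagger>) (etensor H' K' x y) (a, b)" .
  qed
qed

text \<open>Needed to take the adjoint of the right unit law. The reproducing property computes
  \<open>(runit H)\<^sup>\<dagger>\<close> directly, and a second adjoint gives the claim.\<close>

lemma adj_runit_inv:
  assumes H: "fd_hilbert_space H"
  shows "(runit_inv H)\<^sup>\<dagger> = runit H"
proof -
  interpret H: fd_hilbert_space H by (rule H)
  note HC = fd_tensor[OF H fd_complex_hilb]
  note r = runit_in[OF H] and ar = adj_in[OF HC H runit_in[OF H]]
  have "(runit H)\<^sup>\<dagger> = runit_inv H"
  proof (rule Lin_eqI[OF ar runit_inv_in[OF H]])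
    fix x assume x: "x \<in> carrier H"
    have "fn ((runit H)\<^sup>\<dagger>) x = etensor H complex_hilb x 1"
    proof (rule tensor_eqI)
      show "fn ((runit H)\<^sup>\<dagger>) x \<in> carrier (H \<otimes>\<^sub>h complex_hilb)" by (rule Lin_in[OF ar x])
      show "etensor H complex_hilb x 1 \<in> carrier (H \<otimes>\<^sub>h complex_hilb)" using x by simp
      fix a c assume a: "a \<in> carrier H" and c: "c \<in> carrier complex_hilb"
      have "fn ((runit H)\<^sup>\<dagger>) x (a, c) =
          inner (H \<otimes>\<^sub>h complex_hilb) (etensor H complex_hilb a c) (fn ((runit H)\<^sup>\<dagger>) x)"
        by (intro inner_etensor_tensor[symmetric] Lin_in[OF ar x] H fd_complex_hilb a c)
      also have "\<dots> = cnj c * inner H a x"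
        using a c x
        by (simp only: adj_inner_right[OF HC H r] etensor_in runit_fn[OF H] H.inner_smult_left)
      finally show "fn ((runit H)\<^sup>\<dagger>) x (a, c) = etensor H complex_hilb x 1 (a, c)"
        using a c by simp
    qed
    then show "fn ((runit H)\<^sup>\<dagger>) x = fn (runit_inv H) x" using x by simp
  qed
  then show ?thesis using adj_adj[OF HC H r] by simp
qed

lemma ltensor_lid:
  assumes H: "fd_hilbert_space H" and K: "fd_hilbert_space K"
  shows "lid H \<otimes>\<^sub>l lid K = lid (H \<otimes>\<^sub>h K)"
  by (rule tensor_ext[OF H K fd_tensor[OF H K]])
    (auto intro!: lin_intros H K simp: ltensor_fn[OF lid_in[OF H] lid_in[OF K] H K H K])

lemma assoc_natural:
  assumes f: "f \<in> Lin H H'" and g: "g \<in> Lin K K'" and h: "h \<in> Lin L L'"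
    and H: "fd_hilbert_space H" and K: "fd_hilbert_space K" and L: "fd_hilbert_space L"
    and H': "fd_hilbert_space H'" and K': "fd_hilbert_space K'" and L': "fd_hilbert_space L'"
  shows "assoc H' K' L' \<circ>\<^sub>l ((f \<otimes>\<^sub>l g) \<otimes>\<^sub>l h) = (f \<otimes>\<^sub>l (g \<otimes>\<^sub>l h)) \<circ>\<^sub>l assoc H K L"
proof (rule tensor_ext3_left[OF H K L fd_tensor[OF H' fd_tensor[OF K' L']]])
  note fg = ltensor_in[OF f g H K H' K'] and gh = ltensor_in[OF g h K L K' L']
  note HK = fd_tensor[OF H K] and KL = fd_tensor[OF K L]
  note HK' = fd_tensor[OF H' K'] and KL' = fd_tensor[OF K' L']
  note fgh = ltensor_in[OF fg h HK L HK' L']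
  show "assoc H' K' L' \<circ>\<^sub>l ((f \<otimes>\<^sub>l g) \<otimes>\<^sub>l h) \<in> Lin ((H \<otimes>\<^sub>h K) \<otimes>\<^sub>h L) (H' \<otimes>\<^sub>h (K' \<otimes>\<^sub>h L'))"
    "(f \<otimes>\<^sub>l (g \<otimes>\<^sub>l h)) \<circ>\<^sub>l assoc H K L \<in> Lin ((H \<otimes>\<^sub>h K) \<otimes>\<^sub>h L) (H' \<otimes>\<^sub>h (K' \<otimes>\<^sub>h L'))"
    by (rule lin_intros assms)+
  fix x y z assume xyz: "x \<in> carrier H" "y \<in> carrier K" "z \<in> carrier L"
  show "fn (assoc H' K' L' \<circ>\<^sub>l ((f \<otimes>\<^sub>l g) \<otimes>\<^sub>l h)) (etensor (H \<otimes>\<^sub>h K) L (etensor H K x y) z) =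
      fn ((f \<otimes>\<^sub>l (g \<otimes>\<^sub>l h)) \<circ>\<^sub>l assoc H K L) (etensor (H \<otimes>\<^sub>h K) L (etensor H K x y) z)"
    using xyz
    by (simp add: Lin_dom[OF fgh] Lin_dom[OF assoc_in[OF H K L]] assoc_fn[OF H K L]
      assoc_fn[OF H' K' L'] ltensor_fn[OF fg h HK L HK' L'] ltensor_fn[OF f g H K H' K']
      ltensor_fn[OF g h K L K' L'] ltensor_fn[OF f gh H KL H' KL']
      Lin_in[OF f] Lin_in[OF g] Lin_in[OF h])
qed

lemma assoc_inv_natural:
  assumes f: "f \<in> Lin H H'" and g: "g \<in> Lin K K'" and h: "h \<in> Lin L L'"
    and H: "fd_hilbert_space H" and K: "fd_hilbert_space K" and L: "fd_hilbert_space L"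
    and H': "fd_hilbert_space H'" and K': "fd_hilbert_space K'" and L': "fd_hilbert_space L'"
  shows "assoc_inv H' K' L' \<circ>\<^sub>l (f \<otimes>\<^sub>l (g \<otimes>\<^sub>l h)) = ((f \<otimes>\<^sub>l g) \<otimes>\<^sub>l h) \<circ>\<^sub>l assoc_inv H K L"
proof (rule tensor_ext3_right[OF H K L fd_tensor[OF fd_tensor[OF H' K'] L']])
  note fg = ltensor_in[OF f g H K H' K'] and gh = ltensor_in[OF g h K L K' L']
  note HK = fd_tensor[OF H K] and KL = fd_tensor[OF K L]
  note HK' = fd_tensor[OF H' K'] and KL' = fd_tensor[OF K' L']
  note fgh = ltensor_in[OF f gh H KL H' KL']
  show "assoc_inv H' K' L' \<circ>\<^sub>l (f \<otimes>\<^sub>l (g \<otimes>\<^sub>l h)) \<in> Lin (H \<otimes>\<^sub>h (K \<otimes>\<^sub>h L)) ((H' \<otimes>\<^sub>h K') \<otimes>\<^sub>h L')"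
    "((f \<otimes>\<^sub>l g) \<otimes>\<^sub>l h) \<circ>\<^sub>l assoc_inv H K L \<in> Lin (H \<otimes>\<^sub>h (K \<otimes>\<^sub>h L)) ((H' \<otimes>\<^sub>h K') \<otimes>\<^sub>h L')"
    by (rule lin_intros assms)+
  fix x y z assume xyz: "x \<in> carrier H" "y \<in> carrier K" "z \<in> carrier L"
  show "fn (assoc_inv H' K' L' \<circ>\<^sub>l (f \<otimes>\<^sub>l (g \<otimes>\<^sub>l h))) (etensor H (K \<otimes>\<^sub>h L) x (etensor K L y z)) =
      fn (((f \<otimes>\<^sub>l g) \<otimes>\<^sub>l h) \<circ>\<^sub>l assoc_inv H K L) (etensor H (K \<otimes>\<^sub>h L) x (etensor K L y z))"
    using xyz
    by (simp add: Lin_dom[OF fgh] Lin_dom[OF assoc_inv_in[OF H K L]] assoc_inv_fn[OF H K L]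
      assoc_inv_fn[OF H' K' L'] ltensor_fn[OF fg h HK L HK' L'] ltensor_fn[OF f g H K H' K']
      ltensor_fn[OF g h K L K' L'] ltensor_fn[OF f gh H KL H' KL']
      Lin_in[OF f] Lin_in[OF g] Lin_in[OF h])
qed

section \<open>Quantum sets\<close>

locale qset =
  fixes A :: "'a frob"
  assumes quantum_set: "quantum_set A"
begin

lemma fd_sp: "fd_hilbert_space (sp A)"
  and mul_in: "mul A \<in> Lin (sp A \<otimes>\<^sub>h sp A) (sp A)"
  and unt_in: "unt A \<in> Lin complex_hilb (sp A)"
  and left_unit: "mul A \<circ>\<^sub>l (unt A \<otimes>\<^sub>l lid (sp A)) = lunit (sp A)"
  and right_unit: "mul A \<circ>\<^sub>l (lid (sp A) \<otimes>\<^sub>l unt A) = runit (sp A)"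
  and frobenius: "comul A \<circ>\<^sub>l mul A =
    (lid (sp A) \<otimes>\<^sub>l mul A) \<circ>\<^sub>l assoc (sp A) (sp A) (sp A) \<circ>\<^sub>l (comul A \<otimes>\<^sub>l lid (sp A))"
  using quantum_set by (auto simp: quantum_set_def Let_def)

interpretation S: fd_hilbert_space "sp A" by (rule fd_sp)

lemmas fd_SS = fd_tensor[OF fd_sp fd_sp]

lemma comul_in: "comul A \<in> Lin (sp A) (sp A \<otimes>\<^sub>h sp A)"
  unfolding comul_def by (rule adj_in[OF fd_SS fd_sp mul_in])

lemma counit_in: "counit A \<in> Lin (sp A) complex_hilb"
  unfolding counit_def by (rule adj_in[OF fd_complex_hilb fd_sp unt_in])

lemma pairing_in: "counit A \<circ>\<^sub>l mul A \<in> Lin (sp A \<otimes>\<^sub>h sp A) complex_hilb"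
  by (rule lcomp_in[OF fd_SS mul_in counit_in])

lemma copairing_in: "comul A \<circ>\<^sub>l unt A \<in> Lin complex_hilb (sp A \<otimes>\<^sub>h sp A)"
  by (rule lcomp_in[OF fd_complex_hilb unt_in comul_in])

lemmas alg_intros = fd_sp mul_in unt_in comul_in counit_in pairing_in copairing_in

text \<open>Freezing one argument of the pairing turns it into a functional on \<open>sp A\<close>,
  so that duality can be stated without associators.\<close>

definition pair_right :: "'a \<Rightarrow> ('a, complex) linmap" where
  "pair_right a = (counit A \<circ>\<^sub>l mul A) \<circ>\<^sub>l insert_right (sp A) (sp A) a"

lemma pair_right_in: "a \<in> carrier (sp A) \<Longrightarrow> pair_right a \<in> Lin (sp A) complex_hilb"
  unfolding pair_right_def by (rule lin_intros alg_intros | assumption)+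

lemma pair_right_fn: "a \<in> carrier (sp A) \<Longrightarrow> s \<in> carrier (sp A) \<Longrightarrow>
    fn (pair_right a) s = fn (counit A) (fn (mul A) (etensor (sp A) (sp A) s a))"
  unfolding pair_right_def by (simp add: Lin_dom[OF mul_in])

definition pair_left :: "'a \<Rightarrow> ('a, complex) linmap" where
  "pair_left a = (counit A \<circ>\<^sub>l mul A) \<circ>\<^sub>l insert_left (sp A) (sp A) a"

lemma pair_left_in: "a \<in> carrier (sp A) \<Longrightarrow> pair_left a \<in> Lin (sp A) complex_hilb"
  unfolding pair_left_def by (rule lin_intros alg_intros | assumption)+

lemma pair_left_fn: "a \<in> carrier (sp A) \<Longrightarrow> s \<in> carrier (sp A) \<Longrightarrow>
    fn (pair_left a) s = fn (counit A) (fn (mul A) (etensor (sp A) (sp A) a s))"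
  unfolding pair_left_def by (simp add: Lin_dom[OF mul_in])

lemma mul_unt: "a \<in> carrier (sp A) \<Longrightarrow>
    fn (mul A) (etensor (sp A) (sp A) (fn (unt A) 1) a) = a"
proof -
  assume a: "a \<in> carrier (sp A)"
  have "fn (mul A \<circ>\<^sub>l (unt A \<otimes>\<^sub>l lid (sp A))) (etensor complex_hilb (sp A) 1 a) = a"
    unfolding left_unit using lunit_fn[OF fd_sp a, of 1] a by simp
  then show ?thesis
    using a ltensor_in[OF unt_in lid_in[OF fd_sp] fd_complex_hilb fd_sp fd_sp fd_sp]
    by (simp add: Lin_dom ltensor_fn[OF unt_in lid_in[OF fd_sp] fd_complex_hilb fd_sp fd_sp fd_sp])
qed

text \<open>The adjoint of the right unit law, with \<open>runit_inv\<close> composed in so that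
  both sides are endomorphisms of \<open>sp A\<close>.\<close>

lemma counit_comul:
  assumes a: "a \<in> carrier (sp A)"
  shows "fn (runit (sp A)) (fn (lid (sp A) \<otimes>\<^sub>l counit A) (fn (comul A) a)) = a"
proof -
  let ?f = "mul A \<circ>\<^sub>l ((lid (sp A) \<otimes>\<^sub>l unt A) \<circ>\<^sub>l runit_inv (sp A))"
  note SC = fd_tensor[OF fd_sp fd_complex_hilb]
  note l = lid_in[OF fd_sp]
  note lu = ltensor_in[OF l unt_in fd_sp fd_complex_hilb fd_sp fd_sp]
  note ri = runit_inv_in[OF fd_sp]
  have "?f = (mul A \<circ>\<^sub>l (lid (sp A) \<otimes>\<^sub>l unt A)) \<circ>\<^sub>l runit_inv (sp A)"
    by (rule lcomp_assoc[symmetric, OF fd_sp SC ri lu mul_in])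
  also have "\<dots> = lid (sp A)"
    unfolding right_unit
    by (rule Lin_eqI[of _ "sp A" "sp A"]) (auto intro!: lin_intros alg_intros simp: runit_fn fd_sp)
  finally have "?f\<^sup>\<dagger> = lid (sp A)" using adj_lid[OF fd_sp] by simp
  moreover have "?f\<^sup>\<dagger> = (runit (sp A) \<circ>\<^sub>l (lid (sp A) \<otimes>\<^sub>l counit A)) \<circ>\<^sub>l comul A"
    by (simp add: adj_lcomp[OF fd_sp fd_SS fd_sp lcomp_in[OF fd_sp ri lu] mul_in]
      adj_lcomp[OF fd_sp SC fd_SS ri lu] ltensor_adj[OF l unt_in fd_sp fd_complex_hilb fd_sp fd_sp]
      adj_lid[OF fd_sp] adj_runit_inv[OF fd_sp] comul_def counit_def)
  ultimately have "fn ((runit (sp A) \<circ>\<^sub>l (lid (sp A) \<otimes>\<^sub>l counit A)) \<circ>\<^sub>l comul A) a = a"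
    using a by simp
  then show ?thesis
    using a Lin_in[OF comul_in a]
    by (simp add: Lin_dom[OF comul_in] Lin_dom[OF ltensor_in[OF l counit_in fd_sp fd_sp fd_sp fd_complex_hilb]])
qed

text \<open>The snake identity: the copairing \<open>\<Delta> u\<close> is dual to the pairing \<open>\<epsilon> m\<close>.\<close>

lemma snake:
  assumes a: "a \<in> carrier (sp A)"
  shows "fn (runit (sp A)) (fn (lid (sp A) \<otimes>\<^sub>l pair_right a) (fn (comul A \<circ>\<^sub>l unt A) 1)) = a"
proof -
  let ?S = "sp A"
  note l = lid_in[OF fd_sp]
  note lm = ltensor_in[OF l mul_in fd_sp fd_SS fd_sp fd_sp]
  note lc = ltensor_in[OF l counit_in fd_sp fd_sp fd_sp fd_complex_hilb]
  note lp = ltensor_in[OF l pair_right_in[OF a] fd_sp fd_sp fd_sp fd_complex_hilb]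
  note cl = ltensor_in[OF comul_in l fd_sp fd_sp fd_SS fd_sp]
  note as = assoc_in[OF fd_sp fd_sp fd_sp]
  \<comment> \<open>\<open>?F\<close> multiplies the second leg by \<open>a\<close> on the right and
    applies the counit to the product, which is contraction with
    \<open>pair_right a\<close>.\<close>
  let ?F = "runit ?S \<circ>\<^sub>l ((lid ?S \<otimes>\<^sub>l counit A) \<circ>\<^sub>l ((lid ?S \<otimes>\<^sub>l mul A) \<circ>\<^sub>l
    (assoc ?S ?S ?S \<circ>\<^sub>l insert_right (?S \<otimes>\<^sub>h ?S) ?S a)))"
  have FG: "?F = runit ?S \<circ>\<^sub>l (lid ?S \<otimes>\<^sub>l pair_right a)"
  proof (rule tensor_ext[OF fd_sp fd_sp fd_sp])
    show "?F \<in> Lin (?S \<otimes>\<^sub>h ?S) ?S" "runit ?S \<circ>\<^sub>l (lid ?S \<otimes>\<^sub>l pair_right a) \<in> Lin (?S \<otimes>\<^sub>h ?S) ?S"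
      by (rule lin_intros alg_intros pair_right_in a)+
    fix x y assume x: "x \<in> carrier ?S" and y: "y \<in> carrier ?S"
    show "fn ?F (etensor ?S ?S x y) = fn (runit ?S \<circ>\<^sub>l (lid ?S \<otimes>\<^sub>l pair_right a)) (etensor ?S ?S x y)"
      using x y a
      by (simp add: Lin_dom[OF lp] assoc_fn[OF fd_sp fd_sp fd_sp]
        ltensor_fn[OF l mul_in fd_sp fd_SS fd_sp fd_sp]
        ltensor_fn[OF l counit_in fd_sp fd_sp fd_sp fd_complex_hilb] Lin_in[OF mul_in]
        ltensor_fn[OF l pair_right_in[OF a] fd_sp fd_sp fd_sp fd_complex_hilb] pair_right_fn)
  qed
  define u where "u = fn (unt A) 1"
  have u: "u \<in> carrier ?S" unfolding u_def by (rule Lin_in[OF unt_in]) simp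
  have cu: "fn (comul A \<circ>\<^sub>l unt A) 1 = fn (comul A) u"
    by (simp add: u_def Lin_dom[OF unt_in])
  note c = Lin_in[OF comul_in u]
  \<comment> \<open>The unit law writes \<open>a\<close> as the product of the unit with
    \<open>a\<close>, and Frobenius moves the multiplication past the comultiplication: the
    comultiple of \<open>a\<close> is that of the unit with its second leg multiplied by
    \<open>a\<close>. The counit law then recovers \<open>a\<close>.\<close>
  have "fn (comul A) a = fn (comul A \<circ>\<^sub>l mul A) (etensor ?S ?S u a)"
    using a u mul_unt[OF a] by (simp add: Lin_dom[OF mul_in] u_def)
  also have "\<dots> = fn (lid ?S \<otimes>\<^sub>l mul A) (fn (assoc ?S ?S ?S)
      (etensor (?S \<otimes>\<^sub>h ?S) ?S (fn (comul A) u) a))"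
    unfolding frobenius using a u c
    by (simp add: Lin_dom[OF cl] Lin_dom[OF as] ltensor_fn[OF comul_in l fd_sp fd_sp fd_SS fd_sp])
  finally have eq: "fn (comul A) a = \<dots>" .
  have "a = fn ?F (fn (comul A) u)"
    using counit_comul[OF a] a c by (simp add: eq)
  also have "\<dots> = fn (runit ?S) (fn (lid ?S \<otimes>\<^sub>l pair_right a) (fn (comul A) u))"
    unfolding FG using c by (simp add: Lin_dom[OF lp])
  finally show ?thesis unfolding cu by simp
qed

text \<open>By the snake identity, \<open>l = \<epsilon> m (t \<otimes> -)\<close> for \<open>t = (l \<otimes> id) \<Delta> u\<close>.\<close>

lemma ex_pair_left:
  assumes l: "l \<in> Lin (sp A) complex_hilb"
  shows "\<exists>t \<in> carrier (sp A). pair_left t = l"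
proof -
  let ?S = "sp A"
  let ?c = "fn (comul A \<circ>\<^sub>l unt A) 1"
  let ?g = "lunit ?S \<circ>\<^sub>l (l \<otimes>\<^sub>l lid ?S)"
  note ll = ltensor_in[OF l lid_in[OF fd_sp] fd_sp fd_sp fd_complex_hilb fd_sp]
  have g: "?g \<in> Lin (?S \<otimes>\<^sub>h ?S) ?S" by (rule lin_intros l fd_sp)+
  have c: "?c \<in> carrier (?S \<otimes>\<^sub>h ?S)" by (rule Lin_in[OF copairing_in]) simp
  have t: "fn ?g ?c \<in> carrier ?S" by (rule Lin_in[OF g c])
  have "pair_left (fn ?g ?c) = l"
  proof (rule Lin_eqI[OF pair_left_in[OF t] l])
    fix a assume a: "a \<in> carrier ?S"
    note lp = ltensor_in[OF lid_in[OF fd_sp] pair_right_in[OF a] fd_sp fd_sp fd_sp fd_complex_hilb]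
    \<comment> \<open>Functionals on different legs may be applied in either order. Evaluated at the
      copairing, the right-hand order is the snake identity inside \<open>l\<close>.\<close>
    have eq: "pair_right a \<circ>\<^sub>l ?g = l \<circ>\<^sub>l (runit ?S \<circ>\<^sub>l (lid ?S \<otimes>\<^sub>l pair_right a))"
    proof (rule tensor_ext[OF fd_sp fd_sp fd_complex_hilb])
      show "pair_right a \<circ>\<^sub>l ?g \<in> Lin (?S \<otimes>\<^sub>h ?S) complex_hilb"
        "l \<circ>\<^sub>l (runit ?S \<circ>\<^sub>l (lid ?S \<otimes>\<^sub>l pair_right a)) \<in> Lin (?S \<otimes>\<^sub>h ?S) complex_hilb"
        by (rule lin_intros l pair_right_in[OF a] fd_sp)+
      fix x y assume x: "x \<in> carrier ?S" and y: "y \<in> carrier ?S"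
      show "fn (pair_right a \<circ>\<^sub>l ?g) (etensor ?S ?S x y) =
          fn (l \<circ>\<^sub>l (runit ?S \<circ>\<^sub>l (lid ?S \<otimes>\<^sub>l pair_right a))) (etensor ?S ?S x y)"
        using x y
        by (simp add: Lin_dom[OF ll] Lin_dom[OF lp] lunit_fn[OF fd_sp] runit_fn[OF fd_sp]
          ltensor_fn[OF l lid_in[OF fd_sp] fd_sp fd_sp fd_complex_hilb fd_sp]
          ltensor_fn[OF lid_in[OF fd_sp] pair_right_in[OF a] fd_sp fd_sp fd_sp fd_complex_hilb]
          Lin_smult[OF l] Lin_smult[OF pair_right_in[OF a]] mult.commute)
    qed
    have "fn (pair_left (fn ?g ?c)) a = fn (pair_right a) (fn ?g ?c)"
      using t a by (simp only: pair_left_fn pair_right_fn)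
    also have "\<dots> = fn (pair_right a \<circ>\<^sub>l ?g) ?c"
      using c by (simp add: Lin_dom[OF ll])
    also have "\<dots> = fn l a"
      unfolding eq using c snake[OF a] by (simp add: Lin_dom[OF lp])
    finally show "fn (pair_left (fn ?g ?c)) a = fn l a" .
  qed
  with t show ?thesis by blast
qed

end

section \<open>Slices along functionals and the bending of structure maps\<close>

locale qset_pair = A: qset A + B: qset B
  for A :: "'a frob" and B :: "'b frob"
begin

abbreviation S where "S \<equiv> sp A"
abbreviation T where "T \<equiv> sp B"

lemmas qs_intros = lin_intros A.alg_intros B.alg_intros

definition slice :: "'k hilb \<Rightarrow> ('b, complex) linmap \<Rightarrow> ('b \<times> 'k \<Rightarrow> complex, 'k) linmap" where
  "slice K l = lunit K \<circ>\<^sub>l (l \<otimes>\<^sub>l lid K)"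

lemma slice_in:
  assumes "l \<in> Lin T complex_hilb" and "fd_hilbert_space K"
  shows "slice K l \<in> Lin (T \<otimes>\<^sub>h K) K"
  unfolding slice_def by (rule qs_intros assms)+

lemma slice_fn:
  assumes l: "l \<in> Lin T complex_hilb" and K: "fd_hilbert_space K"
    and "b \<in> carrier T" "k \<in> carrier K"
  shows "fn (slice K l) (etensor T K b k) = fn l b \<odot>\<^bsub>K\<^esub> k"
  using assms(3,4) unfolding slice_def
  by (simp add: Lin_dom[OF ltensor_in[OF l lid_in[OF K] B.fd_sp K fd_complex_hilb K]]
    ltensor_fn[OF l lid_in[OF K] B.fd_sp K fd_complex_hilb K] lunit_fn[OF K])

lemma slice_natural:
  assumes l: "l \<in> Lin T complex_hilb" and g: "g \<in> Lin K K'"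
    and K: "fd_hilbert_space K" and K': "fd_hilbert_space K'"
  shows "slice K' l \<circ>\<^sub>l (lid T \<otimes>\<^sub>l g) = g \<circ>\<^sub>l slice K l"
proof (rule tensor_ext[OF B.fd_sp K K'])
  note lg = ltensor_in[OF lid_in[OF B.fd_sp] g B.fd_sp K B.fd_sp K']
  show "slice K' l \<circ>\<^sub>l (lid T \<otimes>\<^sub>l g) \<in> Lin (T \<otimes>\<^sub>h K) K'" "g \<circ>\<^sub>l slice K l \<in> Lin (T \<otimes>\<^sub>h K) K'"
    by (rule qs_intros slice_in assms)+
  fix b k assume "b \<in> carrier T" "k \<in> carrier K"
  then show "fn (slice K' l \<circ>\<^sub>l (lid T \<otimes>\<^sub>l g)) (etensor T K b k) =
      fn (g \<circ>\<^sub>l slice K l) (etensor T K b k)"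
    by (simp add: Lin_dom[OF lg] Lin_dom[OF slice_in[OF l K]] slice_fn[OF l K] slice_fn[OF l K']
      ltensor_fn[OF lid_in[OF B.fd_sp] g B.fd_sp K B.fd_sp K'] Lin_in[OF g] Lin_smult[OF g])
qed

text \<open>The right-hand side of condition (iii), which bends both \<open>A\<close> and \<open>B\<close> around.\<close>

definition bend :: "'h hilb \<Rightarrow> 'k hilb \<Rightarrow> ('h \<times> 'a \<Rightarrow> complex, 'b \<times> 'k \<Rightarrow> complex) linmap
    \<Rightarrow> ('b \<times> 'h \<Rightarrow> complex, 'k \<times> 'a \<Rightarrow> complex) linmap" where
  "bend H K P = lunit (K \<otimes>\<^sub>h S) \<circ>\<^sub>l
       ((counit B \<circ>\<^sub>l mul B) \<otimes>\<^sub>l lid (K \<otimes>\<^sub>h S)) \<circ>\<^sub>l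
       assoc (T \<otimes>\<^sub>h T) K S \<circ>\<^sub>l
       (assoc_inv T T K \<otimes>\<^sub>l lid S) \<circ>\<^sub>l
       ((lid T \<otimes>\<^sub>l P) \<otimes>\<^sub>l lid S) \<circ>\<^sub>l
       (assoc T H S \<otimes>\<^sub>l lid S) \<circ>\<^sub>l
       assoc_inv (T \<otimes>\<^sub>h H) S S \<circ>\<^sub>l
       (lid (T \<otimes>\<^sub>h H) \<otimes>\<^sub>l (comul A \<circ>\<^sub>l unt A)) \<circ>\<^sub>l
       runit_inv (T \<otimes>\<^sub>h H)"

lemma bend_in:
  assumes "P \<in> Lin (H \<otimes>\<^sub>h S) (T \<otimes>\<^sub>h K)" "fd_hilbert_space H" "fd_hilbert_space K"
  shows "bend H K P \<in> Lin (T \<otimes>\<^sub>h H) (K \<otimes>\<^sub>h S)"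
  unfolding bend_def by (rule qs_intros assms)+

text \<open>The pairing contracts \<open>t\<close> with the B-output of P and \<open>h\<close> fills
  its H-input, which leaves a plain map from A to K acting on the first leg of the copairing. All
  coherence maps of \<open>bend\<close> are evaluated here; later computations with
  \<open>bend\<close> go through this formula.\<close>

lemma bend_fn:
  assumes P: "P \<in> Lin (H \<otimes>\<^sub>h S) (T \<otimes>\<^sub>h K)" and H: "fd_hilbert_space H" and K: "fd_hilbert_space K"
    and t: "t \<in> carrier T" and h: "h \<in> carrier H"
  shows "fn (bend H K P) (etensor T H t h) =
    fn ((slice K (B.pair_left t) \<circ>\<^sub>l (P \<circ>\<^sub>l insert_left H S h)) \<otimes>\<^sub>l lid S) (fn (comul A \<circ>\<^sub>l unt A) 1)"
proof -
  note S = A.fd_sp and T = B.fd_sp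
  note TT = B.fd_SS and SS = A.fd_SS and TH = fd_tensor[OF T H] and HS = fd_tensor[OF H S]
    and KS = fd_tensor[OF K S] and TK = fd_tensor[OF T K]
  note THS = fd_tensor[OF TH S] and T_HS = fd_tensor[OF T HS] and T_TK = fd_tensor[OF T TK]
    and TTK = fd_tensor[OF TT K] and C = fd_complex_hilb
  note lT = lid_in[OF T] and lS = lid_in[OF S] and lKS = lid_in[OF KS] and lTH = lid_in[OF TH]
  note \<kappa> = B.pairing_in and \<eta> = A.copairing_in
  note pl = B.pair_left_in[OF t] note sl = slice_in[OF pl K]
  let ?\<eta> = "comul A \<circ>\<^sub>l unt A" and ?\<kappa> = "counit B \<circ>\<^sub>l mul B"
  have c: "fn ?\<eta> 1 \<in> carrier (S \<otimes>\<^sub>h S)" by (rule Lin_in[OF \<eta>]) simp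
  \<comment> \<open>\<open>Q\<close> is the part of \<open>bend\<close> after P and \<open>R\<close>
    the part ending with P; what precedes them only places the copairing beside
    \<open>etensor T H t h\<close>.\<close>
  define Q where "Q = lunit (K \<otimes>\<^sub>h S) \<circ>\<^sub>l (?\<kappa> \<otimes>\<^sub>l lid (K \<otimes>\<^sub>h S)) \<circ>\<^sub>l
    assoc (T \<otimes>\<^sub>h T) K S \<circ>\<^sub>l (assoc_inv T T K \<otimes>\<^sub>l lid S)"
  have Q: "Q \<in> Lin ((T \<otimes>\<^sub>h (T \<otimes>\<^sub>h K)) \<otimes>\<^sub>h S) (K \<otimes>\<^sub>h S)"
    unfolding Q_def by (rule qs_intros H K)+
  have Q_fn: "fn Q (etensor (T \<otimes>\<^sub>h (T \<otimes>\<^sub>h K)) S (etensor T (T \<otimes>\<^sub>h K) t \<psi>) s) =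
      etensor K S (fn (slice K (B.pair_left t)) \<psi>) s"
    if s: "s \<in> carrier S" and \<psi>: "\<psi> \<in> carrier (T \<otimes>\<^sub>h K)" for s \<psi>
  proof -
    let ?i = "insert_right (T \<otimes>\<^sub>h (T \<otimes>\<^sub>h K)) S s \<circ>\<^sub>l insert_left T (T \<otimes>\<^sub>h K) t"
    have "Q \<circ>\<^sub>l ?i = insert_right K S s \<circ>\<^sub>l slice K (B.pair_left t)"
    proof (rule tensor_ext[OF T K KS])
      show "Q \<circ>\<^sub>l ?i \<in> Lin (T \<otimes>\<^sub>h K) (K \<otimes>\<^sub>h S)"
        "insert_right K S s \<circ>\<^sub>l slice K (B.pair_left t) \<in> Lin (T \<otimes>\<^sub>h K) (K \<otimes>\<^sub>h S)"
        by (rule qs_intros Q s t sl K)+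
      fix b k assume b: "b \<in> carrier T" and k: "k \<in> carrier K"
      note ai = assoc_inv_in[OF T T K]
      show "fn (Q \<circ>\<^sub>l ?i) (etensor T K b k) =
          fn (insert_right K S s \<circ>\<^sub>l slice K (B.pair_left t)) (etensor T K b k)"
        unfolding Q_def using b k s t Lin_in[OF sl, of "etensor T K b k"]
        by (simp add: Lin_dom[OF sl] slice_fn[OF pl K] B.pair_left_fn
          Lin_dom[OF ltensor_in[OF ai lS T_TK S TTK S]] ltensor_fn[OF ai lS T_TK S TTK S]
          Lin_in[OF ai] assoc_inv_fn[OF T T K] assoc_fn[OF TT K S] Lin_dom[OF assoc_in[OF TT K S]]
          Lin_dom[OF ltensor_in[OF \<kappa> lKS TT KS C KS]] ltensor_fn[OF \<kappa> lKS TT KS C KS]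
          lunit_fn[OF KS] Lin_dom[OF B.mul_in] etensor_smult_left[OF K S])
    qed
    then have "fn (Q \<circ>\<^sub>l ?i) \<psi> = fn (insert_right K S s \<circ>\<^sub>l slice K (B.pair_left t)) \<psi>" by simp
    then show ?thesis
      using \<psi> s t Lin_in[OF sl \<psi>] by (simp add: Lin_dom[OF sl])
  qed
  define R where "R = ((lid T \<otimes>\<^sub>l P) \<otimes>\<^sub>l lid S) \<circ>\<^sub>l (assoc T H S \<otimes>\<^sub>l lid S) \<circ>\<^sub>l assoc_inv (T \<otimes>\<^sub>h H) S S"
  have R: "R \<in> Lin ((T \<otimes>\<^sub>h H) \<otimes>\<^sub>h (S \<otimes>\<^sub>h S)) ((T \<otimes>\<^sub>h (T \<otimes>\<^sub>h K)) \<otimes>\<^sub>h S)"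
    unfolding R_def by (rule qs_intros P H K)+
  note lP = ltensor_in[OF lT P T HS T TK]
  note lPl = ltensor_in[OF lP lS T_HS S T_TK S]
  note as = assoc_in[OF T H S]
  note asl = ltensor_in[OF as lS THS S T_HS S]
  note ai = assoc_inv_in[OF TH S S]
  let ?j = "insert_left (T \<otimes>\<^sub>h H) (S \<otimes>\<^sub>h S) (etensor T H t h)"
  let ?M = "slice K (B.pair_left t) \<circ>\<^sub>l (P \<circ>\<^sub>l insert_left H S h)"
  have M: "?M \<in> Lin S K" by (rule qs_intros sl P h H K)+
  have th: "etensor T H t h \<in> carrier (T \<otimes>\<^sub>h H)" using t h by simp
  \<comment> \<open>An equation of maps, checked on elementary tensors, because the copairing to
    which it is applied need not be elementary.\<close>
  have "Q \<circ>\<^sub>l (R \<circ>\<^sub>l ?j) = ?M \<otimes>\<^sub>l lid S"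
  proof (rule tensor_ext[OF S S KS])
    show "Q \<circ>\<^sub>l (R \<circ>\<^sub>l ?j) \<in> Lin (S \<otimes>\<^sub>h S) (K \<otimes>\<^sub>h S)" "?M \<otimes>\<^sub>l lid S \<in> Lin (S \<otimes>\<^sub>h S) (K \<otimes>\<^sub>h S)"
      by (rule qs_intros M Q R th H K)+
    fix x y assume x: "x \<in> carrier S" and y: "y \<in> carrier S"
    have Phx: "fn P (etensor H S h x) \<in> carrier (T \<otimes>\<^sub>h K)" using h x by (intro Lin_in[OF P]) auto
    have "fn (R \<circ>\<^sub>l ?j) (etensor S S x y) =
        etensor (T \<otimes>\<^sub>h (T \<otimes>\<^sub>h K)) S (etensor T (T \<otimes>\<^sub>h K) t (fn P (etensor H S h x))) y"
      unfolding R_def using x y t h Phx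
      by (simp add: Lin_dom[OF ai] Lin_dom[OF asl] assoc_inv_fn[OF TH S S]
        ltensor_fn[OF as lS THS S T_HS S] assoc_fn[OF T H S] ltensor_fn[OF lP lS T_HS S T_TK S]
        ltensor_fn[OF lT P T HS T TK])
    then show "fn (Q \<circ>\<^sub>l (R \<circ>\<^sub>l ?j)) (etensor S S x y) = fn (?M \<otimes>\<^sub>l lid S) (etensor S S x y)"
      using x y h by (simp add: Q_fn[OF y Phx] ltensor_fn[OF M lS S S K S] Lin_dom[OF P])
  qed
  then have "fn (Q \<circ>\<^sub>l (R \<circ>\<^sub>l ?j)) (fn ?\<eta> 1) = fn (?M \<otimes>\<^sub>l lid S) (fn ?\<eta> 1)" by simp
  then have 1: "fn Q (fn R (etensor (T \<otimes>\<^sub>h H) (S \<otimes>\<^sub>h S) (etensor T H t h) (fn ?\<eta> 1))) =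
      fn (?M \<otimes>\<^sub>l lid S) (fn ?\<eta> 1)"
    using c by simp
  note l\<eta> = ltensor_in[OF lTH \<eta> TH C TH SS]
  note ri = runit_inv_in[OF TH]
  note as2 = assoc_in[OF TT K S] and ai2 = assoc_inv_in[OF T T K]
  note ai2l = ltensor_in[OF ai2 lS T_TK S TTK S] and \<kappa>l = ltensor_in[OF \<kappa> lKS TT KS C KS]
  have "fn (bend H K P) (etensor T H t h) =
      fn Q (fn R (etensor (T \<otimes>\<^sub>h H) (S \<otimes>\<^sub>h S) (etensor T H t h) (fn ?\<eta> 1)))"
    unfolding bend_def Q_def R_def using th c
    by (simp add: Lin_dom[OF l\<eta>] ltensor_fn[OF lTH \<eta> TH C TH SS] Lin_dom[OF ai] Lin_dom[OF asl]
      Lin_dom[OF lPl] Lin_dom[OF ai2l] Lin_dom[OF as2] Lin_dom[OF \<kappa>l]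
      Lin_in[OF ai] Lin_in[OF asl] Lin_in[OF lPl] Lin_in[OF ai2l] Lin_in[OF as2] Lin_in[OF \<kappa>l]
      Lin_in[OF \<eta>])
  with 1 show ?thesis by simp
qed

text \<open>In the formula for \<open>bend\<close> the vector \<open>h\<close> occurs only as input
  of P, so feeding in its image under \<open>f\<close> has the same effect on both sides. The spaces
  before and after P may differ so that both members of an intertwiner equation can be bent.\<close>

lemma bend_pre:
  assumes P: "P \<in> Lin (H \<otimes>\<^sub>h S) (T \<otimes>\<^sub>h K)" and f: "f \<in> Lin H' H"
    and H: "fd_hilbert_space H" and K: "fd_hilbert_space K" and H': "fd_hilbert_space H'"
  shows "bend H' K (P \<circ>\<^sub>l (f \<otimes>\<^sub>l lid S)) = bend H K P \<circ>\<^sub>l (lid T \<otimes>\<^sub>l f)"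
proof (rule tensor_ext[OF B.fd_sp H' fd_tensor[OF K A.fd_sp]])
  note S = A.fd_sp and T = B.fd_sp
  note fS = ltensor_in[OF f lid_in[OF S] H' S H S] and Tf = ltensor_in[OF lid_in[OF T] f T H' T H]
  have Pf: "P \<circ>\<^sub>l (f \<otimes>\<^sub>l lid S) \<in> Lin (H' \<otimes>\<^sub>h S) (T \<otimes>\<^sub>h K)" by (rule qs_intros P f H H')+
  show "bend H' K (P \<circ>\<^sub>l (f \<otimes>\<^sub>l lid S)) \<in> Lin (T \<otimes>\<^sub>h H') (K \<otimes>\<^sub>h S)"
    by (rule bend_in[OF Pf H' K])
  show "bend H K P \<circ>\<^sub>l (lid T \<otimes>\<^sub>l f) \<in> Lin (T \<otimes>\<^sub>h H') (K \<otimes>\<^sub>h S)"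
    by (rule qs_intros bend_in P f H K H')+
  fix t h assume t: "t \<in> carrier T" and h: "h \<in> carrier H'"
  have "(P \<circ>\<^sub>l (f \<otimes>\<^sub>l lid S)) \<circ>\<^sub>l insert_left H' S h = P \<circ>\<^sub>l insert_left H S (fn f h)"
  proof (rule Lin_eqI)
    show "(P \<circ>\<^sub>l (f \<otimes>\<^sub>l lid S)) \<circ>\<^sub>l insert_left H' S h \<in> Lin S (T \<otimes>\<^sub>h K)"
      "P \<circ>\<^sub>l insert_left H S (fn f h) \<in> Lin S (T \<otimes>\<^sub>h K)"
      by (rule qs_intros Pf P Lin_in[OF f] h H H')+
    fix s assume s: "s \<in> carrier S"
    then show "fn ((P \<circ>\<^sub>l (f \<otimes>\<^sub>l lid S)) \<circ>\<^sub>l insert_left H' S h) s =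
        fn (P \<circ>\<^sub>l insert_left H S (fn f h)) s"
      using h by (simp add: Lin_dom[OF fS] ltensor_fn[OF f lid_in[OF S] H' S H S])
  qed
  then show "fn (bend H' K (P \<circ>\<^sub>l (f \<otimes>\<^sub>l lid S))) (etensor T H' t h) =
      fn (bend H K P \<circ>\<^sub>l (lid T \<otimes>\<^sub>l f)) (etensor T H' t h)"
    using t h by (simp add: bend_fn[OF Pf H' K] bend_fn[OF P H K] Lin_dom[OF Tf] Lin_in[OF f]
      ltensor_fn[OF lid_in[OF T] f T H' T H])
qed

text \<open>A map on the K-leg commutes with contraction of the B-leg, and it leaves the second leg
  of the copairing untouched.\<close>

lemma bend_post:
  assumes P: "P \<in> Lin (H \<otimes>\<^sub>h S) (T \<otimes>\<^sub>h K)" and g: "g \<in> Lin K K'"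
    and H: "fd_hilbert_space H" and K: "fd_hilbert_space K" and K': "fd_hilbert_space K'"
  shows "bend H K' ((lid T \<otimes>\<^sub>l g) \<circ>\<^sub>l P) = (g \<otimes>\<^sub>l lid S) \<circ>\<^sub>l bend H K P"
proof (rule tensor_ext[OF B.fd_sp H fd_tensor[OF K' A.fd_sp]])
  note S = A.fd_sp and T = B.fd_sp
  note HS = fd_tensor[OF H S] and TK = fd_tensor[OF T K]
  note gS = ltensor_in[OF g lid_in[OF S] K S K' S] and Tg = ltensor_in[OF lid_in[OF T] g T K T K']
  have gP: "(lid T \<otimes>\<^sub>l g) \<circ>\<^sub>l P \<in> Lin (H \<otimes>\<^sub>h S) (T \<otimes>\<^sub>h K')" by (rule qs_intros P g H K K')+
  show "bend H K' ((lid T \<otimes>\<^sub>l g) \<circ>\<^sub>l P) \<in> Lin (T \<otimes>\<^sub>h H) (K' \<otimes>\<^sub>h S)"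
    by (rule bend_in[OF gP H K'])
  show "(g \<otimes>\<^sub>l lid S) \<circ>\<^sub>l bend H K P \<in> Lin (T \<otimes>\<^sub>h H) (K' \<otimes>\<^sub>h S)"
    by (rule qs_intros bend_in P g H K K')+
  fix t h assume t: "t \<in> carrier T" and h: "h \<in> carrier H"
  let ?\<eta> = "fn (comul A \<circ>\<^sub>l unt A) 1"
  have c: "?\<eta> \<in> carrier (S \<otimes>\<^sub>h S)" by (rule Lin_in[OF A.copairing_in]) simp
  note pl = B.pair_left_in[OF t]
  note il = insert_left_in[OF h H S]
  let ?M = "slice K (B.pair_left t) \<circ>\<^sub>l (P \<circ>\<^sub>l insert_left H S h)"
  note Pi = lcomp_in[OF S il P]
  note M = lcomp_in[OF S Pi slice_in[OF pl K]]
  have "slice K' (B.pair_left t) \<circ>\<^sub>l (((lid T \<otimes>\<^sub>l g) \<circ>\<^sub>l P) \<circ>\<^sub>l insert_left H S h) = g \<circ>\<^sub>l ?M"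
    using slice_natural[OF pl g K K']
      lcomp_assoc[OF S HS il P Tg] lcomp_assoc[OF S TK Pi Tg slice_in[OF pl K']]
      lcomp_assoc[OF S TK Pi slice_in[OF pl K] g] by simp
  moreover have "(g \<circ>\<^sub>l ?M) \<otimes>\<^sub>l lid S = (g \<otimes>\<^sub>l lid S) \<circ>\<^sub>l (?M \<otimes>\<^sub>l lid S)"
    using ltensor_lcomp[OF M lid_in[OF S] g lid_in[OF S] S S K S K' S]
      lcomp_lid_left[OF S S lid_in[OF S]] by simp
  ultimately show "fn (bend H K' ((lid T \<otimes>\<^sub>l g) \<circ>\<^sub>l P)) (etensor T H t h) =
      fn ((g \<otimes>\<^sub>l lid S) \<circ>\<^sub>l bend H K P) (etensor T H t h)"
    using t h c by (simp add: bend_fn[OF gP H K'] bend_fn[OF P H K] Lin_dom[OF bend_in[OF P H K]]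
      Lin_dom[OF ltensor_in[OF M lid_in[OF S] S S K S]])
qed

text \<open>Nondegeneracy of the pairing: by \<open>ex_pair_left\<close> every functional on T is
  some \<open>pair_left t\<close>, in particular \<open>inner T b\<close>, and pairing the slice
  along the latter with \<open>k\<close> gives the value of the form at
  \<open>(b, k)\<close>.\<close>

lemma tensor_eq_if_slices:
  assumes K: "fd_hilbert_space K" and \<phi>: "\<phi> \<in> carrier (T \<otimes>\<^sub>h K)" and \<psi>: "\<psi> \<in> carrier (T \<otimes>\<^sub>h K)"
    and eq: "\<And>t. t \<in> carrier T \<Longrightarrow> fn (slice K (B.pair_left t)) \<phi> = fn (slice K (B.pair_left t)) \<psi>"
  shows "\<phi> = \<psi>"
proof (rule tensor_eqI[OF \<phi> \<psi>])
  interpret T: fd_hilbert_space T by (rule B.fd_sp)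
  interpret K: fd_hilbert_space K by (rule K)
  fix b k assume b: "b \<in> carrier T" and k: "k \<in> carrier K"
  define l where "l = mk_lin T complex_hilb (inner T b)"
  have l: "l \<in> Lin T complex_hilb"
    unfolding l_def using b
    by (intro mk_lin_in B.fd_sp) (auto simp: T.inner_add_right T.inner_smult_right)
  have l_fn: "fn l x = inner T b x" if "x \<in> carrier T" for x
    using that by (simp add: l_def)
  have sl: "inner K k (fn (slice K l) \<phi>) = \<phi> (b, k)" if "\<phi> \<in> carrier (T \<otimes>\<^sub>h K)" for \<phi>
    using that
  proof (induction rule: tensor_induct)
    case zero
    show ?case
      using Lin_zero[OF fd_tensor[OF B.fd_sp K] K slice_in[OF l K]] k by simp
  next
    case (add \<phi> \<psi>)
    then show ?case
      using Lin_add[OF slice_in[OF l K]] Lin_in[OF slice_in[OF l K]] k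
      by (simp add: K.inner_add_right)
  next
    case (etensor x y)
    then show ?case
      using b k by (simp add: slice_fn[OF l K] K.inner_smult_right l_fn)
  qed
  obtain t where "t \<in> carrier T" "B.pair_left t = l" using B.ex_pair_left[OF l] by blast
  then show "\<phi> (b, k) = \<psi> (b, k)" using eq[of t] sl[OF \<phi>] sl[OF \<psi>] by simp
qed

lemma bend_inject:
  assumes P: "P \<in> Lin (H \<otimes>\<^sub>h S) (T \<otimes>\<^sub>h K)" and Q: "Q \<in> Lin (H \<otimes>\<^sub>h S) (T \<otimes>\<^sub>h K)"
    and H: "fd_hilbert_space H" and K: "fd_hilbert_space K"
    and eq: "bend H K P = bend H K Q"
  shows "P = Q"
proof (rule tensor_ext[OF H A.fd_sp fd_tensor[OF B.fd_sp K] P Q])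
  note S = A.fd_sp
  fix h a assume h: "h \<in> carrier H" and a: "a \<in> carrier S"
  let ?\<eta> = "fn (comul A \<circ>\<^sub>l unt A) 1"
  have c: "?\<eta> \<in> carrier (S \<otimes>\<^sub>h S)" by (rule Lin_in[OF A.copairing_in]) simp
  note pr = A.pair_right_in[OF a]
  note lr = ltensor_in[OF lid_in[OF S] pr S S S fd_complex_hilb]
    and Kr = ltensor_in[OF lid_in[OF K] pr K S K fd_complex_hilb]
  \<comment> \<open>A map \<open>N\<close> is recovered from its action on one leg of the copairing:
    contracting the other leg with \<open>pair_right a\<close> returns \<open>fn N a\<close> by the
    snake identity.\<close>
  have rec: "fn (runit K) (fn (lid K \<otimes>\<^sub>l A.pair_right a) (fn (N \<otimes>\<^sub>l lid S) ?\<eta>)) = fn N a"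
    if N: "N \<in> Lin S K" for N
  proof -
    note NS = ltensor_in[OF N lid_in[OF S] S S K S]
    have "runit K \<circ>\<^sub>l ((lid K \<otimes>\<^sub>l A.pair_right a) \<circ>\<^sub>l (N \<otimes>\<^sub>l lid S)) =
        N \<circ>\<^sub>l (runit S \<circ>\<^sub>l (lid S \<otimes>\<^sub>l A.pair_right a))"
    proof (rule tensor_ext[OF S S K])
      show "runit K \<circ>\<^sub>l ((lid K \<otimes>\<^sub>l A.pair_right a) \<circ>\<^sub>l (N \<otimes>\<^sub>l lid S)) \<in> Lin (S \<otimes>\<^sub>h S) K"
        "N \<circ>\<^sub>l (runit S \<circ>\<^sub>l (lid S \<otimes>\<^sub>l A.pair_right a)) \<in> Lin (S \<otimes>\<^sub>h S) K"
        by (rule qs_intros pr N K)+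
      fix x y assume "x \<in> carrier S" "y \<in> carrier S"
      then show "fn (runit K \<circ>\<^sub>l ((lid K \<otimes>\<^sub>l A.pair_right a) \<circ>\<^sub>l (N \<otimes>\<^sub>l lid S))) (etensor S S x y) =
          fn (N \<circ>\<^sub>l (runit S \<circ>\<^sub>l (lid S \<otimes>\<^sub>l A.pair_right a))) (etensor S S x y)"
        by (simp add: Lin_dom[OF NS] Lin_dom[OF lr] ltensor_fn[OF N lid_in[OF S] S S K S]
          ltensor_fn[OF lid_in[OF S] pr S S S fd_complex_hilb] Lin_in[OF N] Lin_smult[OF N]
          ltensor_fn[OF lid_in[OF K] pr K S K fd_complex_hilb] runit_fn[OF K] runit_fn[OF S])
    qed
    then have "fn (runit K \<circ>\<^sub>l ((lid K \<otimes>\<^sub>l A.pair_right a) \<circ>\<^sub>l (N \<otimes>\<^sub>l lid S))) ?\<eta> =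
        fn (N \<circ>\<^sub>l (runit S \<circ>\<^sub>l (lid S \<otimes>\<^sub>l A.pair_right a))) ?\<eta>" by simp
    then show ?thesis
      using c A.snake[OF a] Lin_in[OF NS c]
      by (simp add: Lin_dom[OF NS] Lin_dom[OF lr] Lin_dom[OF Kr])
  qed
  note il = insert_left_in[OF h H S]
  show "fn P (etensor H S h a) = fn Q (etensor H S h a)"
  proof (rule tensor_eq_if_slices[OF K])
    show "fn P (etensor H S h a) \<in> carrier (T \<otimes>\<^sub>h K)" "fn Q (etensor H S h a) \<in> carrier (T \<otimes>\<^sub>h K)"
      using h a by (auto intro!: Lin_in[OF P] Lin_in[OF Q])
    fix t assume t: "t \<in> carrier T"
    note sl = slice_in[OF B.pair_left_in[OF t] K]
    have PQ: "slice K (B.pair_left t) \<circ>\<^sub>l (P \<circ>\<^sub>l insert_left H S h) \<in> Lin S K"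
      "slice K (B.pair_left t) \<circ>\<^sub>l (Q \<circ>\<^sub>l insert_left H S h) \<in> Lin S K"
      by (rule lcomp_in[OF S] il P Q sl)+
    have "fn (slice K (B.pair_left t) \<circ>\<^sub>l (P \<circ>\<^sub>l insert_left H S h)) a =
        fn (slice K (B.pair_left t) \<circ>\<^sub>l (Q \<circ>\<^sub>l insert_left H S h)) a"
      using bend_fn[OF P H K t h] bend_fn[OF Q H K t h] eq rec[OF PQ(1)] rec[OF PQ(2)] by simp
    then show "fn (slice K (B.pair_left t)) (fn P (etensor H S h a)) =
        fn (slice K (B.pair_left t)) (fn Q (etensor H S h a))"
      using h a by simp
  qed
qed

end

text \<open>Commuting squares are applied to elements, so that chasing a vector through a long
  composite needs no reassociation.\<close>

lemma lcomp_eqD: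
  assumes "g \<circ>\<^sub>l f = g' \<circ>\<^sub>l f'" "f \<in> Lin X Y" "f' \<in> Lin X Y'" "x \<in> carrier X"
  shows "fn g (fn f x) = fn g' (fn f' x)"
  using assms lcomp_fn[of x f g] lcomp_fn[of x f' g'] by (simp add: Lin_dom)

lemma ltensor_interchange:
  assumes f: "f \<in> Lin H H'" and g: "g \<in> Lin K K'"
    and H: "fd_hilbert_space H" and K: "fd_hilbert_space K"
    and H': "fd_hilbert_space H'" and K': "fd_hilbert_space K'"
  shows "(f \<otimes>\<^sub>l lid K') \<circ>\<^sub>l (lid H \<otimes>\<^sub>l g) = (lid H' \<otimes>\<^sub>l g) \<circ>\<^sub>l (f \<otimes>\<^sub>l lid K)"
  using ltensor_lcomp[OF lid_in[OF H] g f lid_in[OF K'] H K H K' H' K']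
    ltensor_lcomp[OF f lid_in[OF K] lid_in[OF H'] g H K H' K H' K']
    lcomp_lid_left[OF K K' g] lcomp_lid_right[OF K g]
    lcomp_lid_left[OF H H' f] lcomp_lid_right[OF H f]
  by simp

section \<open>Equality of maps tested on generating sets\<close>

lemma Lin_eq_generates:
  assumes gen: "generates H E" and F: "F \<in> Lin H V" and G: "G \<in> Lin H V"
    and H: "fd_hilbert_space H" and V: "fd_hilbert_space V"
    and eq: "\<And>x. x \<in> E \<Longrightarrow> fn F x = fn G x"
  shows "F = G"
proof (rule Lin_eqI[OF F G])
  fix x assume "x \<in> carrier H"
  with gen show "fn F x = fn G x"
  proof (induction rule: generates_induct)
    case (gen x)
    then show ?case by (rule eq)
  next
    case zero
    show ?case using Lin_zero[OF H V F] Lin_zero[OF H V G] by simp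
  next
    case (add x y)
    then show ?case using Lin_add[OF F] Lin_add[OF G] by simp
  next
    case (smult c x)
    then show ?case using Lin_smult[OF F] Lin_smult[OF G] by simp
  qed
qed

lemma tensor_ext_generates_left:
  assumes gen: "generates H E"
    and F: "F \<in> Lin (H \<otimes>\<^sub>h K) V" and G: "G \<in> Lin (H \<otimes>\<^sub>h K) V"
    and H: "fd_hilbert_space H" and K: "fd_hilbert_space K" and V: "fd_hilbert_space V"
    and eq: "\<And>x y. \<lbrakk>x \<in> E; y \<in> carrier K\<rbrakk> \<Longrightarrow>
      fn F (etensor H K x y) = fn G (etensor H K x y)"
  shows "F = G"
proof (rule tensor_ext[OF H K V F G])
  fix x y assume x: "x \<in> carrier H" and y: "y \<in> carrier K"
  have "E \<subseteq> carrier H" using gen by (simp add: generates_def)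
  then have "F \<circ>\<^sub>l insert_right H K y = G \<circ>\<^sub>l insert_right H K y"
    using eq y by (intro Lin_eq_generates[OF gen _ _ H V] lcomp_in[OF H insert_right_in[OF y H K]] F G)
      (auto simp: subset_iff)
  from lcomp_eqD[OF this insert_right_in[OF y H K] insert_right_in[OF y H K] x]
  show "fn F (etensor H K x y) = fn G (etensor H K x y)" using x by simp
qed

lemma tensor_ext_generates_right:
  assumes gen: "generates K E"
    and F: "F \<in> Lin (H \<otimes>\<^sub>h K) V" and G: "G \<in> Lin (H \<otimes>\<^sub>h K) V"
    and H: "fd_hilbert_space H" and K: "fd_hilbert_space K" and V: "fd_hilbert_space V"
    and eq: "\<And>x y. \<lbrakk>x \<in> carrier H; y \<in> E\<rbrakk> \<Longrightarrow>
      fn F (etensor H K x y) = fn G (etensor H K x y)"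
  shows "F = G"
proof (rule tensor_ext[OF H K V F G])
  fix x y assume x: "x \<in> carrier H" and y: "y \<in> carrier K"
  have "E \<subseteq> carrier K" using gen by (simp add: generates_def)
  then have "F \<circ>\<^sub>l insert_left H K x = G \<circ>\<^sub>l insert_left H K x"
    using eq x by (intro Lin_eq_generates[OF gen _ _ K V] lcomp_in[OF K insert_left_in[OF x H K]] F G)
      (auto simp: subset_iff)
  from lcomp_eqD[OF this insert_left_in[OF x H K] insert_left_in[OF x H K] y]
  show "fn F (etensor H K x y) = fn G (etensor H K x y)" using y by simp
qed

section \<open>Quantum functions\<close>

context qset_pair
begin

definition comult_lhs :: "'h hilb \<Rightarrow> ('h \<times> 'a \<Rightarrow> complex, 'b \<times> 'h \<Rightarrow> complex) linmap
    \<Rightarrow> ('h \<times> 'a \<Rightarrow> complex, ('b \<times> 'b \<Rightarrow> complex) \<times> 'h \<Rightarrow> complex) linmap" where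
  "comult_lhs H P = (comul B \<otimes>\<^sub>l lid H) \<circ>\<^sub>l P"

definition comult_rhs :: "'h hilb \<Rightarrow> ('h \<times> 'a \<Rightarrow> complex, 'b \<times> 'h \<Rightarrow> complex) linmap
    \<Rightarrow> ('h \<times> 'a \<Rightarrow> complex, ('b \<times> 'b \<Rightarrow> complex) \<times> 'h \<Rightarrow> complex) linmap" where
  "comult_rhs H P = assoc_inv T T H \<circ>\<^sub>l (lid T \<otimes>\<^sub>l P) \<circ>\<^sub>l assoc T H S \<circ>\<^sub>l (P \<otimes>\<^sub>l lid S) \<circ>\<^sub>l
       assoc_inv H S S \<circ>\<^sub>l (lid H \<otimes>\<^sub>l comul A)"

definition counit_rhs :: "'h hilb \<Rightarrow> ('h \<times> 'a \<Rightarrow> complex, 'h) linmap" where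
  "counit_rhs H = runit H \<circ>\<^sub>l (lid H \<otimes>\<^sub>l counit A)"

lemma quantum_function_iff:
  "quantum_function A B H P \<longleftrightarrow> fd_hilbert_space H \<and> P \<in> Lin (H \<otimes>\<^sub>h S) (T \<otimes>\<^sub>h H) \<and>
     comult_lhs H P = comult_rhs H P \<and> slice H (counit B) \<circ>\<^sub>l P = counit_rhs H \<and>
     P\<^sup>\<dagger> = bend H H P"
  unfolding quantum_function_def comult_lhs_def comult_rhs_def slice_def counit_rhs_def bend_def
    Let_def ..

lemma comult_in:
  assumes "P \<in> Lin (H \<otimes>\<^sub>h S) (T \<otimes>\<^sub>h H)" "fd_hilbert_space H"
  shows "comult_lhs H P \<in> Lin (H \<otimes>\<^sub>h S) ((T \<otimes>\<^sub>h T) \<otimes>\<^sub>h H)"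
    and "comult_rhs H P \<in> Lin (H \<otimes>\<^sub>h S) ((T \<otimes>\<^sub>h T) \<otimes>\<^sub>h H)"
  unfolding comult_lhs_def comult_rhs_def by (rule qs_intros assms)+

lemma counit_rhs_in:
  assumes "fd_hilbert_space H"
  shows "counit_rhs H \<in> Lin (H \<otimes>\<^sub>h S) H"
  unfolding counit_rhs_def by (rule qs_intros assms)+

section \<open>Naturality of conditions (i) and (ii) along an intertwining map\<close>

context
  fixes K :: "'k hilb" and H :: "'h hilb" and s Q P
  assumes K: "fd_hilbert_space K" and H: "fd_hilbert_space H"
    and s: "s \<in> Lin K H" and Q: "Q \<in> Lin (K \<otimes>\<^sub>h S) (T \<otimes>\<^sub>h K)" and P: "P \<in> Lin (H \<otimes>\<^sub>h S) (T \<otimes>\<^sub>h H)"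
    and sQP: "P \<circ>\<^sub>l (s \<otimes>\<^sub>l lid S) = (lid T \<otimes>\<^sub>l s) \<circ>\<^sub>l Q"
begin

private lemmas fds = A.fd_sp B.fd_sp A.fd_SS B.fd_SS K H fd_tensor[OF K A.fd_sp]
  fd_tensor[OF H A.fd_sp] fd_tensor[OF B.fd_sp K] fd_tensor[OF B.fd_sp H]

private lemmas lids = lid_in[OF A.fd_sp] lid_in[OF B.fd_sp] lid_in[OF K] lid_in[OF H]

lemma comult_lhs_natural:
  assumes x: "x \<in> carrier (K \<otimes>\<^sub>h S)"
  shows "fn (comult_lhs H P) (fn (s \<otimes>\<^sub>l lid S) x) =
    fn (lid (T \<otimes>\<^sub>h T) \<otimes>\<^sub>l s) (fn (comult_lhs K Q) x)"
proof -
  note sS = ltensor_in[OF s lids(1) K fds(1) H fds(1)]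
  note Ts = ltensor_in[OF lids(2) s fds(2) K fds(2) H]
  note cK = ltensor_in[OF B.comul_in lids(3) fds(2) K fds(4) K]
  note Qx = Lin_in[OF Q x]
  show ?thesis
    unfolding comult_lhs_def
    using x lcomp_eqD[OF sQP sS Q x]
      lcomp_eqD[OF ltensor_interchange[OF B.comul_in s fds(2) K fds(4) H] Ts cK Qx]
    by (simp add: Lin_dom[OF P] Lin_dom[OF Q] Lin_in[OF sS])
qed

lemma comult_rhs_natural:
  assumes x: "x \<in> carrier (K \<otimes>\<^sub>h S)"
  shows "fn (comult_rhs H P) (fn (s \<otimes>\<^sub>l lid S) x) =
    fn (lid (T \<otimes>\<^sub>h T) \<otimes>\<^sub>l s) (fn (comult_rhs K Q) x)"
proof -
  note S = fds(1) and T = fds(2) and SS = fds(3) and TT = fds(4)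
    and KS = fds(7) and HS = fds(8) and TK = fds(9) and TH = fds(10)
  note lS = lids(1) and lT = lids(2) and lK = lids(3) and lH = lids(4)
  note \<Delta> = A.comul_in
  note sS = ltensor_in[OF s lS K S H S] and Ts = ltensor_in[OF lT s T K T H]
  note K\<Delta> = ltensor_in[OF lK \<Delta> K S K SS] and H\<Delta> = ltensor_in[OF lH \<Delta> H S H SS]
  note sSS = ltensor_in[OF s lid_in[OF SS] K SS H SS]
  note aK = assoc_inv_in[OF K S S] and aH = assoc_inv_in[OF H S S]
  note sSl = ltensor_in[OF sS lS KS S HS S]
  note QS = ltensor_in[OF Q lS KS S TK S] and PS = ltensor_in[OF P lS HS S TH S]
  note TsS = ltensor_in[OF Ts lS TK S TH S]
  note bK = assoc_in[OF T K S] and bH = assoc_in[OF T H S]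
  note TsS' = ltensor_in[OF lT sS T KS T HS]
  note TQ = ltensor_in[OF lT Q T KS T TK] and TP = ltensor_in[OF lT P T HS T TH]
  note TTs = ltensor_in[OF lT Ts T TK T TH]
  note cK = assoc_inv_in[OF T T K]
  \<comment> \<open>Successive values of \<open>x\<close> along the composite for Q. Each numbered
    fact below is one square carrying \<open>s\<close> past the corresponding map: squares 3 and 5
    are \<open>sQP\<close> tensored with an identity, the others are interchange or naturality of an
    associator.\<close>
  define x1 where "x1 = fn (lid K \<otimes>\<^sub>l comul A) x"
  define x2 where "x2 = fn (assoc_inv K S S) x1"
  define x3 where "x3 = fn (Q \<otimes>\<^sub>l lid S) x2"
  define x4 where "x4 = fn (assoc T K S) x3"
  define x5 where "x5 = fn (lid T \<otimes>\<^sub>l Q) x4"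
  have x1: "x1 \<in> carrier (K \<otimes>\<^sub>h (S \<otimes>\<^sub>h S))" unfolding x1_def by (rule Lin_in[OF K\<Delta> x])
  have x2: "x2 \<in> carrier ((K \<otimes>\<^sub>h S) \<otimes>\<^sub>h S)" unfolding x2_def by (rule Lin_in[OF aK x1])
  have x3: "x3 \<in> carrier ((T \<otimes>\<^sub>h K) \<otimes>\<^sub>h S)" unfolding x3_def by (rule Lin_in[OF QS x2])
  have x4: "x4 \<in> carrier (T \<otimes>\<^sub>h (K \<otimes>\<^sub>h S))" unfolding x4_def by (rule Lin_in[OF bK x3])
  have x5: "x5 \<in> carrier (T \<otimes>\<^sub>h (T \<otimes>\<^sub>h K))" unfolding x5_def by (rule Lin_in[OF TQ x4])
  have 1: "fn (lid H \<otimes>\<^sub>l comul A) (fn (s \<otimes>\<^sub>l lid S) x) = fn (s \<otimes>\<^sub>l lid (S \<otimes>\<^sub>h S)) x1"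
    unfolding x1_def
    by (rule lcomp_eqD[OF ltensor_interchange[OF s \<Delta> K S H SS, symmetric] sS K\<Delta> x])
  have 2: "fn (assoc_inv H S S) (fn (s \<otimes>\<^sub>l lid (S \<otimes>\<^sub>h S)) x1) = fn ((s \<otimes>\<^sub>l lid S) \<otimes>\<^sub>l lid S) x2"
    unfolding x2_def
    by (rule lcomp_eqD[OF assoc_inv_natural[OF s lS lS K S S H S S, unfolded ltensor_lid[OF S S]]
      sSS aK x1])
  have "(P \<otimes>\<^sub>l lid S) \<circ>\<^sub>l ((s \<otimes>\<^sub>l lid S) \<otimes>\<^sub>l lid S) = ((lid T \<otimes>\<^sub>l s) \<otimes>\<^sub>l lid S) \<circ>\<^sub>l (Q \<otimes>\<^sub>l lid S)"
    by (simp add: ltensor_lcomp[OF sS lS P lS KS S HS S TH S]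
      ltensor_lcomp[OF Q lS Ts lS KS S TK S TH S] sQP)
  then have 3: "fn (P \<otimes>\<^sub>l lid S) (fn ((s \<otimes>\<^sub>l lid S) \<otimes>\<^sub>l lid S) x2) =
      fn ((lid T \<otimes>\<^sub>l s) \<otimes>\<^sub>l lid S) x3"
    unfolding x3_def by (rule lcomp_eqD[OF _ sSl QS x2])
  have 4: "fn (assoc T H S) (fn ((lid T \<otimes>\<^sub>l s) \<otimes>\<^sub>l lid S) x3) = fn (lid T \<otimes>\<^sub>l (s \<otimes>\<^sub>l lid S)) x4"
    unfolding x4_def by (rule lcomp_eqD[OF assoc_natural[OF lT s lS T K S T H S] TsS bK x3])
  have "(lid T \<otimes>\<^sub>l P) \<circ>\<^sub>l (lid T \<otimes>\<^sub>l (s \<otimes>\<^sub>l lid S)) = (lid T \<otimes>\<^sub>l (lid T \<otimes>\<^sub>l s)) \<circ>\<^sub>l (lid T \<otimes>\<^sub>l Q)"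
    by (simp add: ltensor_lcomp[OF lT sS lT P T KS T HS T TH]
      ltensor_lcomp[OF lT Q lT Ts T KS T TK T TH] sQP)
  then have 5: "fn (lid T \<otimes>\<^sub>l P) (fn (lid T \<otimes>\<^sub>l (s \<otimes>\<^sub>l lid S)) x4) =
      fn (lid T \<otimes>\<^sub>l (lid T \<otimes>\<^sub>l s)) x5"
    unfolding x5_def by (rule lcomp_eqD[OF _ TsS' TQ x4])
  have 6: "fn (assoc_inv T T H) (fn (lid T \<otimes>\<^sub>l (lid T \<otimes>\<^sub>l s)) x5) =
      fn (lid (T \<otimes>\<^sub>h T) \<otimes>\<^sub>l s) (fn (assoc_inv T T K) x5)"
    by (rule lcomp_eqD[OF assoc_inv_natural[OF lT lT s T T K T T H, unfolded ltensor_lid[OF T T]]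
      TTs cK x5])
  have K: "fn (comult_rhs K Q) x = fn (assoc_inv T T K) x5"
    unfolding comult_rhs_def using x x1 x2 x3 x4
    by (simp add: Lin_dom[OF K\<Delta>] Lin_dom[OF aK] Lin_dom[OF QS] Lin_dom[OF bK] Lin_dom[OF TQ]
      flip: x1_def x2_def x3_def x4_def x5_def)
  have H: "fn (comult_rhs H P) (fn (s \<otimes>\<^sub>l lid S) x) =
      fn (assoc_inv T T H) (fn (lid T \<otimes>\<^sub>l (lid T \<otimes>\<^sub>l s)) x5)"
    unfolding comult_rhs_def
    using Lin_in[OF sS x] Lin_in[OF sSS x1] Lin_in[OF sSl x2] Lin_in[OF TsS x3] Lin_in[OF TsS' x4]
    by (simp add: Lin_dom[OF H\<Delta>] Lin_dom[OF aH] Lin_dom[OF PS] Lin_dom[OF bH] Lin_dom[OF TP]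
      1 2 3 4 5)
  show ?thesis unfolding H K 6 ..
qed

lemma counit_natural:
  assumes x: "x \<in> carrier (K \<otimes>\<^sub>h S)"
  shows "fn (slice H (counit B) \<circ>\<^sub>l P) (fn (s \<otimes>\<^sub>l lid S) x) =
    fn s (fn (slice K (counit B) \<circ>\<^sub>l Q) x)"
    and "fn (counit_rhs H) (fn (s \<otimes>\<^sub>l lid S) x) = fn s (fn (counit_rhs K) x)"
proof -
  note S = fds(1) and T = fds(2)
  note sS = ltensor_in[OF s lids(1) K S H S] and Ts = ltensor_in[OF lids(2) s T K T H]
  note Qx = Lin_in[OF Q x]
  show "fn (slice H (counit B) \<circ>\<^sub>l P) (fn (s \<otimes>\<^sub>l lid S) x) =
      fn s (fn (slice K (counit B) \<circ>\<^sub>l Q) x)"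
    using x lcomp_eqD[OF sQP sS Q x]
      lcomp_eqD[OF slice_natural[OF B.counit_in s K H] Ts slice_in[OF B.counit_in K] Qx]
    by (simp add: Lin_dom[OF P] Lin_dom[OF Q] Lin_in[OF sS])
  note Kc = ltensor_in[OF lids(3) A.counit_in K S K fd_complex_hilb]
  note Hc = ltensor_in[OF lids(4) A.counit_in H S H fd_complex_hilb]
  have "counit_rhs H \<circ>\<^sub>l (s \<otimes>\<^sub>l lid S) = s \<circ>\<^sub>l counit_rhs K"
  proof (rule tensor_ext[OF K S H])
    show "counit_rhs H \<circ>\<^sub>l (s \<otimes>\<^sub>l lid S) \<in> Lin (K \<otimes>\<^sub>h S) H" "s \<circ>\<^sub>l counit_rhs K \<in> Lin (K \<otimes>\<^sub>h S) H"
      by (rule qs_intros counit_rhs_in s K H)+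
    fix k a assume "k \<in> carrier K" "a \<in> carrier S"
    then show "fn (counit_rhs H \<circ>\<^sub>l (s \<otimes>\<^sub>l lid S)) (etensor K S k a) =
        fn (s \<circ>\<^sub>l counit_rhs K) (etensor K S k a)"
      by (simp add: Lin_dom[OF sS] Lin_dom[OF counit_rhs_in[OF K]])
        (simp add: counit_rhs_def Lin_dom[OF Kc] Lin_dom[OF Hc] ltensor_fn[OF s lids(1) K S H S]
          ltensor_fn[OF lids(3) A.counit_in K S K fd_complex_hilb] runit_fn[OF K] runit_fn[OF H]
          ltensor_fn[OF lids(4) A.counit_in H S H fd_complex_hilb] Lin_in[OF s] Lin_smult[OF s])
  qed
  then show "fn (counit_rhs H) (fn (s \<otimes>\<^sub>l lid S) x) = fn s (fn (counit_rhs K) x)"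
    by (rule lcomp_eqD[OF _ sS counit_rhs_in[OF K] x])
qed

end

text \<open>Adjoints of both members, independently of (iii). It serves for quantum functions and
  also during gluing, where P is not yet known to be one.\<close>

lemma adj_intertwine:
  assumes H: "fd_hilbert_space H" and H': "fd_hilbert_space H'"
    and f: "f \<in> Lin H H'" and P: "P \<in> Lin (H \<otimes>\<^sub>h S) (T \<otimes>\<^sub>h H)" and P': "P' \<in> Lin (H' \<otimes>\<^sub>h S) (T \<otimes>\<^sub>h H')"
    and eq: "(lid T \<otimes>\<^sub>l f) \<circ>\<^sub>l P = P' \<circ>\<^sub>l (f \<otimes>\<^sub>l lid S)"
  shows "P\<^sup>\<dagger> \<circ>\<^sub>l (lid T \<otimes>\<^sub>l f\<^sup>\<dagger>) = (f\<^sup>\<dagger> \<otimes>\<^sub>l lid S) \<circ>\<^sub>l P'\<^sup>\<dagger>"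
proof -
  note S = A.fd_sp and T = B.fd_sp
  note HS = fd_tensor[OF H S] and TH = fd_tensor[OF T H]
  note HS' = fd_tensor[OF H' S] and TH' = fd_tensor[OF T H']
  note lS = lid_in[OF S] and lT = lid_in[OF T]
  note Tf = ltensor_in[OF lT f T H T H'] and fS = ltensor_in[OF f lS H S H' S]
  have "((lid T \<otimes>\<^sub>l f) \<circ>\<^sub>l P)\<^sup>\<dagger> = (P' \<circ>\<^sub>l (f \<otimes>\<^sub>l lid S))\<^sup>\<dagger>" by (simp add: eq)
  then show ?thesis
    by (simp add: adj_lcomp[OF HS TH TH' P Tf] adj_lcomp[OF HS HS' TH' fS P'] adj_lid[OF S] adj_lid[OF T]
      ltensor_adj[OF lT f T H T H'] ltensor_adj[OF f lS H S H' S])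
qed

text \<open>By condition (iii), the adjoint of the intertwiner equation for \<open>f\<close> is the bent version of
  the intertwiner equation for \<open>f\<^sup>\<dagger>\<close>, and bending is injective.\<close>

lemma intertwiner_adj:
  assumes P: "quantum_function A B H P" and P': "quantum_function A B H' P'"
    and f: "f \<in> Lin H H'" and eq: "(lid T \<otimes>\<^sub>l f) \<circ>\<^sub>l P = P' \<circ>\<^sub>l (f \<otimes>\<^sub>l lid S)"
  shows "(lid T \<otimes>\<^sub>l f\<^sup>\<dagger>) \<circ>\<^sub>l P' = P \<circ>\<^sub>l (f\<^sup>\<dagger> \<otimes>\<^sub>l lid S)"
proof (rule bend_inject)
  have H: "fd_hilbert_space H" and H': "fd_hilbert_space H'"
    and P_in: "P \<in> Lin (H \<otimes>\<^sub>h S) (T \<otimes>\<^sub>h H)" and P'_in: "P' \<in> Lin (H' \<otimes>\<^sub>h S) (T \<otimes>\<^sub>h H')"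
    and bP: "P\<^sup>\<dagger> = bend H H P" and bP': "P'\<^sup>\<dagger> = bend H' H' P'"
    using P P' by (simp_all add: quantum_function_iff)
  note af = adj_in[OF H H' f]
  show "(lid T \<otimes>\<^sub>l f\<^sup>\<dagger>) \<circ>\<^sub>l P' \<in> Lin (H' \<otimes>\<^sub>h S) (T \<otimes>\<^sub>h H)" "P \<circ>\<^sub>l (f\<^sup>\<dagger> \<otimes>\<^sub>l lid S) \<in> Lin (H' \<otimes>\<^sub>h S) (T \<otimes>\<^sub>h H)"
    by (rule qs_intros P_in P'_in f H H')+
  show "fd_hilbert_space H'" "fd_hilbert_space H" by (rule H' H)+
  \<comment> \<open>By (iii) for each of the two quantum functions, the left side is
    \<open>(f\<^sup>\<dagger> \<otimes>\<^sub>l lid S) \<circ>\<^sub>l P'\<^sup>\<dagger>\<close>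
    and the right side \<open>P\<^sup>\<dagger> \<circ>\<^sub>l (lid T \<otimes>\<^sub>l
    f\<^sup>\<dagger>)\<close>.\<close>
  show "bend H' H ((lid T \<otimes>\<^sub>l f\<^sup>\<dagger>) \<circ>\<^sub>l P') = bend H' H (P \<circ>\<^sub>l (f\<^sup>\<dagger> \<otimes>\<^sub>l lid S))"
    using adj_intertwine[OF H H' f P_in P'_in eq]
    by (simp add: bend_post[OF P'_in af H' H' H] bend_pre[OF P_in af H H H'] bP bP')
qed

text \<open>The common source of zero objects (the empty family), direct sums (the two injections) and
  splittings of idempotents (the adjoint of the inclusion).\<close>

lemma quantum_function_glue:
  assumes H: "fd_hilbert_space H" and P: "P \<in> Lin (H \<otimes>\<^sub>h S) (T \<otimes>\<^sub>h H)"
    and gen: "generates H (\<Union>(s, Q) \<in> M. fn s ` carrier (dom s))"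
    and M: "\<And>s Q. (s, Q) \<in> M \<Longrightarrow> quantum_function A B (dom s) Q"
      "\<And>s Q. (s, Q) \<in> M \<Longrightarrow> s \<in> Lin (dom s) H"
      "\<And>s Q. (s, Q) \<in> M \<Longrightarrow> (lid T \<otimes>\<^sub>l s) \<circ>\<^sub>l Q = P \<circ>\<^sub>l (s \<otimes>\<^sub>l lid S)"
      "\<And>s Q. (s, Q) \<in> M \<Longrightarrow> (lid T \<otimes>\<^sub>l s\<^sup>\<dagger>) \<circ>\<^sub>l P = Q \<circ>\<^sub>l (s\<^sup>\<dagger> \<otimes>\<^sub>l lid S)"
  shows "quantum_function A B H P"
proof -
  note S = A.fd_sp and T = B.fd_sp
  note TH = fd_tensor[OF T H] and HS = fd_tensor[OF H S]
  note lS = lid_in[OF S] and lT = lid_in[OF T]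
  have q: "fd_hilbert_space (dom s)" "Q \<in> Lin (dom s \<otimes>\<^sub>h S) (T \<otimes>\<^sub>h dom s)"
    "comult_lhs (dom s) Q = comult_rhs (dom s) Q" "slice (dom s) (counit B) \<circ>\<^sub>l Q = counit_rhs (dom s)"
    "Q\<^sup>\<dagger> = bend (dom s) (dom s) Q" if "(s, Q) \<in> M" for s Q
    using M(1)[OF that] by (simp_all add: quantum_function_iff)
  \<comment> \<open>The images of the maps \<open>s\<close> generate H, so a map on
    \<open>H \<otimes>\<^sub>h S\<close> may be tested on the images of the maps
    \<open>s \<otimes>\<^sub>l lid S\<close>; there, naturality replaces P by Q.\<close>
  have ext: "F = G" if F: "F \<in> Lin (H \<otimes>\<^sub>h S) V" and G: "G \<in> Lin (H \<otimes>\<^sub>h S) V" and V: "fd_hilbert_space V"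
    and eq: "\<And>s Q x. \<lbrakk>(s, Q) \<in> M; x \<in> carrier (dom s \<otimes>\<^sub>h S)\<rbrakk> \<Longrightarrow>
      fn F (fn (s \<otimes>\<^sub>l lid S) x) = fn G (fn (s \<otimes>\<^sub>l lid S) x)" for F G and V :: "'z hilb"
  proof (rule tensor_ext_generates_left[OF gen F G H S V])
    fix x y assume "x \<in> (\<Union>(s, Q)\<in>M. fn s ` carrier (dom s))" and y: "y \<in> carrier S"
    then obtain s Q k where sQ: "(s, Q) \<in> M" and k: "k \<in> carrier (dom s)" "x = fn s k" by auto
    have "etensor H S x y = fn (s \<otimes>\<^sub>l lid S) (etensor (dom s) S k y)"
      using k y by (simp add: ltensor_fn[OF M(2)[OF sQ] lS q(1)[OF sQ] S H S])
    then show "fn F (etensor H S x y) = fn G (etensor H S x y)" using eq[OF sQ] k y by simp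
  qed
  have "comult_lhs H P = comult_rhs H P"
  proof (rule ext[OF comult_in[OF P H] fd_tensor[OF B.fd_SS H]])
    fix s Q x assume sQ: "(s, Q) \<in> M" and x: "x \<in> carrier (dom s \<otimes>\<^sub>h S)"
    note c = q(1)[OF sQ] H M(2)[OF sQ] q(2)[OF sQ] P M(3)[OF sQ, symmetric] x
    show "fn (comult_lhs H P) (fn (s \<otimes>\<^sub>l lid S) x) = fn (comult_rhs H P) (fn (s \<otimes>\<^sub>l lid S) x)"
      by (simp add: comult_lhs_natural[OF c] comult_rhs_natural[OF c] q(3)[OF sQ])
  qed
  moreover have "slice H (counit B) \<circ>\<^sub>l P = counit_rhs H"
  proof (rule ext[OF lcomp_in[OF HS P slice_in[OF B.counit_in H]] counit_rhs_in[OF H] H])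
    fix s Q x assume sQ: "(s, Q) \<in> M" and x: "x \<in> carrier (dom s \<otimes>\<^sub>h S)"
    note c = q(1)[OF sQ] H M(2)[OF sQ] q(2)[OF sQ] P M(3)[OF sQ, symmetric] x
    show "fn (slice H (counit B) \<circ>\<^sub>l P) (fn (s \<otimes>\<^sub>l lid S) x) = fn (counit_rhs H) (fn (s \<otimes>\<^sub>l lid S) x)"
      by (simp only: counit_natural[OF c] q(4)[OF sQ])
  qed
  moreover have "P\<^sup>\<dagger> = bend H H P"
  proof (rule tensor_ext_generates_right[OF gen adj_in[OF HS TH P] bend_in[OF P H H] T H HS])
    fix t x assume t: "t \<in> carrier T" and "x \<in> (\<Union>(s, Q)\<in>M. fn s ` carrier (dom s))"
    then obtain s Q k where sQ: "(s, Q) \<in> M" and k: "k \<in> carrier (dom s)" "x = fn s k" by auto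
    note K = q(1)[OF sQ] and s = M(2)[OF sQ] and Q = q(2)[OF sQ]
    note as = adj_in[OF K H s]
    note Ts = ltensor_in[OF lT s T K T H]
    have x: "etensor T H t x = fn (lid T \<otimes>\<^sub>l s) (etensor T (dom s) t k)"
      using t k by (simp add: ltensor_fn[OF lT s T K T H])
    \<comment> \<open>Here the equation for \<open>s\<^sup>\<dagger>\<close> enters: its adjoint
      moves \<open>s\<close> past \<open>P\<^sup>\<dagger>\<close>. The equation for
      \<open>s\<close> does the same for \<open>bend H H P\<close>, and (iii) for Q joins the
      two.\<close>
    have "P\<^sup>\<dagger> \<circ>\<^sub>l (lid T \<otimes>\<^sub>l s) = (s \<otimes>\<^sub>l lid S) \<circ>\<^sub>l Q\<^sup>\<dagger>"
      using adj_intertwine[OF H K as P Q M(4)[OF sQ]] adj_adj[OF K H s] by simp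
    also have "\<dots> = bend H H P \<circ>\<^sub>l (lid T \<otimes>\<^sub>l s)"
      using bend_post[OF Q s K K H] bend_pre[OF P s H H K] M(3)[OF sQ] q(5)[OF sQ] by simp
    finally have "P\<^sup>\<dagger> \<circ>\<^sub>l (lid T \<otimes>\<^sub>l s) = bend H H P \<circ>\<^sub>l (lid T \<otimes>\<^sub>l s)" .
    from lcomp_eqD[OF this Ts Ts, of "etensor T (dom s) t k"]
    show "fn (P\<^sup>\<dagger>) (etensor T H t x) = fn (bend H H P) (etensor T H t x)"
      using t k x by simp
  qed
  ultimately show ?thesis using H P by (simp add: quantum_function_iff)
qed

end

section \<open>The vector space of linear maps\<close>

text \<open>This and the next two operations coincide with the fields of the Hom records, so that
  facts about the category reduce to facts about linear maps.\<close>

definition lzero :: "'a hilb \<Rightarrow> 'b hilb \<Rightarrow> ('a, 'b) linmap" where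
  "lzero H K = mk_lin H K (\<lambda>x. \<zero>\<^bsub>K\<^esub>)"

definition ladd :: "'a hilb \<Rightarrow> 'b hilb \<Rightarrow> ('a, 'b) linmap \<Rightarrow> ('a, 'b) linmap \<Rightarrow> ('a, 'b) linmap" where
  "ladd H K f g = mk_lin H K (\<lambda>x. fn f x \<oplus>\<^bsub>K\<^esub> fn g x)"

definition lscale :: "'a hilb \<Rightarrow> 'b hilb \<Rightarrow> complex \<Rightarrow> ('a, 'b) linmap \<Rightarrow> ('a, 'b) linmap" where
  "lscale H K c f = mk_lin H K (\<lambda>x. c \<odot>\<^bsub>K\<^esub> fn f x)"

lemma lzero_fn [simp]: "x \<in> carrier H \<Longrightarrow> fn (lzero H K) x = \<zero>\<^bsub>K\<^esub>"
  and ladd_fn [simp]: "x \<in> carrier H \<Longrightarrow> fn (ladd H K f g) x = fn f x \<oplus>\<^bsub>K\<^esub> fn g x"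
  and lscale_fn [simp]: "x \<in> carrier H \<Longrightarrow> fn (lscale H K c f) x = c \<odot>\<^bsub>K\<^esub> fn f x"
  by (simp_all add: lzero_def ladd_def lscale_def)

lemma dom_mk_lin [simp]: "dom (mk_lin H K g) = H"
  by (simp add: mk_lin_def)

lemma dom_lzero [simp]: "dom (lzero H K) = H"
  and dom_ladd [simp]: "dom (ladd H K f g) = H"
  and dom_lscale [simp]: "dom (lscale H K c f) = H"
  by (simp_all add: lzero_def ladd_def lscale_def)

context
  fixes H :: "'a hilb" and K :: "'b hilb"
  assumes H: "fd_hilbert_space H" and K: "fd_hilbert_space K"
begin

interpretation H: fd_hilbert_space H by (rule H)
interpretation K: fd_hilbert_space K by (rule K)

lemma lzero_in: "lzero H K \<in> Lin H K"
  unfolding lzero_def by (rule mk_lin_in[OF H]) auto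

lemma ladd_in: "f \<in> Lin H K \<Longrightarrow> g \<in> Lin H K \<Longrightarrow> ladd H K f g \<in> Lin H K"
  unfolding ladd_def
  by (rule mk_lin_in[OF H]) (simp_all add: Lin_in Lin_add Lin_smult K.a_ac K.smult_add_right)

lemma lscale_in: "f \<in> Lin H K \<Longrightarrow> lscale H K c f \<in> Lin H K"
  unfolding lscale_def
  by (rule mk_lin_in[OF H])
    (simp_all add: Lin_in Lin_add Lin_smult K.smult_add_right K.smult_smult[symmetric] mult.commute)

lemma ladd_lzero: "f \<in> Lin H K \<Longrightarrow> ladd H K f (lzero H K) = f"
  by (rule Lin_eqI[of _ H K]) (auto intro: ladd_in lzero_in simp: Lin_in)

lemma lzero_ladd: "f \<in> Lin H K \<Longrightarrow> ladd H K (lzero H K) f = f"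
  by (rule Lin_eqI[of _ H K]) (auto intro: ladd_in lzero_in simp: Lin_in)

lemma adj_ladd:
  assumes f: "f \<in> Lin H K" and g: "g \<in> Lin H K"
  shows "(ladd H K f g)\<^sup>\<dagger> = ladd K H (f\<^sup>\<dagger>) (g\<^sup>\<dagger>)"
proof (rule adj_eqI[OF H K ladd_in[OF f g]])
  note af = adj_in[OF H K f] and ag = adj_in[OF H K g]
  show "ladd K H (f\<^sup>\<dagger>) (g\<^sup>\<dagger>) \<in> Lin K H"
    unfolding ladd_def
    by (rule mk_lin_in[OF K])
      (simp_all add: Lin_in[OF af] Lin_add[OF af] Lin_smult[OF af] Lin_in[OF ag] Lin_add[OF ag]
        Lin_smult[OF ag] H.a_ac H.smult_add_right)
  fix x y assume "x \<in> carrier H" "y \<in> carrier K"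
  then show "inner H (fn (ladd K H (f\<^sup>\<dagger>) (g\<^sup>\<dagger>)) y) x = inner K y (fn (ladd H K f g) x)"
    by (simp add: H.inner_add_left K.inner_add_right Lin_in[OF f] Lin_in[OF g] Lin_in[OF af]
      Lin_in[OF ag] adj_inner[OF H K f] adj_inner[OF H K g])
qed

lemma adj_lscale:
  assumes f: "f \<in> Lin H K"
  shows "(lscale H K c f)\<^sup>\<dagger> = lscale K H (cnj c) (f\<^sup>\<dagger>)"
proof (rule adj_eqI[OF H K lscale_in[OF f]])
  note af = adj_in[OF H K f]
  show "lscale K H (cnj c) (f\<^sup>\<dagger>) \<in> Lin K H"
    unfolding lscale_def
    by (rule mk_lin_in[OF K])
      (simp_all add: Lin_in[OF af] Lin_add[OF af] Lin_smult[OF af] H.smult_add_right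
        H.smult_smult[symmetric] mult.commute)
  fix x y assume "x \<in> carrier H" "y \<in> carrier K"
  then show "inner H (fn (lscale K H (cnj c) (f\<^sup>\<dagger>)) y) x = inner K y (fn (lscale H K c f) x)"
    by (simp add: H.inner_smult_left K.inner_smult_right Lin_in[OF f] Lin_in[OF af]
      adj_inner[OF H K f])
qed

text \<open>The positivity axiom: moving \<open>f\<close> across the inner product shows that the
  squared norm of every value of \<open>f\<close> is zero.\<close>

lemma adj_lcomp_eq_lzero:
  assumes f: "f \<in> Lin H K" and eq: "f\<^sup>\<dagger> \<circ>\<^sub>l f = lzero H H"
  shows "f = lzero H K"
proof (rule Lin_eqI[OF f lzero_in])
  fix x assume x: "x \<in> carrier H"
  have "inner K (fn f x) (fn f x) = inner H x (fn (f\<^sup>\<dagger> \<circ>\<^sub>l f) x)"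
    using x by (simp add: Lin_dom[OF f] adj_inner_right[OF H K f] Lin_in[OF f])
  also have "\<dots> = 0" unfolding eq using x by simp
  finally show "fn f x = fn (lzero H K) x"
    using x K.inner_self_eq_0[OF Lin_in[OF f x]] by simp
qed

text \<open>Frame expansion in both arguments leaves finitely many matrix entries; these are the
  functionals that bound the dimension of a Hom space.\<close>

lemma eq_lzero_if_entries:
  assumes f: "f \<in> Lin H K"
    and eq: "\<And>e e'. e \<in> H.frame \<Longrightarrow> e' \<in> K.frame \<Longrightarrow> inner K e' (fn f e) = 0"
  shows "f = lzero H K"
proof (rule Lin_eqI[OF f lzero_in])
  fix x assume x: "x \<in> carrier H"
  have "fn f x = \<zero>\<^bsub>K\<^esub>"
  proof (rule K.inner_ext)
    fix z assume z: "z \<in> carrier K"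
    have 1: "inner K z (fn f e) = 0" if "e \<in> H.frame" for e
      unfolding K.linear_functional_frame[OF K.linear_functional_inner[OF z] Lin_in[OF f H.frame_in[OF that]]]
      using eq that by (intro sum.neutral) auto
    have "linear_functional H (\<lambda>x. inner K z (fn f x))"
      using z by (intro linear_functionalI)
        (simp_all add: Lin_add[OF f] Lin_smult[OF f] Lin_in[OF f] K.inner_add_right K.inner_smult_right)
    from H.linear_functional_frame[OF this x] 1
    show "inner K z (fn f x) = inner K z \<zero>\<^bsub>K\<^esub>" using z by simp
  qed (use x in \<open>auto intro: Lin_in[OF f]\<close>)
  then show "fn f x = fn (lzero H K) x" using x by simp
qed

end

section \<open>Bilinearity of composition\<close>

context
  fixes H :: "'a hilb" and K :: "'b hilb" and L :: "'c hilb"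
  assumes H: "fd_hilbert_space H" and K: "fd_hilbert_space K" and L: "fd_hilbert_space L"
begin

interpretation K: fd_hilbert_space K by (rule K)
interpretation L: fd_hilbert_space L by (rule L)

lemma lcomp_lzero_right: "g \<in> Lin K L \<Longrightarrow> g \<circ>\<^sub>l lzero H K = lzero H L"
  by (rule Lin_eqI[of _ H L])
    (auto intro: lzero_in H K L lcomp_in simp: Lin_zero[OF K L])

lemma lcomp_lzero_left: "f \<in> Lin H K \<Longrightarrow> lzero K L \<circ>\<^sub>l f = lzero H L"
  by (rule Lin_eqI[of _ H L])
    (auto intro: lzero_in H K L lcomp_in simp: Lin_dom Lin_in)

lemma lcomp_ladd_right:
  assumes "f \<in> Lin H K" "f' \<in> Lin H K" "g \<in> Lin K L"
  shows "g \<circ>\<^sub>l ladd H K f f' = ladd H L (g \<circ>\<^sub>l f) (g \<circ>\<^sub>l f')"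
  using assms
  by (intro Lin_eqI[of _ H L])
    (auto intro!: ladd_in H K L lcomp_in[OF H] simp: Lin_dom Lin_in Lin_add)

lemma lcomp_ladd_left:
  assumes "f \<in> Lin H K" "g \<in> Lin K L" "g' \<in> Lin K L"
  shows "ladd K L g g' \<circ>\<^sub>l f = ladd H L (g \<circ>\<^sub>l f) (g' \<circ>\<^sub>l f)"
  using assms
  by (intro Lin_eqI[of _ H L])
    (auto intro!: ladd_in H K L lcomp_in[OF H] simp: Lin_dom Lin_in)

lemma lcomp_lscale_right:
  assumes "f \<in> Lin H K" "g \<in> Lin K L"
  shows "g \<circ>\<^sub>l lscale H K c f = lscale H L c (g \<circ>\<^sub>l f)"
  using assms
  by (intro Lin_eqI[of _ H L])
    (auto intro!: lscale_in H K L lcomp_in[OF H] simp: Lin_dom Lin_in Lin_smult)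

lemma lcomp_lscale_left:
  assumes "f \<in> Lin H K" "g \<in> Lin K L"
  shows "lscale K L c g \<circ>\<^sub>l f = lscale H L c (g \<circ>\<^sub>l f)"
  using assms
  by (intro Lin_eqI[of _ H L])
    (auto intro!: lscale_in H K L lcomp_in[OF H] simp: Lin_dom Lin_in)

end

section \<open>Bilinearity of the tensor product of maps\<close>

context
  fixes H :: "'a hilb" and K :: "'b hilb" and H' :: "'c hilb" and K' :: "'d hilb"
  assumes H: "fd_hilbert_space H" and K: "fd_hilbert_space K"
    and H': "fd_hilbert_space H'" and K': "fd_hilbert_space K'"
begin

private lemmas HK = fd_tensor[OF H K]
private lemmas HK' = fd_tensor[OF H' K']

lemma ltensor_lzero_right:
  assumes f: "f \<in> Lin H H'"
  shows "f \<otimes>\<^sub>l lzero K K' = lzero (H \<otimes>\<^sub>h K) (H' \<otimes>\<^sub>h K')"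
  by (rule tensor_ext[OF H K HK' ltensor_in[OF f lzero_in[OF K K'] H K H' K'] lzero_in[OF HK HK']])
    (simp add: ltensor_fn[OF f lzero_in[OF K K'] H K H' K'] etensor_zero_right[OF H' K'] Lin_in[OF f])

lemma ltensor_lzero_left:
  assumes g: "g \<in> Lin K K'"
  shows "lzero H H' \<otimes>\<^sub>l g = lzero (H \<otimes>\<^sub>h K) (H' \<otimes>\<^sub>h K')"
  by (rule tensor_ext[OF H K HK' ltensor_in[OF lzero_in[OF H H'] g H K H' K'] lzero_in[OF HK HK']])
    (simp add: ltensor_fn[OF lzero_in[OF H H'] g H K H' K'] etensor_zero_left[OF H' K'] Lin_in[OF g])

lemma ltensor_ladd_right:
  assumes f: "f \<in> Lin H H'" and g: "g \<in> Lin K K'" and g': "g' \<in> Lin K K'"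
  shows "f \<otimes>\<^sub>l ladd K K' g g' = ladd (H \<otimes>\<^sub>h K) (H' \<otimes>\<^sub>h K') (f \<otimes>\<^sub>l g) (f \<otimes>\<^sub>l g')"
  by (rule tensor_ext[OF H K HK' ltensor_in[OF f ladd_in[OF K K' g g'] H K H' K']
      ladd_in[OF HK HK' ltensor_in[OF f g H K H' K'] ltensor_in[OF f g' H K H' K']]])
    (simp add: ltensor_fn[OF f ladd_in[OF K K' g g'] H K H' K'] ltensor_fn[OF f g H K H' K']
      ltensor_fn[OF f g' H K H' K'] etensor_add_right[OF H' K'] Lin_in[OF f] Lin_in[OF g] Lin_in[OF g'])

lemma ltensor_ladd_left:
  assumes f: "f \<in> Lin H H'" and f': "f' \<in> Lin H H'" and g: "g \<in> Lin K K'"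
  shows "ladd H H' f f' \<otimes>\<^sub>l g = ladd (H \<otimes>\<^sub>h K) (H' \<otimes>\<^sub>h K') (f \<otimes>\<^sub>l g) (f' \<otimes>\<^sub>l g)"
  by (rule tensor_ext[OF H K HK' ltensor_in[OF ladd_in[OF H H' f f'] g H K H' K']
      ladd_in[OF HK HK' ltensor_in[OF f g H K H' K'] ltensor_in[OF f' g H K H' K']]])
    (simp add: ltensor_fn[OF ladd_in[OF H H' f f'] g H K H' K'] ltensor_fn[OF f g H K H' K']
      ltensor_fn[OF f' g H K H' K'] etensor_add_left[OF H' K'] Lin_in[OF f] Lin_in[OF g] Lin_in[OF f'])

lemma ltensor_lscale_right:
  assumes f: "f \<in> Lin H H'" and g: "g \<in> Lin K K'"
  shows "f \<otimes>\<^sub>l lscale K K' c g = lscale (H \<otimes>\<^sub>h K) (H' \<otimes>\<^sub>h K') c (f \<otimes>\<^sub>l g)"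
  by (rule tensor_ext[OF H K HK' ltensor_in[OF f lscale_in[OF K K' g] H K H' K']
      lscale_in[OF HK HK' ltensor_in[OF f g H K H' K']]])
    (simp add: ltensor_fn[OF f lscale_in[OF K K' g] H K H' K'] ltensor_fn[OF f g H K H' K']
      etensor_smult_right[OF H' K'] Lin_in[OF f] Lin_in[OF g])

lemma ltensor_lscale_left:
  assumes f: "f \<in> Lin H H'" and g: "g \<in> Lin K K'"
  shows "lscale H H' c f \<otimes>\<^sub>l g = lscale (H \<otimes>\<^sub>h K) (H' \<otimes>\<^sub>h K') c (f \<otimes>\<^sub>l g)"
  by (rule tensor_ext[OF H K HK' ltensor_in[OF lscale_in[OF H H' f] g H K H' K']
      lscale_in[OF HK HK' ltensor_in[OF f g H K H' K']]])
    (simp add: ltensor_fn[OF lscale_in[OF H H' f] g H K H' K'] ltensor_fn[OF f g H K H' K']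
      etensor_smult_left[OF H' K'] Lin_in[OF f] Lin_in[OF g])

end

section \<open>Constructions of Hilbert spaces\<close>

text \<open>Every type contains \<open>undefined\<close>, so this one-point space exists in any
  universe \<open>'h\<close>.\<close>

definition zero_hilb :: "'h hilb" where
  "zero_hilb = \<lparr>carrier = {undefined}, mult = undefined, one = undefined, zero = undefined,
     add = (\<lambda>x y. undefined), smult = (\<lambda>c x. undefined), inner = (\<lambda>x y. 0)\<rparr>"

lemma generates_zero_hilb: "generates zero_hilb {}"
  by (rule generatesI) (simp_all add: zero_hilb_def)

lemma fd_zero_hilb: "fd_hilbert_space zero_hilb"
proof (rule fd_hilbert_spaceI[OF _ _ generates_zero_hilb])
  show "vectorspace class_ring zero_hilb"
    by (rule vectorspaceI) (simp_all add: zero_hilb_def)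
qed (simp_all add: zero_hilb_def)

text \<open>A nonzero space has at least as many vectors as there are scalars, so it is infinite;
  the direct sum then fits into the same type.\<close>

lemma ex_inj_on_pairs:
  fixes H K :: "'h hilb"
  assumes H: "fd_hilbert_space H" and K: "fd_hilbert_space K"
  shows "\<exists>\<phi> :: 'h \<times> 'h \<Rightarrow> 'h. inj_on \<phi> (carrier H \<times> carrier K)"
proof -
  have inf: "carrier H \<subseteq> {\<zero>\<^bsub>H\<^esub>}" if H: "fd_hilbert_space H" and fin: "finite (carrier H)"
    for H :: "'h hilb"
  proof
    interpret H: fd_hilbert_space H by (rule H)
    fix x assume x: "x \<in> carrier H"
    have "x = \<zero>\<^bsub>H\<^esub>"
    proof (rule ccontr)
      assume "x \<noteq> \<zero>\<^bsub>H\<^esub>"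
      then have xx: "inner H x x \<noteq> 0" using H.inner_self_eq_0[OF x] by auto
      \<comment> \<open>A nonzero \<open>x\<close> embeds the complex numbers into the carrier: a
        scalar is recovered by pairing \<open>x\<close> with the corresponding multiple of
        \<open>x\<close>.\<close>
      have "inj (\<lambda>c. c \<odot>\<^bsub>H\<^esub> x)"
      proof (rule injI)
        fix a b assume "a \<odot>\<^bsub>H\<^esub> x = b \<odot>\<^bsub>H\<^esub> x"
        then have "a * inner H x x = b * inner H x x"
          using H.inner_smult_right[OF x x, of a] H.inner_smult_right[OF x x, of b] by metis
        then show "a = b" using xx by simp
      qed
      moreover have "range (\<lambda>c. c \<odot>\<^bsub>H\<^esub> x) \<subseteq> carrier H" using x by auto
      ultimately have "finite (UNIV :: complex set)"
        using finite_imageD[OF finite_subset[OF _ fin]] by blast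
      then show False using infinite_UNIV_char_0 by blast
    qed
    then show "x \<in> {\<zero>\<^bsub>H\<^esub>}" by simp
  qed
  let ?U = "carrier H \<union> carrier K"
  show ?thesis
  proof (cases "finite ?U")
    case True
    then have "carrier H \<subseteq> {\<zero>\<^bsub>H\<^esub>}" "carrier K \<subseteq> {\<zero>\<^bsub>K\<^esub>}" using inf H K by auto
    \<comment> \<open>The product has at most one element here, so even a constant map is injective
      on it.\<close>
    then have "inj_on (\<lambda>_. undefined) (carrier H \<times> carrier K)" by (auto simp: inj_on_def)
    then show ?thesis by blast
  next
    case False
    \<comment> \<open>An infinite set is equinumerous with its square.\<close>
    then obtain \<phi> where "bij_betw \<phi> (?U \<times> ?U) ?U"
      using card_of_Times_same_infinite card_of_ordIso by blast
    then have "inj_on \<phi> (carrier H \<times> carrier K)"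
      unfolding bij_betw_def by (blast intro: inj_on_subset)
    then show ?thesis by blast
  qed
qed

text \<open>The vanishing cross terms are recorded because the structure map on the sum will be
  block diagonal, and its compatibility with the injections rests on them.\<close>

lemma ex_direct_sum:
  fixes H K :: "'h hilb"
  assumes H: "fd_hilbert_space H" and K: "fd_hilbert_space K"
  shows "\<exists>(D :: 'h hilb) s t. fd_hilbert_space D \<and> s \<in> Lin H D \<and> t \<in> Lin K D \<and>
    s\<^sup>\<dagger> \<circ>\<^sub>l s = lid H \<and> t\<^sup>\<dagger> \<circ>\<^sub>l t = lid K \<and> s\<^sup>\<dagger> \<circ>\<^sub>l t = lzero K H \<and> t\<^sup>\<dagger> \<circ>\<^sub>l s = lzero H K \<and>
    ladd D D (s \<circ>\<^sub>l s\<^sup>\<dagger>) (t \<circ>\<^sub>l t\<^sup>\<dagger>) = lid D"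
proof -
  interpret H: fd_hilbert_space H by (rule H)
  interpret K: fd_hilbert_space K by (rule K)
  obtain \<phi> :: "'h \<times> 'h \<Rightarrow> 'h" where inj: "inj_on \<phi> (carrier H \<times> carrier K)"
    using ex_inj_on_pairs[OF H K] by blast
  define \<psi> where "\<psi> = inv_into (carrier H \<times> carrier K) \<phi>"
  have \<psi>: "\<psi> (\<phi> (x, y)) = (x, y)" if "x \<in> carrier H" "y \<in> carrier K" for x y
    unfolding \<psi>_def using inj that by (intro inv_into_f_f) auto
  \<comment> \<open>The Hilbert space of pairs, transported along the injection \<phi> into the type
    \<open>'h\<close>; \<psi> decodes.\<close>
  define D :: "'h hilb" where "D = \<lparr>carrier = \<phi> ` (carrier H \<times> carrier K), mult = undefined,
    one = undefined, zero = \<phi> (\<zero>\<^bsub>H\<^esub>, \<zero>\<^bsub>K\<^esub>),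
    add = (\<lambda>u v. \<phi> (fst (\<psi> u) \<oplus>\<^bsub>H\<^esub> fst (\<psi> v), snd (\<psi> u) \<oplus>\<^bsub>K\<^esub> snd (\<psi> v))),
    smult = (\<lambda>c u. \<phi> (c \<odot>\<^bsub>H\<^esub> fst (\<psi> u), c \<odot>\<^bsub>K\<^esub> snd (\<psi> u))),
    inner = (\<lambda>u v. inner H (fst (\<psi> u)) (fst (\<psi> v)) + inner K (snd (\<psi> u)) (snd (\<psi> v)))\<rparr>"
  have D_in [simp]: "\<phi> (x, y) \<in> carrier D" if "x \<in> carrier H" "y \<in> carrier K" for x y
    using that by (simp add: D_def)
  have D_cases: "\<exists>x \<in> carrier H. \<exists>y \<in> carrier K. u = \<phi> (x, y)" if "u \<in> carrier D" for u
    using that by (auto simp: D_def)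
  have D_ops [simp]: "zero D = \<phi> (\<zero>\<^bsub>H\<^esub>, \<zero>\<^bsub>K\<^esub>)"
    "\<And>x y x' y'. \<lbrakk>x \<in> carrier H; y \<in> carrier K; x' \<in> carrier H; y' \<in> carrier K\<rbrakk> \<Longrightarrow>
      \<phi> (x, y) \<oplus>\<^bsub>D\<^esub> \<phi> (x', y') = \<phi> (x \<oplus>\<^bsub>H\<^esub> x', y \<oplus>\<^bsub>K\<^esub> y')"
    "\<And>c x y. \<lbrakk>x \<in> carrier H; y \<in> carrier K\<rbrakk> \<Longrightarrow>
      c \<odot>\<^bsub>D\<^esub> \<phi> (x, y) = \<phi> (c \<odot>\<^bsub>H\<^esub> x, c \<odot>\<^bsub>K\<^esub> y)"
    "\<And>x y x' y'. \<lbrakk>x \<in> carrier H; y \<in> carrier K; x' \<in> carrier H; y' \<in> carrier K\<rbrakk> \<Longrightarrow>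
      inner D (\<phi> (x, y)) (\<phi> (x', y')) = inner H x x' + inner K y y'"
    by (simp_all add: D_def \<psi>)
  have vs: "vectorspace class_ring D"
    by (rule vectorspaceI)
      (auto dest!: D_cases simp: H.a_ac K.a_ac H.smult_smult K.smult_smult H.smult_add_left
        K.smult_add_left H.smult_add_right K.smult_add_right)
  obtain EH EK where E: "finite EH" "finite EK" "generates H EH" "generates K EK"
    using H.ex_generates K.ex_generates by auto
  have Esub: "EH \<subseteq> carrier H" "EK \<subseteq> carrier K" using E by (auto simp: generates_def)
  let ?E = "(\<lambda>x. \<phi> (x, \<zero>\<^bsub>K\<^esub>)) ` EH \<union> (\<lambda>y. \<phi> (\<zero>\<^bsub>H\<^esub>, y)) ` EK"
  have gen: "generates D ?E"
  proof (rule generatesI)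
    show "?E \<subseteq> carrier D" using Esub by auto
    fix U u
    assume EU: "?E \<subseteq> U" and z: "\<zero>\<^bsub>D\<^esub> \<in> U"
      and a: "\<And>x y. \<lbrakk>x \<in> carrier D; y \<in> carrier D; x \<in> U; y \<in> U\<rbrakk> \<Longrightarrow> x \<oplus>\<^bsub>D\<^esub> y \<in> U"
      and m: "\<And>c x. \<lbrakk>x \<in> carrier D; x \<in> U\<rbrakk> \<Longrightarrow> c \<odot>\<^bsub>D\<^esub> x \<in> U" and u: "u \<in> carrier D"
    have 1: "\<phi> (x, \<zero>\<^bsub>K\<^esub>) \<in> U" if "x \<in> carrier H" for x
      using E(3) that
    proof (induction rule: generates_induct)
      case (add x y)
      then show ?case using a[of "\<phi> (x, \<zero>\<^bsub>K\<^esub>)" "\<phi> (y, \<zero>\<^bsub>K\<^esub>)"] by simp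
    next
      case (smult c x)
      then show ?case using m[of "\<phi> (x, \<zero>\<^bsub>K\<^esub>)" c] K.smult_r_null[of c] by simp
    qed (use EU z in auto)
    have 2: "\<phi> (\<zero>\<^bsub>H\<^esub>, y) \<in> U" if "y \<in> carrier K" for y
      using E(4) that
    proof (induction rule: generates_induct)
      case (add x y)
      then show ?case using a[of "\<phi> (\<zero>\<^bsub>H\<^esub>, x)" "\<phi> (\<zero>\<^bsub>H\<^esub>, y)"] by simp
    next
      case (smult c x)
      then show ?case using m[of "\<phi> (\<zero>\<^bsub>H\<^esub>, x)" c] H.smult_r_null[of c] by simp
    qed (use EU z in auto)
    obtain x y where xy: "x \<in> carrier H" "y \<in> carrier K" "u = \<phi> (x, y)" using D_cases[OF u] by blast
    then show "u \<in> U" using a[of "\<phi> (x, \<zero>\<^bsub>K\<^esub>)" "\<phi> (\<zero>\<^bsub>H\<^esub>, y)"] 1 2 by simp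
  qed
  have D: "fd_hilbert_space D"
  proof (rule fd_hilbert_spaceI[OF vs _ gen])
    show "finite ?E" using E by simp
    show "inner D x (y \<oplus>\<^bsub>D\<^esub> z) = inner D x y + inner D x z"
      if "x \<in> carrier D" "y \<in> carrier D" "z \<in> carrier D" for x y z
      using that by (auto dest!: D_cases simp: H.inner_add_right K.inner_add_right)
    show "inner D x (c \<odot>\<^bsub>D\<^esub> y) = c * inner D x y" if "x \<in> carrier D" "y \<in> carrier D" for c x y
      using that
      by (auto dest!: D_cases simp: H.inner_smult_right K.inner_smult_right algebra_simps)
    show "inner D y x = cnj (inner D x y)" if xy: "x \<in> carrier D" "y \<in> carrier D" for x y
    proof -
      obtain x1 x2 y1 y2 where "x1 \<in> carrier H" "x2 \<in> carrier K" "x = \<phi> (x1, x2)"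
        "y1 \<in> carrier H" "y2 \<in> carrier K" "y = \<phi> (y1, y2)"
        using D_cases[OF xy(1)] D_cases[OF xy(2)] by blast
      then show ?thesis by (simp add: H.inner_commute[of x1] K.inner_commute[of x2])
    qed
    show "Re (inner D u u) > 0" if u: "u \<in> carrier D" "u \<noteq> \<zero>\<^bsub>D\<^esub>" for u
    proof -
      obtain x y where xy: "x \<in> carrier H" "y \<in> carrier K" "u = \<phi> (x, y)"
        using D_cases[OF u(1)] by blast
      have "x \<noteq> \<zero>\<^bsub>H\<^esub> \<or> y \<noteq> \<zero>\<^bsub>K\<^esub>" using u(2) xy by auto
      moreover have "Re (inner H x x) \<ge> 0" using H.inner_pos[OF xy(1)] xy(1) by (cases "x = \<zero>\<^bsub>H\<^esub>") auto
      moreover have "Re (inner K y y) \<ge> 0" using K.inner_pos[OF xy(2)] xy(2) by (cases "y = \<zero>\<^bsub>K\<^esub>") auto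
      ultimately show ?thesis
        using xy H.inner_pos[OF xy(1)] K.inner_pos[OF xy(2)] by auto
    qed
  qed
  let ?s = "mk_lin H D (\<lambda>x. \<phi> (x, \<zero>\<^bsub>K\<^esub>))" and ?t = "mk_lin K D (\<lambda>y. \<phi> (\<zero>\<^bsub>H\<^esub>, y))"
  let ?s' = "mk_lin D H (\<lambda>u. fst (\<psi> u))" and ?t' = "mk_lin D K (\<lambda>u. snd (\<psi> u))"
  have s: "?s \<in> Lin H D" using K.smult_r_null by (intro mk_lin_in[OF H]) auto
  have t: "?t \<in> Lin K D" using H.smult_r_null by (intro mk_lin_in[OF K]) auto
  have s': "?s' \<in> Lin D H" by (rule mk_lin_in[OF D]) (auto dest!: D_cases simp: \<psi>)
  have t': "?t' \<in> Lin D K" by (rule mk_lin_in[OF D]) (auto dest!: D_cases simp: \<psi>)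
  \<comment> \<open>The candidate adjoints are the coordinate projections; orthogonality of the two
    summands is built into \<open>inner D\<close>.\<close>
  have as: "?s\<^sup>\<dagger> = ?s'" by (rule adj_eqI[OF H D s s']) (auto dest!: D_cases simp: \<psi>)
  have at: "?t\<^sup>\<dagger> = ?t'" by (rule adj_eqI[OF K D t t']) (auto dest!: D_cases simp: \<psi>)
  have "?s\<^sup>\<dagger> \<circ>\<^sub>l ?s = lid H"
    unfolding as by (rule Lin_eqI[of _ H H]) (auto intro!: lcomp_in s s' H simp: \<psi>)
  moreover have "?t\<^sup>\<dagger> \<circ>\<^sub>l ?t = lid K"
    unfolding at by (rule Lin_eqI[of _ K K]) (auto intro!: lcomp_in t t' K simp: \<psi>)
  moreover have "?s\<^sup>\<dagger> \<circ>\<^sub>l ?t = lzero K H"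
    unfolding as by (rule Lin_eqI[of _ K H]) (auto intro!: lcomp_in t s' H K lzero_in simp: \<psi>)
  moreover have "?t\<^sup>\<dagger> \<circ>\<^sub>l ?s = lzero H K"
    unfolding at by (rule Lin_eqI[of _ H K]) (auto intro!: lcomp_in s t' H K lzero_in simp: \<psi>)
  moreover have "ladd D D (?s \<circ>\<^sub>l ?s\<^sup>\<dagger>) (?t \<circ>\<^sub>l ?t\<^sup>\<dagger>) = lid D"
    unfolding as at
    by (rule Lin_eqI[of _ D D])
      (auto intro!: ladd_in lcomp_in s t s' t' D dest!: D_cases simp: \<psi>)
  ultimately show ?thesis using D s t by blast
qed

text \<open>The range of \<open>p\<close> with the inherited structure splits it: self-adjointness
  makes \<open>p\<close>, regarded as a map onto its range, the adjoint of the inclusion.\<close>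

lemma ex_splitting:
  fixes H :: "'h hilb"
  assumes H: "fd_hilbert_space H" and p: "p \<in> Lin H H" and pp: "p \<circ>\<^sub>l p = p" and ap: "p\<^sup>\<dagger> = p"
  shows "\<exists>(K :: 'h hilb) i. fd_hilbert_space K \<and> i \<in> Lin K H \<and> i\<^sup>\<dagger> \<circ>\<^sub>l i = lid K \<and> i \<circ>\<^sub>l i\<^sup>\<dagger> = p"
proof -
  interpret H: fd_hilbert_space H by (rule H)
  have pp': "fn p (fn p x) = fn p x" if "x \<in> carrier H" for x
    using lcomp_fn[of x p p] that by (simp add: pp Lin_dom[OF p])
  note p_in = Lin_in[OF p] and p_add = Lin_add[OF p] and p_smult = Lin_smult[OF p]
  have p_zero: "fn p \<zero>\<^bsub>H\<^esub> = \<zero>\<^bsub>H\<^esub>" by (rule Lin_zero[OF H H p])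
  define K where "K = H\<lparr>carrier := fn p ` carrier H\<rparr>"
  have K_simps [simp]: "zero K = zero H" "add K = add H" "smult K = smult H" "inner K = inner H"
    by (simp_all add: K_def)
  have K_sub: "x \<in> carrier H" "fn p x = x" if "x \<in> carrier K" for x
    using that pp' p_in by (auto simp: K_def)
  have K_I: "fn p x \<in> carrier K" if "x \<in> carrier H" for x using that by (simp add: K_def)
  \<comment> \<open>Idempotence identifies the range with the fixed points, whose closure under the
    operations is immediate from linearity of \<open>p\<close>.\<close>
  have K_iff: "x \<in> carrier K \<longleftrightarrow> x \<in> carrier H \<and> fn p x = x" for x
    using K_sub K_I[of x] by auto
  have vs: "vectorspace class_ring K"
    by (rule vectorspaceI)
      (simp_all add: K_iff p_add p_smult p_zero H.a_ac H.smult_smult H.smult_add_left H.smult_add_right)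
  obtain E where E: "finite E" "generates H E" using H.ex_generates by auto
  have gen: "generates K (fn p ` E)"
  proof (rule generatesI)
    show "fn p ` E \<subseteq> carrier K" using E K_I by (auto simp: generates_def)
    fix U x
    assume EU: "fn p ` E \<subseteq> U" and z: "\<zero>\<^bsub>K\<^esub> \<in> U"
      and a: "\<And>x y. \<lbrakk>x \<in> carrier K; y \<in> carrier K; x \<in> U; y \<in> U\<rbrakk> \<Longrightarrow> x \<oplus>\<^bsub>K\<^esub> y \<in> U"
      and m: "\<And>c x. \<lbrakk>x \<in> carrier K; x \<in> U\<rbrakk> \<Longrightarrow> c \<odot>\<^bsub>K\<^esub> x \<in> U" and x: "x \<in> carrier K"
    have "fn p y \<in> U" if "y \<in> carrier H" for y
      using E(2) that
      by (induction rule: generates_induct)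
        (use EU z a m K_I in \<open>auto simp: p_zero p_add p_smult\<close>)
    from this[of x] show "x \<in> U" using K_sub[OF x] by simp
  qed
  have K: "fd_hilbert_space K"
    by (rule fd_hilbert_spaceI[OF vs finite_imageI[OF E(1)] gen])
      (auto dest: K_sub intro: H.inner_add_right H.inner_smult_right H.inner_commute H.inner_pos)
  let ?i = "mk_lin K H (\<lambda>x. x)" and ?j = "mk_lin H K (fn p)"
  have i: "?i \<in> Lin K H" by (rule mk_lin_in[OF K]) (auto dest: K_sub)
  have j: "?j \<in> Lin H K" by (rule mk_lin_in[OF H]) (auto simp: K_I p_add p_smult)
  have "inner H (fn p y) x = inner H y x" if "x \<in> carrier K" "y \<in> carrier H" for x y
    using adj_inner[OF H H p, of x y] that K_sub[of x] by (simp add: ap)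
  then have ai: "?i\<^sup>\<dagger> = ?j"
    by (intro adj_eqI[OF K H i j]) simp
  have "?i\<^sup>\<dagger> \<circ>\<^sub>l ?i = lid K"
    unfolding ai by (rule Lin_eqI[of _ K K]) (auto intro!: lcomp_in i j K simp: K_sub)
  moreover have "?i \<circ>\<^sub>l ?i\<^sup>\<dagger> = p"
    unfolding ai by (rule Lin_eqI[of _ H H]) (auto intro!: lcomp_in i j H p simp: K_I)
  ultimately show ?thesis using K i by blast
qed

section \<open>The category of quantum functions\<close>

lemma QSet_simps:
  "X \<in> Obj (QSet A B) \<longleftrightarrow> quantum_function A B (fst X) (snd X)"
  "f \<in> carrier (Hom (QSet A B) X Y) \<longleftrightarrow> f \<in> Lin (fst X) (fst Y) \<and>
    (lid (sp B) \<otimes>\<^sub>l f) \<circ>\<^sub>l snd X = snd Y \<circ>\<^sub>l (f \<otimes>\<^sub>l lid (sp A))"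
  "zero (Hom (QSet A B) X Y) = lzero (fst X) (fst Y)"
  "add (Hom (QSet A B) X Y) = ladd (fst X) (fst Y)"
  "smult (Hom (QSet A B) X Y) = lscale (fst X) (fst Y)"
  "Ident (QSet A B) X = lid (fst X)"
  "Comp (QSet A B) = (\<circ>\<^sub>l)"
  "Dag (QSet A B) = adj"
  by (simp_all add: QSet_def intertwiners_def case_prod_beta lzero_def ladd_def lscale_def
    mk_lin_def fun_eq_iff)

context qset_pair
begin

section \<open>Closure properties of intertwiners\<close>

definition intertwines :: "'h hilb \<times> ('h \<times> 'a \<Rightarrow> complex, 'b \<times> 'h \<Rightarrow> complex) linmap
    \<Rightarrow> 'h hilb \<times> ('h \<times> 'a \<Rightarrow> complex, 'b \<times> 'h \<Rightarrow> complex) linmap \<Rightarrow> ('h, 'h) linmap \<Rightarrow> bool" where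
  "intertwines X Y f \<longleftrightarrow> f \<in> Lin (fst X) (fst Y) \<and>
    (lid T \<otimes>\<^sub>l f) \<circ>\<^sub>l snd X = snd Y \<circ>\<^sub>l (f \<otimes>\<^sub>l lid S)"

abbreviation qfun where "qfun X \<equiv> quantum_function A B (fst X) (snd X)"

lemma qfun_fd: "qfun X \<Longrightarrow> fd_hilbert_space (fst X)"
  and qfun_in: "qfun X \<Longrightarrow> snd X \<in> Lin (fst X \<otimes>\<^sub>h S) (T \<otimes>\<^sub>h fst X)"
  by (simp_all add: quantum_function_iff)

lemma ltensor_lid_left_lcomp:
  assumes f: "f \<in> Lin H K" and g: "g \<in> Lin K L"
    and H: "fd_hilbert_space H" and K: "fd_hilbert_space K" and L: "fd_hilbert_space L"
  shows "lid T \<otimes>\<^sub>l (g \<circ>\<^sub>l f) = (lid T \<otimes>\<^sub>l g) \<circ>\<^sub>l (lid T \<otimes>\<^sub>l f)"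
  using ltensor_lcomp[OF lid_in[OF B.fd_sp] f lid_in[OF B.fd_sp] g B.fd_sp H B.fd_sp K B.fd_sp L]
    lcomp_lid_left[OF B.fd_sp B.fd_sp lid_in[OF B.fd_sp]] by simp

lemma ltensor_lid_right_lcomp:
  assumes f: "f \<in> Lin H K" and g: "g \<in> Lin K L"
    and H: "fd_hilbert_space H" and K: "fd_hilbert_space K" and L: "fd_hilbert_space L"
  shows "(g \<circ>\<^sub>l f) \<otimes>\<^sub>l lid S = (g \<otimes>\<^sub>l lid S) \<circ>\<^sub>l (f \<otimes>\<^sub>l lid S)"
  using ltensor_lcomp[OF f lid_in[OF A.fd_sp] g lid_in[OF A.fd_sp] H A.fd_sp K A.fd_sp L A.fd_sp]
    lcomp_lid_left[OF A.fd_sp A.fd_sp lid_in[OF A.fd_sp]] by simp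

lemma intertwines_lid:
  assumes X: "qfun X"
  shows "intertwines X X (lid (fst X))"
proof -
  note H = qfun_fd[OF X]
  show ?thesis
    using lid_in[OF H] lcomp_lid_left[OF fd_tensor[OF H A.fd_sp] fd_tensor[OF B.fd_sp H] qfun_in[OF X]]
      lcomp_lid_right[OF fd_tensor[OF H A.fd_sp] qfun_in[OF X]]
    by (simp add: intertwines_def ltensor_lid[OF H A.fd_sp] ltensor_lid[OF B.fd_sp H])
qed

lemma intertwines_lcomp:
  assumes X: "qfun X" and Y: "qfun Y" and Z: "qfun Z"
    and f: "intertwines X Y f" and g: "intertwines Y Z g"
  shows "intertwines X Z (g \<circ>\<^sub>l f)"
proof -
  note S = A.fd_sp and T = B.fd_sp
  note H = qfun_fd[OF X] and K = qfun_fd[OF Y] and L = qfun_fd[OF Z]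
  note P = qfun_in[OF X] and Q = qfun_in[OF Y] and R = qfun_in[OF Z]
  have f': "f \<in> Lin (fst X) (fst Y)" "(lid T \<otimes>\<^sub>l f) \<circ>\<^sub>l snd X = snd Y \<circ>\<^sub>l (f \<otimes>\<^sub>l lid S)"
    and g': "g \<in> Lin (fst Y) (fst Z)" "(lid T \<otimes>\<^sub>l g) \<circ>\<^sub>l snd Y = snd Z \<circ>\<^sub>l (g \<otimes>\<^sub>l lid S)"
    using f g by (auto simp: intertwines_def)
  note HS = fd_tensor[OF H S] and KS = fd_tensor[OF K S] and TH = fd_tensor[OF T H]
    and TK = fd_tensor[OF T K]
  note Tf = ltensor_in[OF lid_in[OF T] f'(1) T H T K] and Tg = ltensor_in[OF lid_in[OF T] g'(1) T K T L]
  note fS = ltensor_in[OF f'(1) lid_in[OF S] H S K S] and gS = ltensor_in[OF g'(1) lid_in[OF S] K S L S]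
  have "(lid T \<otimes>\<^sub>l (g \<circ>\<^sub>l f)) \<circ>\<^sub>l snd X = snd Z \<circ>\<^sub>l ((g \<circ>\<^sub>l f) \<otimes>\<^sub>l lid S)"
    using lcomp_assoc[OF HS TH P Tf Tg] lcomp_assoc[OF HS KS fS Q Tg] lcomp_assoc[OF HS KS fS gS R]
    by (simp add: ltensor_lid_left_lcomp[OF f'(1) g'(1) H K L] ltensor_lid_right_lcomp[OF f'(1) g'(1) H K L]
      f'(2) flip: g'(2))
  then show ?thesis using lcomp_in[OF H f'(1) g'(1)] by (simp add: intertwines_def)
qed

lemma intertwines_adj:
  assumes X: "qfun X" and Y: "qfun Y" and f: "intertwines X Y f"
  shows "intertwines Y X (f\<^sup>\<dagger>)"
  using f adj_in[OF qfun_fd[OF X] qfun_fd[OF Y]] intertwiner_adj[OF X Y]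
  by (simp add: intertwines_def)

lemma intertwines_lzero:
  assumes X: "qfun X" and Y: "qfun Y"
  shows "intertwines X Y (lzero (fst X) (fst Y))"
proof -
  note S = A.fd_sp and T = B.fd_sp
  note H = qfun_fd[OF X] and K = qfun_fd[OF Y]
  note HS = fd_tensor[OF H S] and KS = fd_tensor[OF K S] and TH = fd_tensor[OF T H]
    and TK = fd_tensor[OF T K]
  show ?thesis
    unfolding intertwines_def
    by (simp add: lzero_in[OF H K] ltensor_lzero_right[OF T H T K lid_in[OF T]]
      ltensor_lzero_left[OF H S K S lid_in[OF S]] lcomp_lzero_left[OF HS TH TK qfun_in[OF X]]
      lcomp_lzero_right[OF HS KS TK qfun_in[OF Y]])
qed

lemma intertwines_ladd:
  assumes X: "qfun X" and Y: "qfun Y" and f: "intertwines X Y f" and g: "intertwines X Y g"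
  shows "intertwines X Y (ladd (fst X) (fst Y) f g)"
proof -
  note S = A.fd_sp and T = B.fd_sp
  note H = qfun_fd[OF X] and K = qfun_fd[OF Y]
  note HS = fd_tensor[OF H S] and KS = fd_tensor[OF K S] and TH = fd_tensor[OF T H]
    and TK = fd_tensor[OF T K]
  note lS = lid_in[OF S] and lT = lid_in[OF T]
  have f': "f \<in> Lin (fst X) (fst Y)" "(lid T \<otimes>\<^sub>l f) \<circ>\<^sub>l snd X = snd Y \<circ>\<^sub>l (f \<otimes>\<^sub>l lid S)"
    and g': "g \<in> Lin (fst X) (fst Y)" "(lid T \<otimes>\<^sub>l g) \<circ>\<^sub>l snd X = snd Y \<circ>\<^sub>l (g \<otimes>\<^sub>l lid S)"
    using f g by (auto simp: intertwines_def)
  show ?thesis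
    unfolding intertwines_def
    by (simp add: ladd_in[OF H K f'(1) g'(1)] ltensor_ladd_right[OF T H T K lT f'(1) g'(1)]
      ltensor_ladd_left[OF H S K S f'(1) g'(1) lS] f'(2) g'(2)
      lcomp_ladd_left[OF HS TH TK qfun_in[OF X] ltensor_in[OF lT f'(1) T H T K] ltensor_in[OF lT g'(1) T H T K]]
      lcomp_ladd_right[OF HS KS TK ltensor_in[OF f'(1) lS H S K S] ltensor_in[OF g'(1) lS H S K S] qfun_in[OF Y]])
qed

lemma intertwines_lscale:
  assumes X: "qfun X" and Y: "qfun Y" and f: "intertwines X Y f"
  shows "intertwines X Y (lscale (fst X) (fst Y) c f)"
proof -
  note S = A.fd_sp and T = B.fd_sp
  note H = qfun_fd[OF X] and K = qfun_fd[OF Y]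
  note HS = fd_tensor[OF H S] and KS = fd_tensor[OF K S] and TH = fd_tensor[OF T H]
    and TK = fd_tensor[OF T K]
  note lS = lid_in[OF S] and lT = lid_in[OF T]
  have f': "f \<in> Lin (fst X) (fst Y)" "(lid T \<otimes>\<^sub>l f) \<circ>\<^sub>l snd X = snd Y \<circ>\<^sub>l (f \<otimes>\<^sub>l lid S)"
    using f by (auto simp: intertwines_def)
  show ?thesis
    unfolding intertwines_def
    by (simp add: lscale_in[OF H K f'(1)] ltensor_lscale_right[OF T H T K lT f'(1)]
      ltensor_lscale_left[OF H S K S f'(1) lS] f'(2)
      lcomp_lscale_left[OF HS TH TK qfun_in[OF X] ltensor_in[OF lT f'(1) T H T K]]
      lcomp_lscale_right[OF HS KS TK ltensor_in[OF f'(1) lS H S K S] qfun_in[OF Y]])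
qed

section \<open>Hom spaces as finite-dimensional vector spaces\<close>

lemma vectorspace_Hom:
  assumes X: "qfun X" and Y: "qfun Y"
  shows "vectorspace class_ring (Hom (QSet A B) X Y)"
proof (rule vectorspaceI)
  let ?V = "Hom (QSet A B) X Y"
  note H = qfun_fd[OF X] and K = qfun_fd[OF Y]
  interpret K: fd_hilbert_space "fst Y" by (rule K)
  note [simp] = QSet_simps(3-5)
  have iff: "f \<in> carrier (?V) \<longleftrightarrow> intertwines X Y f" for f
    by (simp add: QSet_simps intertwines_def)
  have L: "f \<in> Lin (fst X) (fst Y)" if "f \<in> carrier (?V)" for f
    using that by (simp add: QSet_simps)
  note ins = ladd_in[OF H K] lscale_in[OF H K] lzero_in[OF H K] L
  show "\<zero>\<^bsub>?V\<^esub> \<in> carrier (?V)"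
    unfolding iff using intertwines_lzero[OF X Y] by simp
  fix f assume f: "f \<in> carrier (?V)"
  note f_in = Lin_in[OF L[OF f]]
  show "c \<odot>\<^bsub>?V\<^esub> f \<in> carrier (?V)" for c
    using f unfolding iff by (simp add: intertwines_lscale[OF X Y])
  show "f \<oplus>\<^bsub>?V\<^esub> \<zero>\<^bsub>?V\<^esub> = f"
    using ladd_lzero[OF H K L[OF f]] by simp
  show "f \<oplus>\<^bsub>?V\<^esub> - 1 \<odot>\<^bsub>?V\<^esub> f = \<zero>\<^bsub>?V\<^esub>"
    by (rule Lin_eqI[of _ "fst X" "fst Y"]) (simp_all add: ins f f_in)
  show "1 \<odot>\<^bsub>?V\<^esub> f = f"
    by (rule Lin_eqI[of _ "fst X" "fst Y"]) (simp_all add: ins f f_in)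
  show "(a * b) \<odot>\<^bsub>?V\<^esub> f =
      a \<odot>\<^bsub>?V\<^esub> (b \<odot>\<^bsub>?V\<^esub> f)" for a b
    by (rule Lin_eqI[of _ "fst X" "fst Y"]) (simp_all add: ins f f_in K.smult_smult)
  show "(a + b) \<odot>\<^bsub>?V\<^esub> f =
      a \<odot>\<^bsub>?V\<^esub> f \<oplus>\<^bsub>?V\<^esub> b \<odot>\<^bsub>?V\<^esub> f" for a b
    by (rule Lin_eqI[of _ "fst X" "fst Y"]) (simp_all add: ins f f_in K.smult_add_left)
  fix g assume g: "g \<in> carrier (?V)"
  note g_in = Lin_in[OF L[OF g]]
  show "f \<oplus>\<^bsub>?V\<^esub> g \<in> carrier (?V)"
    using f g unfolding iff by (simp add: intertwines_ladd[OF X Y])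
  show "f \<oplus>\<^bsub>?V\<^esub> g = g \<oplus>\<^bsub>?V\<^esub> f"
    by (rule Lin_eqI[of _ "fst X" "fst Y"]) (simp_all add: ins f g f_in g_in K.a_comm)
  show "a \<odot>\<^bsub>?V\<^esub> (f \<oplus>\<^bsub>?V\<^esub> g) =
      a \<odot>\<^bsub>?V\<^esub> f \<oplus>\<^bsub>?V\<^esub> a \<odot>\<^bsub>?V\<^esub> g" for a
    by (rule Lin_eqI[of _ "fst X" "fst Y"]) (simp_all add: ins f g f_in g_in K.smult_add_right)
  fix h assume h: "h \<in> carrier (?V)"
  note h_in = Lin_in[OF L[OF h]]
  show "(f \<oplus>\<^bsub>?V\<^esub> g) \<oplus>\<^bsub>?V\<^esub> h =
      f \<oplus>\<^bsub>?V\<^esub> (g \<oplus>\<^bsub>?V\<^esub> h)"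
    by (rule Lin_eqI[of _ "fst X" "fst Y"]) (simp_all add: ins f g h f_in g_in h_in K.a_assoc)
qed

text \<open>Matrix entries with respect to the two frames separate all linear maps, hence also the
  solutions of the intertwiner equation.\<close>

lemma fin_dim_Hom:
  assumes X: "qfun X" and Y: "qfun Y"
  shows "vectorspace.fin_dim class_ring (Hom (QSet A B) X Y)"
proof -
  note H = qfun_fd[OF X] and K = qfun_fd[OF Y]
  interpret H: fd_hilbert_space "fst X" by (rule H)
  interpret K: fd_hilbert_space "fst Y" by (rule K)
  have L: "f \<in> Lin (fst X) (fst Y)" if "f \<in> carrier (Hom (QSet A B) X Y)" for f
    using that by (simp add: QSet_simps)
  show ?thesis
  proof (rule fin_dim_if_separated[OF vectorspace_Hom[OF X Y],
      of "H.frame \<times> K.frame" "\<lambda>(e, e') f. inner (fst Y) e' (fn f e)"])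
    show "finite (H.frame \<times> K.frame)" by simp
    show "f = \<zero>\<^bsub>Hom (QSet A B) X Y\<^esub>"
      if "f \<in> carrier (Hom (QSet A B) X Y)"
        "\<And>i. i \<in> H.frame \<times> K.frame \<Longrightarrow> (case i of (e, e') \<Rightarrow> \<lambda>f. inner (fst Y) e' (fn f e)) f = 0" for f
      unfolding QSet_simps(3)
      by (rule eq_lzero_if_entries[OF H K L[OF that(1)]]) (use that(2) in fastforce)
  qed (auto simp: QSet_simps(4,5) K.inner_add_right K.inner_smult_right Lin_in[OF L])
qed

section \<open>Zero objects, direct sums and splittings of quantum functions\<close>

lemma ex_zero_object: "\<exists>Z. qfun Z \<and> fst Z = (zero_hilb :: 'h hilb)"
proof -
  let ?Z = "zero_hilb :: 'h hilb"
  note S = A.fd_sp and T = B.fd_sp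
  have "lzero (?Z \<otimes>\<^sub>h S) (T \<otimes>\<^sub>h ?Z) \<in> Lin (?Z \<otimes>\<^sub>h S) (T \<otimes>\<^sub>h ?Z)"
    by (intro lzero_in fd_tensor S T fd_zero_hilb)
  \<comment> \<open>The empty set generates the zero space, so gluing along the empty family
    applies, with vacuous conditions on its members. The annotation fixes their otherwise
    undetermined source type.\<close>
  then have "quantum_function A B ?Z (lzero (?Z \<otimes>\<^sub>h S) (T \<otimes>\<^sub>h ?Z))"
    by (rule quantum_function_glue[where M = "{} :: (('h, 'h) linmap \<times> _) set", OF fd_zero_hilb])
      (simp_all add: generates_zero_hilb)
  then show ?thesis by (intro exI[of _ "(?Z, lzero (?Z \<otimes>\<^sub>h S) (T \<otimes>\<^sub>h ?Z))"]) simp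
qed

lemma Lin_zero_hilb_unique:
  assumes H: "fd_hilbert_space H"
  shows "f \<in> Lin H zero_hilb \<Longrightarrow> f = lzero H zero_hilb"
    and "g \<in> Lin zero_hilb H \<Longrightarrow> g = lzero zero_hilb H"
proof -
  show "f = lzero H zero_hilb" if f: "f \<in> Lin H zero_hilb"
    using Lin_in[OF f] by (intro Lin_eqI[OF f lzero_in[OF H fd_zero_hilb]]) (simp add: zero_hilb_def)
  show "g = lzero zero_hilb H" if g: "g \<in> Lin zero_hilb H"
    by (rule Lin_eq_generates[OF generates_zero_hilb g lzero_in[OF fd_zero_hilb H] fd_zero_hilb H]) simp
qed

text \<open>Conjugation of P by \<open>s\<close>. For an isometry it extends P by zero off the range
  of \<open>s\<close>; for the adjoint of an isometry it compresses P to a subspace.\<close>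

definition transport :: "'k hilb \<Rightarrow> ('k, 'h) linmap \<Rightarrow> ('k \<times> 'a \<Rightarrow> complex, 'b \<times> 'k \<Rightarrow> complex) linmap
    \<Rightarrow> ('h \<times> 'a \<Rightarrow> complex, 'b \<times> 'h \<Rightarrow> complex) linmap" where
  "transport K s P = (lid T \<otimes>\<^sub>l s) \<circ>\<^sub>l (P \<circ>\<^sub>l (s\<^sup>\<dagger> \<otimes>\<^sub>l lid S))"

context
  fixes K :: "'k hilb" and H :: "'h hilb" and s P
  assumes K: "fd_hilbert_space K" and H: "fd_hilbert_space H"
    and s: "s \<in> Lin K H" and P: "P \<in> Lin (K \<otimes>\<^sub>h S) (T \<otimes>\<^sub>h K)"
begin

private lemmas as = adj_in[OF K H s]

lemma transport_in: "transport K s P \<in> Lin (H \<otimes>\<^sub>h S) (T \<otimes>\<^sub>h H)"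
  unfolding transport_def by (rule qs_intros s P K H)+

text \<open>Collects \<open>s\<^sup>\<dagger> \<circ>\<^sub>l t\<close> in one place, where the
  relations between two injections, or between an inclusion and its adjoint, can be applied.\<close>

lemma transport_lcomp:
  assumes L: "fd_hilbert_space L" and t: "t \<in> Lin L H"
  shows "transport K s P \<circ>\<^sub>l (t \<otimes>\<^sub>l lid S) = (lid T \<otimes>\<^sub>l s) \<circ>\<^sub>l (P \<circ>\<^sub>l ((s\<^sup>\<dagger> \<circ>\<^sub>l t) \<otimes>\<^sub>l lid S))"
proof -
  note S = A.fd_sp and T = B.fd_sp
  note lS = lid_in[OF S] and lT = lid_in[OF T]
  note LS = fd_tensor[OF L S] and HS = fd_tensor[OF H S]
  note tS = ltensor_in[OF t lS L S H S] and aS = ltensor_in[OF as lS H S K S]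
    and Ts = ltensor_in[OF lT s T K T H]
  show ?thesis
    unfolding transport_def
    using lcomp_assoc[OF LS HS tS lcomp_in[OF HS aS P] Ts] lcomp_assoc[OF LS HS tS aS P]
    by (simp add: ltensor_lid_right_lcomp[OF t as L H K])
qed

lemma lcomp_transport:
  assumes L: "fd_hilbert_space L" and t: "t \<in> Lin H L"
  shows "(lid T \<otimes>\<^sub>l t) \<circ>\<^sub>l transport K s P = (lid T \<otimes>\<^sub>l (t \<circ>\<^sub>l s)) \<circ>\<^sub>l (P \<circ>\<^sub>l (s\<^sup>\<dagger> \<otimes>\<^sub>l lid S))"
proof -
  note S = A.fd_sp and T = B.fd_sp
  note lS = lid_in[OF S] and lT = lid_in[OF T]
  note HS = fd_tensor[OF H S] and TK = fd_tensor[OF T K]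
  note aS = ltensor_in[OF as lS H S K S] and Ts = ltensor_in[OF lT s T K T H]
    and Tt = ltensor_in[OF lT t T H T L]
  show ?thesis
    unfolding transport_def
    using lcomp_assoc[OF HS TK lcomp_in[OF HS aS P] Ts Tt]
    by (simp add: ltensor_lid_left_lcomp[OF s t K H L])
qed

end

lemma ex_direct_sum_qfun:
  fixes X Y :: "'h hilb \<times> ('h \<times> 'a \<Rightarrow> complex, 'b \<times> 'h \<Rightarrow> complex) linmap"
  assumes X: "qfun X" and Y: "qfun Y"
  shows "\<exists>Z s t. qfun Z \<and> intertwines X Z s \<and> intertwines Y Z t \<and>
    s\<^sup>\<dagger> \<circ>\<^sub>l s = lid (fst X) \<and> t\<^sup>\<dagger> \<circ>\<^sub>l t = lid (fst Y) \<and>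
    ladd (fst Z) (fst Z) (s \<circ>\<^sub>l s\<^sup>\<dagger>) (t \<circ>\<^sub>l t\<^sup>\<dagger>) = lid (fst Z)"
proof -
  note S = A.fd_sp and T = B.fd_sp
  note lS = lid_in[OF S] and lT = lid_in[OF T]
  note H = qfun_fd[OF X] and K = qfun_fd[OF Y]
  note P = qfun_in[OF X] and Q = qfun_in[OF Y]
  obtain D :: "'h hilb" and s t where D: "fd_hilbert_space D" and s: "s \<in> Lin (fst X) D"
    and t: "t \<in> Lin (fst Y) D" and ss: "s\<^sup>\<dagger> \<circ>\<^sub>l s = lid (fst X)" and tt: "t\<^sup>\<dagger> \<circ>\<^sub>l t = lid (fst Y)"
    and st: "s\<^sup>\<dagger> \<circ>\<^sub>l t = lzero (fst Y) (fst X)" and ts: "t\<^sup>\<dagger> \<circ>\<^sub>l s = lzero (fst X) (fst Y)"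
    and sum: "ladd D D (s \<circ>\<^sub>l s\<^sup>\<dagger>) (t \<circ>\<^sub>l t\<^sup>\<dagger>) = lid D"
    using ex_direct_sum[OF H K] by blast
  note as = adj_in[OF H D s] and at = adj_in[OF K D t]
  note DS = fd_tensor[OF D S] and TD = fd_tensor[OF T D]
  note HS = fd_tensor[OF H S] and KS = fd_tensor[OF K S] and TH = fd_tensor[OF T H] and TK = fd_tensor[OF T K]
  note Ts = ltensor_in[OF lT s T H T D] and Tt = ltensor_in[OF lT t T K T D]
  note sS = ltensor_in[OF s lS H S D S] and tS = ltensor_in[OF t lS K S D S]
  note Tas = ltensor_in[OF lT as T D T H] and Tat = ltensor_in[OF lT at T D T K]
  note asS = ltensor_in[OF as lS D S H S] and atS = ltensor_in[OF at lS D S K S]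
  note c1 = transport_in[OF H D s P] and c2 = transport_in[OF K D t Q]
  \<comment> \<open>The block-diagonal sum of the two structure maps. The four equations that follow
    are what gluing asks for: in each, one block survives by an isometry relation and the other
    vanishes by orthogonality.\<close>
  define R where "R = ladd (D \<otimes>\<^sub>h S) (T \<otimes>\<^sub>h D) (transport (fst X) s (snd X)) (transport (fst Y) t (snd Y))"
  have R: "R \<in> Lin (D \<otimes>\<^sub>h S) (T \<otimes>\<^sub>h D)"
    unfolding R_def by (rule ladd_in[OF DS TD c1 c2])
  have 1: "(lid T \<otimes>\<^sub>l s) \<circ>\<^sub>l snd X = R \<circ>\<^sub>l (s \<otimes>\<^sub>l lid S)"
    unfolding R_def
    by (simp add: lcomp_ladd_left[OF HS DS TD sS c1 c2] transport_lcomp[OF H D s P H s]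
      transport_lcomp[OF K D t Q H s] ss ts ltensor_lid[OF H S] ltensor_lzero_left[OF H S K S lS]
      lcomp_lid_right[OF HS P] lcomp_lzero_right[OF HS KS TK Q] lcomp_lzero_right[OF HS TK TD Tt]
      ladd_lzero[OF HS TD lcomp_in[OF HS P Ts]])
  have 2: "(lid T \<otimes>\<^sub>l t) \<circ>\<^sub>l snd Y = R \<circ>\<^sub>l (t \<otimes>\<^sub>l lid S)"
    unfolding R_def
    by (simp add: lcomp_ladd_left[OF KS DS TD tS c1 c2] transport_lcomp[OF H D s P K t]
      transport_lcomp[OF K D t Q K t] tt st ltensor_lid[OF K S] ltensor_lzero_left[OF K S H S lS]
      lcomp_lid_right[OF KS Q] lcomp_lzero_right[OF KS HS TH P] lcomp_lzero_right[OF KS TH TD Ts]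
      lzero_ladd[OF KS TD lcomp_in[OF KS Q Tt]])
  have 3: "(lid T \<otimes>\<^sub>l s\<^sup>\<dagger>) \<circ>\<^sub>l R = snd X \<circ>\<^sub>l (s\<^sup>\<dagger> \<otimes>\<^sub>l lid S)"
    unfolding R_def
    by (simp add: lcomp_ladd_right[OF DS TD TH c1 c2 Tas] lcomp_transport[OF H D s P H as]
      lcomp_transport[OF K D t Q H as] ss st ltensor_lid[OF T H] ltensor_lzero_right[OF T K T H lT]
      lcomp_lid_left[OF DS TH lcomp_in[OF DS asS P]] lcomp_lzero_left[OF DS TK TH lcomp_in[OF DS atS Q]]
      ladd_lzero[OF DS TH lcomp_in[OF DS asS P]])
  have 4: "(lid T \<otimes>\<^sub>l t\<^sup>\<dagger>) \<circ>\<^sub>l R = snd Y \<circ>\<^sub>l (t\<^sup>\<dagger> \<otimes>\<^sub>l lid S)"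
    unfolding R_def
    by (simp add: lcomp_ladd_right[OF DS TD TK c1 c2 Tat] lcomp_transport[OF H D s P K at]
      lcomp_transport[OF K D t Q K at] tt ts ltensor_lid[OF T K] ltensor_lzero_right[OF T H T K lT]
      lcomp_lid_left[OF DS TK lcomp_in[OF DS atS Q]] lcomp_lzero_left[OF DS TH TK lcomp_in[OF DS asS P]]
      lzero_ladd[OF DS TK lcomp_in[OF DS atS Q]])
  let ?M = "{(s, snd X), (t, snd Y)}"
  have gen: "generates D (\<Union>(u, Q) \<in> ?M. fn u ` carrier (dom u))"
  proof (rule generatesI)
    show "(\<Union>(u, Q) \<in> ?M. fn u ` carrier (dom u)) \<subseteq> carrier D"
      by (auto simp: Lin_dom[OF s] Lin_dom[OF t] intro: Lin_in[OF s] Lin_in[OF t])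
    fix U x
    assume U: "(\<Union>(u, Q) \<in> ?M. fn u ` carrier (dom u)) \<subseteq> U"
      and a: "\<And>x y. \<lbrakk>x \<in> carrier D; y \<in> carrier D; x \<in> U; y \<in> U\<rbrakk> \<Longrightarrow> x \<oplus>\<^bsub>D\<^esub> y \<in> U"
      and x: "x \<in> carrier D"
    note sx = Lin_in[OF as x] and tx = Lin_in[OF at x]
    \<comment> \<open>The completeness relation \<open>sum\<close> writes every vector as a sum of
      one vector from each image.\<close>
    have "x = fn (ladd D D (s \<circ>\<^sub>l s\<^sup>\<dagger>) (t \<circ>\<^sub>l t\<^sup>\<dagger>)) x" unfolding sum using x by simp
    also have "\<dots> = fn s (fn (s\<^sup>\<dagger>) x) \<oplus>\<^bsub>D\<^esub> fn t (fn (t\<^sup>\<dagger>) x)"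
      using x by (simp add: Lin_dom[OF as] Lin_dom[OF at])
    also have "\<dots> \<in> U"
      using U sx tx
      by (intro a Lin_in[OF s] Lin_in[OF t]) (auto simp: Lin_dom[OF s] Lin_dom[OF t])
    finally show "x \<in> U" .
  qed
  have "quantum_function A B D R"
    by (rule quantum_function_glue[OF D R gen])
      (use X Y s t 1 2 3 4 in \<open>auto simp: Lin_dom[OF s] Lin_dom[OF t]\<close>)
  then show ?thesis
    using s t 1 2 ss tt sum
    by (intro exI[of _ "(D, R)"] exI[of _ s] exI[of _ t]) (simp add: intertwines_def)
qed

lemma ex_splitting_qfun:
  fixes X :: "'h hilb \<times> ('h \<times> 'a \<Rightarrow> complex, 'b \<times> 'h \<Rightarrow> complex) linmap"
  assumes X: "qfun X" and p: "intertwines X X p" and pp: "p \<circ>\<^sub>l p = p" and ap: "p\<^sup>\<dagger> = p"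
  shows "\<exists>Y i. qfun Y \<and> intertwines Y X i \<and> i\<^sup>\<dagger> \<circ>\<^sub>l i = lid (fst Y) \<and> i \<circ>\<^sub>l i\<^sup>\<dagger> = p"
proof -
  note S = A.fd_sp and T = B.fd_sp
  note lS = lid_in[OF S] and lT = lid_in[OF T]
  note H = qfun_fd[OF X] and P = qfun_in[OF X]
  have p': "p \<in> Lin (fst X) (fst X)" "(lid T \<otimes>\<^sub>l p) \<circ>\<^sub>l snd X = snd X \<circ>\<^sub>l (p \<otimes>\<^sub>l lid S)"
    using p by (auto simp: intertwines_def)
  obtain K :: "'h hilb" and i where K: "fd_hilbert_space K" and i: "i \<in> Lin K (fst X)"
    and ii: "i\<^sup>\<dagger> \<circ>\<^sub>l i = lid K" and ip: "i \<circ>\<^sub>l i\<^sup>\<dagger> = p"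
    using ex_splitting[OF H p'(1) pp ap] by blast
  note ai = adj_in[OF K H i]
  have aai: "(i\<^sup>\<dagger>)\<^sup>\<dagger> = i" by (rule adj_adj[OF K H i])
  note HS = fd_tensor[OF H S] and KS = fd_tensor[OF K S] and TH = fd_tensor[OF T H] and TK = fd_tensor[OF T K]
  note pS = ltensor_in[OF p'(1) lS H S H S] and iS = ltensor_in[OF i lS K S H S]
    and Tp = ltensor_in[OF lT p'(1) T H T H] and Tai = ltensor_in[OF lT ai T H T K]
  \<comment> \<open>The compression of the structure map of \<open>X\<close> to the range of
    \<open>p\<close>: \<open>i\<^sup>\<dagger>\<close> plays the role of \<open>s\<close> in
    \<open>transport\<close>, and \<open>i\<close> that of its adjoint.\<close>
  define Q where "Q = transport (fst X) (i\<^sup>\<dagger>) (snd X)"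
  have Q: "Q \<in> Lin (K \<otimes>\<^sub>h S) (T \<otimes>\<^sub>h K)" unfolding Q_def by (rule transport_in[OF H K ai P])
  have "i\<^sup>\<dagger> \<circ>\<^sub>l p = (i\<^sup>\<dagger> \<circ>\<^sub>l i) \<circ>\<^sub>l i\<^sup>\<dagger>"
    unfolding ip[symmetric] by (rule lcomp_assoc[symmetric, OF H K ai i ai])
  then have aip: "i\<^sup>\<dagger> \<circ>\<^sub>l p = i\<^sup>\<dagger>" by (simp add: ii lcomp_lid_left[OF H K ai])
  have "p \<circ>\<^sub>l i = i \<circ>\<^sub>l (i\<^sup>\<dagger> \<circ>\<^sub>l i)"
    unfolding ip[symmetric] by (rule lcomp_assoc[OF K H i ai i])
  then have pi: "p \<circ>\<^sub>l i = i" by (simp add: ii lcomp_lid_right[OF K i])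
  \<comment> \<open>The factor \<open>i \<circ>\<^sub>l i\<^sup>\<dagger>\<close> that appears is
    \<open>p\<close>; its intertwiner equation moves it to the other side of the structure map,
    where \<open>aip\<close> absorbs it.\<close>
  have 1: "(lid T \<otimes>\<^sub>l i\<^sup>\<dagger>) \<circ>\<^sub>l snd X = Q \<circ>\<^sub>l (i\<^sup>\<dagger> \<otimes>\<^sub>l lid S)"
  proof -
    have "Q \<circ>\<^sub>l (i\<^sup>\<dagger> \<otimes>\<^sub>l lid S) = (lid T \<otimes>\<^sub>l i\<^sup>\<dagger>) \<circ>\<^sub>l ((lid T \<otimes>\<^sub>l p) \<circ>\<^sub>l snd X)"
      unfolding Q_def by (simp add: transport_lcomp[OF H K ai P H ai] aai ip p'(2))
    also have "\<dots> = (lid T \<otimes>\<^sub>l (i\<^sup>\<dagger> \<circ>\<^sub>l p)) \<circ>\<^sub>l snd X"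
      by (simp add: ltensor_lid_left_lcomp[OF p'(1) ai H H K] lcomp_assoc[OF HS TH P Tp Tai])
    finally show ?thesis by (simp add: aip)
  qed
  \<comment> \<open>The mirror image, with \<open>p\<close> moved next to \<open>i\<close> and
    absorbed by \<open>pi\<close>.\<close>
  have 2: "(lid T \<otimes>\<^sub>l i) \<circ>\<^sub>l Q = snd X \<circ>\<^sub>l (i \<otimes>\<^sub>l lid S)"
  proof -
    have "(lid T \<otimes>\<^sub>l i) \<circ>\<^sub>l Q = (lid T \<otimes>\<^sub>l p) \<circ>\<^sub>l (snd X \<circ>\<^sub>l (i \<otimes>\<^sub>l lid S))"
      unfolding Q_def by (simp add: lcomp_transport[OF H K ai P H i] aai ip)
    also have "\<dots> = snd X \<circ>\<^sub>l ((p \<circ>\<^sub>l i) \<otimes>\<^sub>l lid S)"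
      using lcomp_assoc[OF KS HS iS P Tp] lcomp_assoc[OF KS HS iS pS P]
      by (simp add: ltensor_lid_right_lcomp[OF i p'(1) K H H] p'(2))
    finally show ?thesis by (simp add: pi)
  qed
  have gen: "generates K (\<Union>(u, Q) \<in> {(i\<^sup>\<dagger>, snd X)}. fn u ` carrier (dom u))"
  proof (rule generatesI)
    show "(\<Union>(u, Q) \<in> {(i\<^sup>\<dagger>, snd X)}. fn u ` carrier (dom u)) \<subseteq> carrier K"
      by (auto simp: Lin_dom[OF ai] intro: Lin_in[OF ai])
    fix U x
    assume U: "(\<Union>(u, Q) \<in> {(i\<^sup>\<dagger>, snd X)}. fn u ` carrier (dom u)) \<subseteq> U" and x: "x \<in> carrier K"
    have "x = fn (i\<^sup>\<dagger> \<circ>\<^sub>l i) x" unfolding ii using x by simp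
    then have "x = fn (i\<^sup>\<dagger>) (fn i x)" using x by (simp add: Lin_dom[OF i])
    then show "x \<in> U" using U Lin_in[OF i x] by (auto simp: Lin_dom[OF ai])
  qed
  \<comment> \<open>Gluing needs maps into K, so the family consists of
    \<open>i\<^sup>\<dagger>\<close> alone, which is onto because \<open>ii\<close> gives it a right
    inverse. The inclusion \<open>i\<close> enters as its adjoint.\<close>
  have "quantum_function A B K Q"
    by (rule quantum_function_glue[OF K Q gen])
      (use X ai 1 2 in \<open>auto simp: Lin_dom[OF ai] aai\<close>)
  then show ?thesis
    using i 2 ii ip by (intro exI[of _ "(K, Q)"] exI[of _ i]) (simp add: intertwines_def)
qed

section \<open>Assembly of the category axioms\<close>

theorem semisimple_QSet:
  "semisimple_dagger_category (QSet A B :: ('h hilb \<times> ('h \<times> 'a \<Rightarrow> complex, 'b \<times> 'h \<Rightarrow> complex) linmap,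
       ('h, 'h) linmap) dcat)" (is "semisimple_dagger_category ?C")
proof -
  have Hom: "f \<in> carrier (Hom ?C X Y) \<longleftrightarrow> intertwines X Y f" for f X Y
    by (simp add: QSet_simps(2) intertwines_def)
  note C = QSet_simps(1,3-) Hom
  have L: "f \<in> Lin (fst X) (fst Y)" if "intertwines X Y f" for f and X Y :: "'h hilb \<times> _"
    using that by (simp add: intertwines_def)
  have "dagger_category ?C"
  proof (rule dagger_category.intro, unfold C)
    \<comment> \<open>Assumptions are introduced gradually, and each axiom is discharged as soon as
      those it mentions are available.\<close>
    fix W X Y Z :: "'h hilb \<times> ('h \<times> 'a \<Rightarrow> complex, 'b \<times> 'h \<Rightarrow> complex) linmap" and f g h
    assume X: "qfun X"
    show "intertwines X X (lid (fst X))" by (rule intertwines_lid[OF X])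
    show "(lid (fst X))\<^sup>\<dagger> = lid (fst X)" by (rule adj_lid[OF qfun_fd[OF X]])
    assume Y: "qfun Y"
    { assume f: "intertwines X Y f"
      show "f \<circ>\<^sub>l lid (fst X) = f" by (rule lcomp_lid_right[OF qfun_fd[OF X] L[OF f]])
      show "lid (fst Y) \<circ>\<^sub>l f = f" by (rule lcomp_lid_left[OF qfun_fd[OF X] qfun_fd[OF Y] L[OF f]])
      show "intertwines Y X (f\<^sup>\<dagger>)" by (rule intertwines_adj[OF X Y f])
      show "(f\<^sup>\<dagger>)\<^sup>\<dagger> = f" by (rule adj_adj[OF qfun_fd[OF X] qfun_fd[OF Y] L[OF f]]) }
    assume Z: "qfun Z"
    { assume f: "intertwines X Y f" and g: "intertwines Y Z g"
      show "intertwines X Z (g \<circ>\<^sub>l f)" by (rule intertwines_lcomp[OF X Y Z f g])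
      show "(g \<circ>\<^sub>l f)\<^sup>\<dagger> = f\<^sup>\<dagger> \<circ>\<^sub>l g\<^sup>\<dagger>"
        by (rule adj_lcomp[OF qfun_fd[OF X] qfun_fd[OF Y] qfun_fd[OF Z] L[OF f] L[OF g]]) }
    assume W: "qfun W" and f: "intertwines W X f" and g: "intertwines X Y g" and h: "intertwines Y Z h"
    show "(h \<circ>\<^sub>l g) \<circ>\<^sub>l f = h \<circ>\<^sub>l (g \<circ>\<^sub>l f)"
      by (rule lcomp_assoc[OF qfun_fd[OF W] qfun_fd[OF X] L[OF f] L[OF g] L[OF h]])
  qed
  moreover have "linear_dagger_category_axioms ?C"
  proof (rule linear_dagger_category_axioms.intro, unfold C)
    fix X Y Z :: "'h hilb \<times> ('h \<times> 'a \<Rightarrow> complex, 'b \<times> 'h \<Rightarrow> complex) linmap" and f f' g g' c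
    assume X: "qfun X" and Y: "qfun Y"
    note H = qfun_fd[OF X] and K = qfun_fd[OF Y]
    show "vectorspace class_ring (Hom ?C X Y)" by (rule vectorspace_Hom[OF X Y])
    show "vectorspace.fin_dim class_ring (Hom ?C X Y)" by (rule fin_dim_Hom[OF X Y])
    { assume f: "intertwines X Y f"
      show "(lscale (fst X) (fst Y) c f)\<^sup>\<dagger> = lscale (fst Y) (fst X) (cnj c) (f\<^sup>\<dagger>)"
        by (rule adj_lscale[OF H K L[OF f]])
      assume g: "intertwines X Y g"
      show "(ladd (fst X) (fst Y) f g)\<^sup>\<dagger> = ladd (fst Y) (fst X) (f\<^sup>\<dagger>) (g\<^sup>\<dagger>)"
        by (rule adj_ladd[OF H K L[OF f] L[OF g]]) }
    assume Z: "qfun Z" and f: "intertwines X Y f"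
    note M = qfun_fd[OF Z]
    { assume g: "intertwines Y Z g"
      show "lscale (fst Y) (fst Z) c g \<circ>\<^sub>l f = lscale (fst X) (fst Z) c (g \<circ>\<^sub>l f)"
        by (rule lcomp_lscale_left[OF H K M L[OF f] L[OF g]])
      show "g \<circ>\<^sub>l lscale (fst X) (fst Y) c f = lscale (fst X) (fst Z) c (g \<circ>\<^sub>l f)"
        by (rule lcomp_lscale_right[OF H K M L[OF f] L[OF g]])
      assume g': "intertwines Y Z g'"
      show "ladd (fst Y) (fst Z) g g' \<circ>\<^sub>l f = ladd (fst X) (fst Z) (g \<circ>\<^sub>l f) (g' \<circ>\<^sub>l f)"
        by (rule lcomp_ladd_left[OF H K M L[OF f] L[OF g] L[OF g']]) }
    assume f': "intertwines X Y f'" and g: "intertwines Y Z g"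
    show "g \<circ>\<^sub>l ladd (fst X) (fst Y) f f' = ladd (fst X) (fst Z) (g \<circ>\<^sub>l f) (g \<circ>\<^sub>l f')"
      by (rule lcomp_ladd_right[OF H K M L[OF f] L[OF f'] L[OF g]])
  qed
  moreover have "semisimple_dagger_category_axioms ?C"
  \<comment> \<open>Bounded quantifiers are expanded first, so that the membership facts in
    \<open>C\<close> can rewrite their ranges.\<close>
  proof (rule semisimple_dagger_category_axioms.intro, unfold Bex_def Ball_def, unfold C)
    fix X Y :: "'h hilb \<times> ('h \<times> 'a \<Rightarrow> complex, 'b \<times> 'h \<Rightarrow> complex) linmap" and r p
    show "\<exists>Z. qfun Z \<and> (\<forall>X. qfun X \<longrightarrow>
      (\<exists>!f. intertwines X Z f) \<and> (\<exists>!f :: ('h, 'h) linmap. intertwines Z X f))"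
    proof -
      obtain Z where Z: "qfun Z" "fst Z = (zero_hilb :: 'h hilb)" using ex_zero_object by blast
      \<comment> \<open>A linear map into or out of the one-point space is the zero map, and the
        zero map is an intertwiner.\<close>
      have "(\<exists>!f. intertwines X Z f) \<and> (\<exists>!f. intertwines Z X f)" if X: "qfun X" for X
      proof
        show "\<exists>!f. intertwines X Z f"
          using intertwines_lzero[OF X Z(1)] Lin_zero_hilb_unique(1)[OF qfun_fd[OF X]] L Z(2) by metis
        show "\<exists>!f. intertwines Z X f"
          using intertwines_lzero[OF Z(1) X] Lin_zero_hilb_unique(2)[OF qfun_fd[OF X]] L Z(2) by metis
      qed
      with Z show ?thesis by blast
    qed
    assume X: "qfun X"
    { assume "intertwines X X p" "p \<circ>\<^sub>l p = p" "p\<^sup>\<dagger> = p"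
      then show "\<exists>Y. qfun Y \<and> (\<exists>i. intertwines Y X i \<and> i\<^sup>\<dagger> \<circ>\<^sub>l i = lid (fst Y) \<and> i \<circ>\<^sub>l i\<^sup>\<dagger> = p)"
        using ex_splitting_qfun[OF X] by blast }
    assume Y: "qfun Y"
    show "\<exists>Z. qfun Z \<and> (\<exists>s. intertwines X Z s \<and> (\<exists>t. intertwines Y Z t \<and>
      s\<^sup>\<dagger> \<circ>\<^sub>l s = lid (fst X) \<and> t\<^sup>\<dagger> \<circ>\<^sub>l t = lid (fst Y) \<and>
      ladd (fst Z) (fst Z) (s \<circ>\<^sub>l s\<^sup>\<dagger>) (t \<circ>\<^sub>l t\<^sup>\<dagger>) = lid (fst Z)))"
      using ex_direct_sum_qfun[OF X Y] by blast
    assume r: "intertwines X Y r" and "r\<^sup>\<dagger> \<circ>\<^sub>l r = lzero (fst X) (fst X)"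
    then show "r = lzero (fst X) (fst Y)"
      by (intro adj_lcomp_eq_lzero[OF qfun_fd[OF X] qfun_fd[OF Y] L[OF r]])
  qed
  ultimately show "semisimple_dagger_category ?C"
    by (intro semisimple_dagger_category.intro linear_dagger_category.intro)
qed

end

theorem theorem6p4:
  fixes A :: "'a frob" and B :: "'b frob"
  assumes "quantum_set A" and "quantum_set B"
  shows "semisimple_dagger_category
    (QSet A B :: ('h hilb \<times> ('h \<times> 'a \<Rightarrow> complex, 'b \<times> 'h \<Rightarrow> complex) linmap,
       ('h, 'h) linmap) dcat)"
proof -
  interpret qset_pair A B
    by (intro qset_pair.intro qset.intro assms)
  show ?thesis by (rule semisimple_QSet)
qed

end
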